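(* Let $P,Q$ be strongly guarded $\mathbb{CCSP}_t$ processes. If $P\simeq_{rbr}Q$ then $Ax^\infty_r\vdash P=Q$.
   Context: $Act=A\uplus\{\tau,t\}$ ($A$ visible actions, $\tau$ hidden, $t$ time-out); $A_\tau:=A\cup\{\tau\}$. $\mathbb{CCSP}_t$: for a countable set $V$ of variables, expressions are $E::=0\mid x\mid\alpha.E\mid E+F\mid E\parallel_S F\mid\tau_I(E)\mid\mathcal R(E)\mid\theta_L^U(E)\mid\psi_X(E)\mid\langle y\mid\mathcal S\rangle$ with $x\in V$, $\alpha\in Act$, $S,I,L,U,X\subseteq A$, $L\subseteq U$, $\mathcal R\subseteq A\times A$ with each $\{b\mid(a,b)\in\mathcal R\}$ finite, $\mathcal S$ a recursive specification (a set $\{x=\mathcal S_x\mid x\in V_{\mathcal S}\}$, $V_{\mathcal S}\subseteq V$, each $\mathcal S_x$ an expression) and $y\in V_{\mathcal S}$. The $\mathcal S_x$ are subexpressions of $\langle y|\mathcal S\rangle$; an occurrence of $x$ is bound if it lies in a subexpression $\langle y|\mathcal S\rangle$ with $x\in V_{\mathcal S}$, else free. An expression is invalid if it has a subexpression $\theta_L^U(F)$ or $\psi_X(F)$ with a variable occurrence free in $F$ but bound in the whole expression; processes are valid expressions without free variables. $\theta_X:=\theta_X^X$. $\langle E|\mathcal S\rangle$ is $E$ with each free $y\in V_{\mathcal S}$ replaced by $\langle y|\mathcal S\rangle$. $\mathcal I(P):=\{\alpha\in A_\tau\mid\exists Q.\,P\xrightarrow{\alpha}Q\}$; transitions are the least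 relation satisfying ($\alpha\in Act$, $a,b\in A$): $\alpha.x\xrightarrow{\alpha}x$; $x\xrightarrow{\alpha}x'$ implies $x+y\xrightarrow{\alpha}x'$ and $y+x\xrightarrow{\alpha}x'$; $x\xrightarrow{a}x'$, $(a,b)\in\mathcal R$ imply $\mathcal R(x)\xrightarrow{b}\mathcal R(x')$; $x\xrightarrow{\tau}x'$ implies $\mathcal R(x)\xrightarrow{\tau}\mathcal R(x')$; $x\xrightarrow{t}x'$ implies $\mathcal R(x)\xrightarrow{t}\mathcal R(x')$; $x\xrightarrow{\alpha}x'$, $\alpha\notin S$ imply $x\parallel_S y\xrightarrow{\alpha}x'\parallel_S y$ and $y\parallel_S x\xrightarrow{\alpha}y\parallel_S x'$; $x\xrightarrow{a}x'$, $y\xrightarrow{a}y'$, $a\in S$ imply $x\parallel_S y\xrightarrow{a}x'\parallel_S y'$; $x\xrightarrow{\alpha}x'$, $\alpha\notin I$ imply $\tau_I(x)\xrightarrow{\alpha}\tau_I(x')$; $x\xrightarrow{a}x'$, $a\in I$ imply $\tau_I(x)\xrightarrow{\tau}\tau_I(x')$; $\langle\mathcal S_x|\mathcal S\rangle\xrightarrow{\alpha}x'$ implies $\langle x|\mathcal S\rangle\xrightarrow{\alpha}x'$; $x\xrightarrow{\tau}x'$ implies $\theta_L^U(x)\xrightarrow{\tau}\theta_L^U(x')$; $x\xrightarrow{a}x'$, $a\in U$ imply $\theta_L^U(x)\xrightarrow{a}x'$; $x\xrightarrow{\alpha}x'$ and $\mathcal I(x)\cap(L\cup\{\tau\})=\emptyset$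 imply $\theta_L^U(x)\xrightarrow{\alpha}x'$; $x\xrightarrow{\alpha}x'$, $\alpha\neq t$ imply $\psi_X(x)\xrightarrow{\alpha}x'$; $x\xrightarrow{t}x'$ and $\mathcal I(x)\cap(X\cup\{\tau\})=\emptyset$ imply $\psi_X(x)\xrightarrow{t}\theta_X(x')$. Notation: $P\xrightarrow{(\alpha)}P'$ means ($\alpha=\tau$ and $P=P'$) or $P\xrightarrow{\alpha}P'$; $\Longrightarrow$ is the reflexive-transitive closure of $\xrightarrow{\tau}$; $P\not\xrightarrow{\tau}$ means no $\tau$-transition. $\simeq_{br}$, $\simeq^X_{br}$: a concrete branching reactive bisimulation is a symmetric relation on pairs and triples $(P,X,Q)$ ($X\subseteq A$) of processes such that: 1. if $\mathcal R(P,Q)$: (a) if $P\xrightarrow{\alpha}P'$, $\alpha\in A_\tau$, there is $Q\Longrightarrow Q_1\xrightarrow{(\alpha)}Q_2$ with $\mathcal R(P,Q_1)$, $\mathcal R(P',Q_2)$; (b) $\mathcal R(P,Y,Q)$ for all $Y\subseteq A$; 2. if $\mathcal R(P,X,Q)$: (a) if $P\xrightarrow{\tau}P'$ there is $Q\Longrightarrow Q_1\xrightarrow{(\tau)}Q_2$ with $\mathcal R(P,X,Q_1)$, $\mathcal R(P',X,Q_2)$; (b) if $P\xrightarrow{a}P'$, $a\in X$, there is $Q\Longrightarrow Q_1\xrightarrow{a}Q_2$ with $\mathcal R(P,X,Q_1)$, $\mathcal R(P',Q_2)$; (c) if $\mathcal I(P)\cap(X\cup\{\tau\})=\emptyset$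 there is $Q\Longrightarrow Q_0$ with $\mathcal R(P,Q_0)$; (d) if $\mathcal I(P)\cap(X\cup\{\tau\})=\emptyset$ and $P\xrightarrow{t}P'$ there is $Q\Longrightarrow Q_1\xrightarrow{t}Q_2$ with $\mathcal R(P',X,Q_2)$; (e) if $P\not\xrightarrow{\tau}$ there is $Q\Longrightarrow Q_0\not\xrightarrow{\tau}$. $P\simeq_{br}Q$ / $P\simeq^X_{br}Q$ iff $\mathcal R(P,Q)$ / $\mathcal R(P,X,Q)$ for some such $\mathcal R$. $P\simeq_{rbr}Q$ iff $\mathcal R(P,Q)$ for some symmetric relation of the same type with: 1. if $\mathcal R(P,Q)$: (a) if $P\xrightarrow{\alpha}P'$, $\alpha\in A_\tau$, then $Q\xrightarrow{\alpha}Q'$ with $P'\simeq_{br}Q'$; (b) $\mathcal R(P,Y,Q)$ for all $Y$; 2. if $\mathcal R(P,X,Q)$: (a) if $P\xrightarrow{\tau}P'$ then $Q\xrightarrow{\tau}Q'$ with $P'\simeq^X_{br}Q'$; (b) if $P\xrightarrow{a}P'$, $a\in X$, then $Q\xrightarrow{a}Q'$ with $P'\simeq_{br}Q'$; (c) if $\mathcal I(P)\cap(X\cup\{\tau\})=\emptyset$ then $\mathcal R(P,Q)$; (d) if moreover $P\xrightarrow{t}P'$ then $Q\xrightarrow{t}Q'$ with $P'\simeq^X_{br}Q'$. Guardedness: an occurrence of $x$ is well-guarded if it lies in a subexpression $a.F$ with $a\in A\cup\{t\}$. $\mathcal S$ is manifestly well-guarded if no $\tau_I$ occurs in $\mathcal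 S$ and for all $x,y\in V_{\mathcal S}$ all occurrences of $x$ in $\mathcal S_y$ are well-guarded; well-guarded if it can be made manifestly well-guarded by repeatedly substituting $\mathcal S_y$ for $y$ within the $\mathcal S_x$. A process is guarded if every recursive specification occurring in it is well-guarded; strongly guarded if moreover there is no infinite path of $\tau$-transitions starting from any process reachable from it. Axioms (variables range over expressions; $\alpha,\beta\in Act$; empty sums are $0$): (A) $x+(y+z)=(x+y)+z$; $x+y=y+x$; $x+x=x$; $x+0=x$; $\tau_I(x+y)=\tau_I(x)+\tau_I(y)$; $\tau_I(\alpha.x)=\alpha.\tau_I(x)$ if $\alpha\notin I$; $\tau_I(\alpha.x)=\tau.\tau_I(x)$ if $\alpha\in I$; $\mathcal R(x+y)=\mathcal R(x)+\mathcal R(y)$; $\mathcal R(\tau.x)=\tau.\mathcal R(x)$; $\mathcal R(t.x)=t.\mathcal R(x)$; $\mathcal R(a.x)=\sum_{\{b\mid(a,b)\in\mathcal R\}}b.\mathcal R(x)$; Expansion: if $P=\sum_{i\in I}\alpha_i.P_i$ and $Q=\sum_{j\in J}\beta_j.Q_j$ then $P\parallel_SQ=\sum_{i\in I,\alpha_i\notin S}\alpha_i.(P_i\parallel_SQ)+\sum_{j\in J,\beta_j\notin S}\beta_j.(P\parallel_SQ_j)+\sum_{i\in I,j\in J,\alpha_i=\beta_j\in S}\alpha_i.(P_i\parallel_SQ_j)$; Branching axiom $\alpha.(\tau.(x+y)+x)=\alpha.(x+y)$; RDP: $\langle x|\mathcal S\rangle=\langle\mathcal S_x|\mathcal S\rangle$;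 RSP: for well-guarded $\mathcal S$, if expressions $\rho(y)$ ($y\in V_{\mathcal S}$) satisfy $\rho(y)=\mathcal S_y[\rho]$ for all $y$, then $\rho(x)=\langle x|\mathcal S\rangle$. (B) $\theta_L^U(\sum_{i\in I}\alpha_i.x_i)=\sum_{i\in I}\alpha_i.x_i$ if all $\alpha_i\notin L\cup\{\tau\}$; $\theta_L^U(x+\alpha.y+\beta.z)=\theta_L^U(x+\alpha.y)$ if $\alpha\in L\cup\{\tau\}$, $\beta\notin U\cup\{\tau\}$; $\theta_L^U(x+\alpha.y+\beta.z)=\theta_L^U(x+\alpha.y)+\theta_L^U(\beta.z)$ if $\alpha\in L\cup\{\tau\}$, $\beta\in U\cup\{\tau\}$; $\theta_L^U(\alpha.x)=\alpha.x$ if $\alpha\neq\tau$; $\theta_L^U(\tau.x)=\tau.\theta_L^U(x)$; $\psi_X(x+\alpha.y)=\psi_X(x)+\alpha.y$ if $\alpha\notin X\cup\{\tau,t\}$; $\psi_X(x+\alpha.y+t.z)=\psi_X(x+\alpha.y)$ if $\alpha\in X\cup\{\tau\}$; $\psi_X(x+\alpha.y+\beta.z)=\psi_X(x+\alpha.y)+\beta.z$ if $\alpha,\beta\in X\cup\{\tau\}$; $\psi_X(\alpha.x)=\alpha.x$ if $\alpha\neq t$; $\psi_X(\sum_{i\in I}t.y_i)=\sum_{i\in I}t.\theta_X(y_i)$. (C) Reactive approximation axiom: if $\psi_X(x)=\psi_X(y)$ for all $X\subseteq A$ then $x=y$. $Ax^\infty_r$ := axioms (A), (B) and (C). $Ax^\infty_r\vdash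 E=F$ means derivable in equational logic (reflexivity, symmetry, transitivity, instantiation, replacement in contexts), with RSP and (C) used as conditional inference rules.
   Formalization: The axioms are extended by τ_I(0)=0 and R(0)=0 (the distribution laws for empty sums): from the listed axioms alone τ_I(0)=0 is not derivable, although τ_I(0) and 0 are strongly guarded and rooted branching reactive bisimilar. *)

theory Defs
  imports Main
begin

section \<open>Syntax\<close>

text \<open>The type variable \<open>'a\<close> is the set of visible actions; the variables are the natural numbers.
  \<open>Tau\<close> is the hidden action and \<open>Tout\<close> the time-out.\<close>

datatype 'a act = Vis 'a | Tau | Tout

type_synonym var = nat

text \<open>In \<open>Rec y S\<close>, i.e. \<open>\<langle>y|S\<rangle>\<close>, the recursive specification \<open>S\<close> is a partial function with
  domain \<open>V\<^sub>S\<close> mapping \<open>x\<close> to \<open>S\<^sub>x\<close>; it may be infinite.  The side conditions of the grammar are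
  imposed by \<open>wf_expr\<close> below.\<close>

datatype 'a expr =
    Zero
  | Var var
  | Prefix "'a act" "'a expr"
  | Plus "'a expr" "'a expr"
  | Par "'a set" "'a expr" "'a expr"
  | Hide "'a set" "'a expr"
  | Rename "('a \<times> 'a) set" "'a expr"
  | Theta "'a set" "'a set" "'a expr"  \<comment> \<open>\<open>Theta L U E\<close> is \<open>\<theta>\<close> with lower index \<open>L\<close> and upper index \<open>U\<close>\<close>
  | Psi "'a set" "'a expr"
  | Rec var "var \<Rightarrow> 'a expr option"

type_synonym 'a spec = "var \<Rightarrow> 'a expr option"

fun children :: "'a expr \<Rightarrow> 'a expr set" where
  "children Zero = {}"
| "children (Var x) = {}"
| "children (Prefix \<alpha> E) = {E}"
| "children (Plus E F) = {E, F}"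
| "children (Par A E F) = {E, F}"
| "children (Hide I E) = {E}"
| "children (Rename R E) = {E}"
| "children (Theta L U E) = {E}"
| "children (Psi X E) = {E}"
| "children (Rec y S) = ran S"

inductive subexpr :: "'a expr \<Rightarrow> 'a expr \<Rightarrow> bool" where
  subexpr_refl: "subexpr E E"
| subexpr_child: "\<lbrakk> subexpr G F; F \<in> children E \<rbrakk> \<Longrightarrow> subexpr G E"

definition wf_expr :: "'a expr \<Rightarrow> bool" where
  "wf_expr E \<longleftrightarrow>
     (\<forall>L U F. subexpr (Theta L U F) E \<longrightarrow> L \<subseteq> U) \<and>
     (\<forall>R F. subexpr (Rename R F) E \<longrightarrow> (\<forall>a. finite {b. (a, b) \<in> R})) \<and>
     (\<forall>y S. subexpr (Rec y S) E \<longrightarrow> y \<in> dom S)"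

primrec fv :: "'a expr \<Rightarrow> var set" where
  "fv Zero = {}"
| "fv (Var x) = {x}"
| "fv (Prefix \<alpha> E) = fv E"
| "fv (Plus E F) = fv E \<union> fv F"
| "fv (Par A E F) = fv E \<union> fv F"
| "fv (Hide I E) = fv E"
| "fv (Rename R E) = fv E"
| "fv (Theta L U E) = fv E"
| "fv (Psi X E) = fv E"
| "fv (Rec y S) = \<Union> (ran (\<lambda>x. map_option fv (S x))) - dom S"

text \<open>A variable occurrence that is free in \<open>F\<close> is bound in \<open>E\<close> iff \<open>F\<close> lies within a recursion
  \<open>\<langle>y|S\<rangle>\<close> in \<open>E\<close> that binds it.\<close>

definition valid :: "'a expr \<Rightarrow> bool" where
  "valid E \<longleftrightarrow> \<not> (\<exists>y S F x. subexpr (Rec y S) E \<and>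
     ((\<exists>L U. subexpr (Theta L U F) (Rec y S)) \<or> (\<exists>X. subexpr (Psi X F) (Rec y S))) \<and>
     x \<in> fv F \<and> x \<in> dom S)"

definition ccsp :: "'a expr \<Rightarrow> bool" where
  "ccsp E \<longleftrightarrow> wf_expr E \<and> valid E"

definition process :: "'a expr \<Rightarrow> bool" where
  "process P \<longleftrightarrow> ccsp P \<and> fv P = {}"


section \<open>Substitution\<close>

text \<open>Literal replacement of free occurrences, without renaming.  It is only used to unfold
  recursions of processes, where all substituted expressions are closed.\<close>

primrec subst :: "'a expr \<Rightarrow> (var \<Rightarrow> 'a expr) \<Rightarrow> 'a expr" where
  "subst Zero \<sigma> = Zero"
| "subst (Var x) \<sigma> = \<sigma> x"
| "subst (Prefix \<alpha> E) \<sigma> = Prefix \<alpha> (subst E \<sigma>)"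
| "subst (Plus E F) \<sigma> = Plus (subst E \<sigma>) (subst F \<sigma>)"
| "subst (Par A E F) \<sigma> = Par A (subst E \<sigma>) (subst F \<sigma>)"
| "subst (Hide I E) \<sigma> = Hide I (subst E \<sigma>)"
| "subst (Rename R E) \<sigma> = Rename R (subst E \<sigma>)"
| "subst (Theta L U E) \<sigma> = Theta L U (subst E \<sigma>)"
| "subst (Psi X E) \<sigma> = Psi X (subst E \<sigma>)"
| "subst (Rec y S) \<sigma> =
     Rec y (\<lambda>x. map_option (\<lambda>E. subst E (\<lambda>v. if v \<in> dom S then Var v else \<sigma> v)) (S x))"

text \<open>The substitution \<open>\<lambda>y. \<langle>y|S\<rangle>\<close> for \<open>y \<in> V\<^sub>S\<close>; thus \<open>\<langle>E|S\<rangle>\<close> is \<open>subst E (rec_subst S)\<close>.\<close>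

definition rec_subst :: "'a spec \<Rightarrow> var \<Rightarrow> 'a expr" where
  "rec_subst S = (\<lambda>y. if y \<in> dom S then Rec y S else Var y)"

text \<open>Capture-avoiding simultaneous substitution on open expressions: \<open>is_subst \<sigma> E F\<close> says that
  \<open>F\<close> results from \<open>E\<close> by replacing each free \<open>x\<close> by \<open>\<sigma> x\<close>, after renaming the bound variables
  (by \<open>\<pi>\<close>) so that no free variable of a substituted expression gets captured.  \<open>F\<close> is determined
  up to the names of its bound variables.\<close>

inductive is_subst :: "(var \<Rightarrow> 'a expr) \<Rightarrow> 'a expr \<Rightarrow> 'a expr \<Rightarrow> bool" where
  "is_subst \<sigma> Zero Zero"
| "is_subst \<sigma> (Var x) (\<sigma> x)"
| "is_subst \<sigma> E E' \<Longrightarrow> is_subst \<sigma> (Prefix \<alpha> E) (Prefix \<alpha> E')"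
| "\<lbrakk> is_subst \<sigma> E E'; is_subst \<sigma> F F' \<rbrakk> \<Longrightarrow> is_subst \<sigma> (Plus E F) (Plus E' F')"
| "\<lbrakk> is_subst \<sigma> E E'; is_subst \<sigma> F F' \<rbrakk> \<Longrightarrow> is_subst \<sigma> (Par A E F) (Par A E' F')"
| "is_subst \<sigma> E E' \<Longrightarrow> is_subst \<sigma> (Hide I E) (Hide I E')"
| "is_subst \<sigma> E E' \<Longrightarrow> is_subst \<sigma> (Rename R E) (Rename R E')"
| "is_subst \<sigma> E E' \<Longrightarrow> is_subst \<sigma> (Theta L U E) (Theta L U E')"
| "is_subst \<sigma> E E' \<Longrightarrow> is_subst \<sigma> (Psi X E) (Psi X E')"
| "\<lbrakk> inj_on \<pi> (dom S); dom T = \<pi> ` dom S;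
     \<forall>v \<in> fv (Rec y S). fv (\<sigma> v) \<inter> \<pi> ` dom S = {};
     \<forall>x E. S x = Some E \<longrightarrow>
       (\<exists>F. T (\<pi> x) = Some F \<and>
            is_subst (\<lambda>v. if v \<in> dom S then Var (\<pi> v) else \<sigma> v) E F) \<rbrakk>
   \<Longrightarrow> is_subst \<sigma> (Rec y S) (Rec (\<pi> y) T)"


section \<open>Operational semantics\<close>

abbreviation vis_tau :: "'a set \<Rightarrow> 'a act set" where
  "vis_tau X \<equiv> insert Tau (Vis ` X)"

text \<open>The transition rules have negative premises.  They are first read relative to a function \<open>N\<close>
  that supplies the initials of the arguments of \<open>\<theta>\<close> and \<open>\<psi>\<close>.\<close>

inductive trans_wrt :: "('a expr \<Rightarrow> 'a act set) \<Rightarrow> 'a expr \<Rightarrow> 'a act \<Rightarrow> 'a expr \<Rightarrow> bool"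
  for N :: "'a expr \<Rightarrow> 'a act set" where
  prefix: "trans_wrt N (Prefix \<alpha> x) \<alpha> x"
| plus1: "trans_wrt N x \<alpha> x' \<Longrightarrow> trans_wrt N (Plus x y) \<alpha> x'"
| plus2: "trans_wrt N x \<alpha> x' \<Longrightarrow> trans_wrt N (Plus y x) \<alpha> x'"
| rename_vis: "\<lbrakk> trans_wrt N x (Vis a) x'; (a, b) \<in> R \<rbrakk>
    \<Longrightarrow> trans_wrt N (Rename R x) (Vis b) (Rename R x')"
| rename_tau: "trans_wrt N x Tau x' \<Longrightarrow> trans_wrt N (Rename R x) Tau (Rename R x')"
| rename_tout: "trans_wrt N x Tout x' \<Longrightarrow> trans_wrt N (Rename R x) Tout (Rename R x')"
| par1: "\<lbrakk> trans_wrt N x \<alpha> x'; \<alpha> \<notin> Vis ` S \<rbrakk> \<Longrightarrow> trans_wrt N (Par S x y) \<alpha> (Par S x' y)"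
| par2: "\<lbrakk> trans_wrt N x \<alpha> x'; \<alpha> \<notin> Vis ` S \<rbrakk> \<Longrightarrow> trans_wrt N (Par S y x) \<alpha> (Par S y x')"
| par_sync: "\<lbrakk> trans_wrt N x (Vis a) x'; trans_wrt N y (Vis a) y'; a \<in> S \<rbrakk>
    \<Longrightarrow> trans_wrt N (Par S x y) (Vis a) (Par S x' y')"
| hide_other: "\<lbrakk> trans_wrt N x \<alpha> x'; \<alpha> \<notin> Vis ` I \<rbrakk> \<Longrightarrow> trans_wrt N (Hide I x) \<alpha> (Hide I x')"
| hide_vis: "\<lbrakk> trans_wrt N x (Vis a) x'; a \<in> I \<rbrakk> \<Longrightarrow> trans_wrt N (Hide I x) Tau (Hide I x')"
| recursion: "\<lbrakk> S x = Some E; trans_wrt N (subst E (rec_subst S)) \<alpha> x' \<rbrakk>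
    \<Longrightarrow> trans_wrt N (Rec x S) \<alpha> x'"
| theta_tau: "trans_wrt N x Tau x' \<Longrightarrow> trans_wrt N (Theta L U x) Tau (Theta L U x')"
| theta_vis: "\<lbrakk> trans_wrt N x (Vis a) x'; a \<in> U \<rbrakk> \<Longrightarrow> trans_wrt N (Theta L U x) (Vis a) x'"
| theta_idle: "\<lbrakk> trans_wrt N x \<alpha> x'; N x \<inter> vis_tau L = {} \<rbrakk>
    \<Longrightarrow> trans_wrt N (Theta L U x) \<alpha> x'"
| psi_other: "\<lbrakk> trans_wrt N x \<alpha> x'; \<alpha> \<noteq> Tout \<rbrakk> \<Longrightarrow> trans_wrt N (Psi X x) \<alpha> x'"
| psi_tout: "\<lbrakk> trans_wrt N x Tout x'; N x \<inter> vis_tau X = {} \<rbrakk>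
    \<Longrightarrow> trans_wrt N (Psi X x) Tout (Theta X X x')"

definition initials_wrt :: "('a expr \<Rightarrow> 'a act set) \<Rightarrow> 'a expr \<Rightarrow> 'a act set" where
  "initials_wrt N P = {\<alpha>. \<alpha> \<noteq> Tout \<and> (\<exists>Q. trans_wrt N P \<alpha> Q)}"

text \<open>The intended \<open>N\<close> is a fixed point of the antitone operator \<open>initials_wrt\<close>.  Its well-founded
  model is used here: \<open>possible_initials\<close> overapproximates the initials of an arbitrary expression,
  so that a negative premise holds only if the transitions in question are certainly absent.  On
  processes the argument of \<open>\<theta>\<close> and \<open>\<psi>\<close> is always closed, the rules are stratified, and
  \<open>possible_initials\<close> coincides with the actual \<open>initials\<close>, see \<open>possible_initials_eq_initials\<close>.\<close>

definition possible_initials :: "'a expr \<Rightarrow> 'a act set" where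
  "possible_initials = gfp (\<lambda>N. initials_wrt (initials_wrt N))"

definition transition :: "'a expr \<Rightarrow> 'a act \<Rightarrow> 'a expr \<Rightarrow> bool" where
  "transition = trans_wrt possible_initials"

definition initials :: "'a expr \<Rightarrow> 'a act set" where
  "initials P = {\<alpha>. \<alpha> \<noteq> Tout \<and> (\<exists>Q. transition P \<alpha> Q)}"

lemma subexpr_free_or_bound:
  assumes "subexpr F E" "x \<in> fv F"
  shows "x \<in> fv E \<or> (\<exists>y S. subexpr (Rec y S) E \<and> subexpr F (Rec y S) \<and> x \<in> dom S)"
  using assms
proof (induction rule: subexpr.induct)
  case (subexpr_child G F E)
  from subexpr_child.IH[OF subexpr_child.prems] show ?case
  proof
    assume x: "x \<in> fv F"
    show ?thesis
    proof (cases "\<exists>y S. E = Rec y S \<and> x \<in> dom S")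
      case True
      then show ?thesis using subexpr.subexpr_child[OF subexpr_child.hyps] subexpr_refl by blast
    next
      case False
      then have "x \<in> fv E" using x subexpr_child.hyps(2)
        by (cases E) (auto simp: ran_def)
      then show ?thesis ..
    qed
  next
    assume "\<exists>y S. subexpr (Rec y S) F \<and> subexpr G (Rec y S) \<and> x \<in> dom S"
    then show ?thesis using subexpr_child.hyps(2) subexpr.subexpr_child by blast
  qed
qed simp

text \<open>\<open>F\<close> is the argument of some \<open>\<theta>\<close> or \<open>\<psi>\<close> in \<open>E\<close>.\<close>

definition body :: "'a expr \<Rightarrow> 'a expr \<Rightarrow> bool" where
  "body F E \<longleftrightarrow> (\<exists>L U. subexpr (Theta L U F) E) \<or> (\<exists>X. subexpr (Psi X F) E)"

lemma process_bodies_closed: "process P \<Longrightarrow> body F P \<Longrightarrow> fv F = {}"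
proof -
  assume P: "process P" and b: "body F P"
  have "x \<notin> fv F" if G: "subexpr G P" "(\<exists>X. G = Psi X F) \<or> (\<exists>L U. G = Theta L U F)" for x G
  proof
    assume "x \<in> fv F"
    then have "x \<in> fv G" using G(2) by auto
    then obtain y S where "subexpr (Rec y S) P" "subexpr G (Rec y S)" "x \<in> dom S"
      using subexpr_free_or_bound[OF G(1)] P unfolding process_def by blast
    then show False using P G(2) \<open>x \<in> fv F\<close> unfolding process_def ccsp_def valid_def by blast
  qed
  then show ?thesis using b unfolding body_def by blast
qed

lemma subexpr_simps:
  "subexpr G E \<longleftrightarrow> G = E \<or> (\<exists>F \<in> children E. subexpr G F)"
  by (subst subexpr.simps) auto

lemma body_unfold:
  "body F E \<longleftrightarrow> (\<exists>L U. E = Theta L U F) \<or> (\<exists>X. E = Psi X F) \<or> (\<exists>C \<in> children E. body F C)"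
  unfolding body_def by (subst (1 2) subexpr_simps) auto

lemma body_simps [simp]:
  "body F Zero \<longleftrightarrow> False" "body F (Var x) \<longleftrightarrow> False"
  "body F (Prefix \<alpha> E) \<longleftrightarrow> body F E"
  "body F (Plus E E') \<longleftrightarrow> body F E \<or> body F E'"
  "body F (Par A E E') \<longleftrightarrow> body F E \<or> body F E'"
  "body F (Hide I E) \<longleftrightarrow> body F E"
  "body F (Rename R E) \<longleftrightarrow> body F E"
  "body F (Theta L U E) \<longleftrightarrow> F = E \<or> body F E"
  "body F (Psi X E) \<longleftrightarrow> F = E \<or> body F E"
  "body F (Rec y S) \<longleftrightarrow> (\<exists>E \<in> ran S. body F E)"
  by (subst body_unfold; auto)+

lemma subst_closed: "(\<forall>v \<in> fv E. \<sigma> v = Var v) \<Longrightarrow> subst E \<sigma> = E"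
proof (induction E arbitrary: \<sigma>)
  case (Rec y S)
  have "map_option (\<lambda>E. subst E (\<lambda>v. if v \<in> dom S then Var v else \<sigma> v)) (S x) = S x" for x
  proof (cases "S x")
    case (Some E)
    have "\<forall>v \<in> fv E. (if v \<in> dom S then Var v else \<sigma> v) = Var v"
    proof
      fix v assume "v \<in> fv E"
      then have "v \<in> \<Union> (ran (\<lambda>x. map_option fv (S x)))" using Some by (auto simp: ran_def)
      then show "(if v \<in> dom S then Var v else \<sigma> v) = Var v" using Rec.prems by simp
    qed
    then have "subst E (\<lambda>v. if v \<in> dom S then Var v else \<sigma> v) = E"
      using Rec.IH[OF rangeI[of S x], of E] Some by simp
    then show ?thesis using Some by simp
  qed simp
  then show ?case by simp
qed auto

lemma body_subst:
  assumes "body F (subst E \<sigma>)" "\<And>G. body G E \<Longrightarrow> fv G = {}"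
  shows "body F E \<or> (\<exists>v. body F (\<sigma> v))"
  using assms
proof (induction E arbitrary: \<sigma>)
  case (Rec y S)
  let ?\<sigma> = "\<lambda>v. if v \<in> dom S then Var v else \<sigma> v"
  from Rec.prems(1) obtain z E where E: "S z = Some E" "body F (subst E ?\<sigma>)"
    by (auto simp: ran_def)
  have ran: "E \<in> ran S" using E(1) by (rule ranI)
  have "body F E \<or> (\<exists>v. body F (?\<sigma> v))"
  proof (rule Rec.IH[OF rangeI[of S z]])
    show "E \<in> set_option (S z)" using E(1) by simp
    show "body F (subst E ?\<sigma>)" by (rule E(2))
    show "fv G = {}" if "body G E" for G using Rec.prems(2)[of G] ran that by auto
  qed
  then show ?case
  proof
    assume "body F E" then show ?thesis using ran by auto
  next
    assume "\<exists>v. body F (?\<sigma> v)"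
    then obtain v where "body F (?\<sigma> v)" ..
    then show ?thesis by (cases "v \<in> dom S") auto
  qed
next
  case (Theta L U E)
  then show ?case using subst_closed[of E \<sigma>] by auto
next
  case (Psi X E)
  then show ?case using subst_closed[of E \<sigma>] by auto
qed auto

lemma trans_wrt_cong:
  assumes "trans_wrt N P \<alpha> Q"
    and "\<And>F. body F P \<Longrightarrow> N F = N' F" "\<And>F. body F P \<Longrightarrow> fv F = {}"
  shows "trans_wrt N' P \<alpha> Q"
  using assms
proof (induction rule: trans_wrt.induct)
  case (recursion S x E \<alpha> x')
  have "body F (Rec x S)" if "body F (subst E (rec_subst S))" for F
  proof -
    have "body F E \<or> (\<exists>v. body F (rec_subst S v))"
      using body_subst[OF that] recursion.prems(2) ranI[of S x E] recursion.hyps(1) by auto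
    then show ?thesis
    proof
      assume "body F E" then show ?thesis using ranI[of S x E] recursion.hyps(1) by auto
    next
      assume "\<exists>v. body F (rec_subst S v)"
      then obtain v where "body F (rec_subst S v)" ..
      then show ?thesis by (cases "v \<in> dom S") (auto simp: rec_subst_def)
    qed
  qed
  then show ?case using recursion trans_wrt.recursion by blast
next
  case (theta_idle x \<alpha> x' L U)
  then have "N' x \<inter> vis_tau L = {}" using theta_idle.prems(1)[of x] by simp
  then show ?case using theta_idle by (intro trans_wrt.theta_idle) auto
next
  case (psi_tout x x' X)
  then have "N' x \<inter> vis_tau X = {}" using psi_tout.prems(1)[of x] by simp
  then show ?case using psi_tout by (intro trans_wrt.psi_tout) auto
qed (auto intro: trans_wrt.intros)

lemma trans_wrt_antimono:
  assumes "trans_wrt N P \<alpha> Q" "N' \<le> N" shows "trans_wrt N' P \<alpha> Q"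
  using assms(1)
proof (induction rule: trans_wrt.induct)
  case theta_idle then show ?case using assms(2) by (intro trans_wrt.theta_idle) (auto simp: le_fun_def)
next
  case psi_tout then show ?case using assms(2) by (intro trans_wrt.psi_tout) (auto simp: le_fun_def)
qed (auto intro: trans_wrt.intros)

lemma initials_wrt_antimono: "N' \<le> N \<Longrightarrow> initials_wrt N \<le> initials_wrt N'"
  by (rule le_funI) (auto simp: initials_wrt_def dest: trans_wrt_antimono)

lemma possible_initials_unfold:
  "possible_initials = initials_wrt (initials_wrt possible_initials)"
  unfolding possible_initials_def
  by (rule gfp_unfold) (auto intro!: monoI initials_wrt_antimono)

lemma initials_eq: "initials = initials_wrt possible_initials"
  by (auto simp: initials_def initials_wrt_def transition_def fun_eq_iff)

lemma subexpr_trans: "subexpr G F \<Longrightarrow> subexpr F E \<Longrightarrow> subexpr G E"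
  by (rotate_tac, induction rule: subexpr.induct) (auto intro: subexpr.intros)

lemma body_child:
  assumes "body G E" shows "\<exists>C \<in> children E. subexpr G C"
proof -
  have "\<exists>C \<in> children E. subexpr G C" if H: "subexpr H E" "G \<in> children H" for H
    using H(1)[unfolded subexpr_simps[of H E]]
  proof
    assume "H = E" then show ?thesis using H(2) subexpr_refl by blast
  next
    assume "\<exists>F \<in> children E. subexpr H F"
    then show ?thesis using subexpr_trans[OF subexpr_child[OF subexpr_refl H(2)]] by blast
  qed
  then show ?thesis using assms unfolding body_def by fastforce
qed

lemma body_subexpr: "body G F \<Longrightarrow> subexpr F E \<Longrightarrow> body G E"
  unfolding body_def using subexpr_trans by blast

theorem possible_initials_eq_initials:
  assumes "process P"
  shows "possible_initials P = initials P"
proof -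
  define good :: "'a expr \<Rightarrow> bool" where "good F \<longleftrightarrow> (\<forall>G. body G F \<longrightarrow> fv G = {})" for F
  define K :: "'a expr \<Rightarrow> bool" where
    "K E \<longleftrightarrow> (\<forall>F. subexpr F E \<longrightarrow> good F \<longrightarrow> possible_initials F = initials F)" for E
  have step: "K E" if IH: "\<And>C. C \<in> children E \<Longrightarrow> K C" for E
    unfolding K_def
  proof (intro allI impI)
    fix F assume F: "subexpr F E" and cl: "good F"
    show "possible_initials F = initials F"
    proof (cases "F = E")
      case True
      have agree: "possible_initials G = initials G" if G: "body G F" for G
      proof -
        obtain C where C: "C \<in> children E" "subexpr G C" using body_child[OF G] True by blast
        have "good G" unfolding good_def
        proof (intro allI impI)
          fix H assume "body H G"
          then have "body H F"
            using body_subexpr[OF _ subexpr_child[OF C(2,1)]] True by blast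
          then show "fv H = {}" using cl good_def by blast
        qed
        then show ?thesis using IH[OF C(1)] C(2) unfolding K_def by blast
      qed
      have "trans_wrt possible_initials F \<alpha> Q \<longleftrightarrow> trans_wrt initials F \<alpha> Q" for \<alpha> Q
        using trans_wrt_cong[of _ F \<alpha> Q] agree cl unfolding good_def by metis
      then have "initials_wrt possible_initials F = initials_wrt initials F"
        by (simp add: initials_wrt_def)
      then show ?thesis using possible_initials_unfold initials_eq by metis
    next
      case False
      then show ?thesis using F IH cl unfolding K_def by (metis subexpr_simps)
    qed
  qed
  have "K E" for E
  proof (induction E)
    case (Rec y S)
    have "K C" if "C \<in> ran S" for C
    proof -
      from that obtain x where "S x = Some C" by (auto simp: ran_def)
      then show ?thesis using Rec.IH[OF rangeI[of S x], of C] by simp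
    qed
    then show ?case using step[of "Rec y S"] by simp
  qed (rule step; auto)+
  moreover have "good P"
    using process_bodies_closed[OF assms] by (simp add: good_def)
  ultimately show ?thesis unfolding K_def using subexpr_refl by blast
qed

lemma process_body:
  assumes "process P" "body F P"
  shows "process F"
proof -
  have sub: "subexpr F P"
    using body_child[OF assms(2)] subexpr_child by blast
  have sub': "subexpr G P" if "subexpr G F" for G
    using subexpr_trans[OF that sub] .
  have "wf_expr P" "valid P" using assms(1) by (simp_all add: process_def ccsp_def)
  then have "wf_expr F" "valid F" unfolding wf_expr_def valid_def by (meson sub')+
  then show ?thesis
    using process_bodies_closed[OF assms] by (simp add: process_def ccsp_def)
qed

definition tau_steps :: "'a expr \<Rightarrow> 'a expr \<Rightarrow> bool" where
  "tau_steps = (\<lambda>P Q. transition P Tau Q)\<^sup>*\<^sup>*"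

text \<open>The transition with a bracketed label \<open>(\<alpha>)\<close>.\<close>

definition trans_opt :: "'a expr \<Rightarrow> 'a act \<Rightarrow> 'a expr \<Rightarrow> bool" where
  "trans_opt P \<alpha> P' \<longleftrightarrow> (\<alpha> = Tau \<and> P = P') \<or> transition P \<alpha> P'"

definition stable :: "'a expr \<Rightarrow> bool" where
  "stable P \<longleftrightarrow> \<not> (\<exists>P'. transition P Tau P')"


section \<open>Branching reactive bisimilarity\<close>

text \<open>A relation on pairs and triples is represented by its pairs \<open>B\<close> and its triples \<open>T\<close>.\<close>

definition sym_process_rel ::
  "('a expr \<Rightarrow> 'a expr \<Rightarrow> bool) \<Rightarrow> ('a expr \<Rightarrow> 'a set \<Rightarrow> 'a expr \<Rightarrow> bool) \<Rightarrow> bool" where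
  "sym_process_rel B T \<longleftrightarrow>
     (\<forall>P Q. B P Q \<longrightarrow> process P \<and> process Q \<and> B Q P) \<and>
     (\<forall>P X Q. T P X Q \<longrightarrow> process P \<and> process Q \<and> T Q X P)"

definition br_bisimulation ::
  "('a expr \<Rightarrow> 'a expr \<Rightarrow> bool) \<Rightarrow> ('a expr \<Rightarrow> 'a set \<Rightarrow> 'a expr \<Rightarrow> bool) \<Rightarrow> bool" where
  "br_bisimulation B T \<longleftrightarrow> sym_process_rel B T \<and>
     (\<forall>P Q. B P Q \<longrightarrow>
        (\<forall>\<alpha> P'. \<alpha> \<noteq> Tout \<and> transition P \<alpha> P' \<longrightarrow>
           (\<exists>Q1 Q2. tau_steps Q Q1 \<and> trans_opt Q1 \<alpha> Q2 \<and> B P Q1 \<and> B P' Q2)) \<and>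
        (\<forall>Y. T P Y Q)) \<and>
     (\<forall>P X Q. T P X Q \<longrightarrow>
        (\<forall>P'. transition P Tau P' \<longrightarrow>
           (\<exists>Q1 Q2. tau_steps Q Q1 \<and> trans_opt Q1 Tau Q2 \<and> T P X Q1 \<and> T P' X Q2)) \<and>
        (\<forall>a P'. transition P (Vis a) P' \<and> a \<in> X \<longrightarrow>
           (\<exists>Q1 Q2. tau_steps Q Q1 \<and> transition Q1 (Vis a) Q2 \<and> T P X Q1 \<and> B P' Q2)) \<and>
        (initials P \<inter> vis_tau X = {} \<longrightarrow> (\<exists>Q0. tau_steps Q Q0 \<and> B P Q0)) \<and>
        (\<forall>P'. initials P \<inter> vis_tau X = {} \<and> transition P Tout P' \<longrightarrow>
           (\<exists>Q1 Q2. tau_steps Q Q1 \<and> transition Q1 Tout Q2 \<and> T P' X Q2)) \<and>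
        (stable P \<longrightarrow> (\<exists>Q0. tau_steps Q Q0 \<and> stable Q0)))"

definition br_bisim :: "'a expr \<Rightarrow> 'a expr \<Rightarrow> bool" where
  "br_bisim P Q \<longleftrightarrow> (\<exists>B T. br_bisimulation B T \<and> B P Q)"

definition br_bisim_env :: "'a expr \<Rightarrow> 'a set \<Rightarrow> 'a expr \<Rightarrow> bool" where
  "br_bisim_env P X Q \<longleftrightarrow> (\<exists>B T. br_bisimulation B T \<and> T P X Q)"

definition rbr_bisimulation ::
  "('a expr \<Rightarrow> 'a expr \<Rightarrow> bool) \<Rightarrow> ('a expr \<Rightarrow> 'a set \<Rightarrow> 'a expr \<Rightarrow> bool) \<Rightarrow> bool" where
  "rbr_bisimulation B T \<longleftrightarrow> sym_process_rel B T \<and>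
     (\<forall>P Q. B P Q \<longrightarrow>
        (\<forall>\<alpha> P'. \<alpha> \<noteq> Tout \<and> transition P \<alpha> P' \<longrightarrow> (\<exists>Q'. transition Q \<alpha> Q' \<and> br_bisim P' Q')) \<and>
        (\<forall>Y. T P Y Q)) \<and>
     (\<forall>P X Q. T P X Q \<longrightarrow>
        (\<forall>P'. transition P Tau P' \<longrightarrow> (\<exists>Q'. transition Q Tau Q' \<and> br_bisim_env P' X Q')) \<and>
        (\<forall>a P'. transition P (Vis a) P' \<and> a \<in> X \<longrightarrow> (\<exists>Q'. transition Q (Vis a) Q' \<and> br_bisim P' Q')) \<and>
        (initials P \<inter> vis_tau X = {} \<longrightarrow> B P Q) \<and>
        (\<forall>P'. initials P \<inter> vis_tau X = {} \<and> transition P Tout P' \<longrightarrow>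
           (\<exists>Q'. transition Q Tout Q' \<and> br_bisim_env P' X Q')))"

definition rbr_bisim :: "'a expr \<Rightarrow> 'a expr \<Rightarrow> bool" where
  "rbr_bisim P Q \<longleftrightarrow> (\<exists>B T. rbr_bisimulation B T \<and> B P Q)"


section \<open>Guardedness\<close>

text \<open>The variables with a free occurrence that does not lie in any subexpression \<open>\<alpha>.F\<close>, where
  \<open>\<alpha>\<close> is a visible action or the time-out.\<close>

primrec unguarded_vars :: "'a expr \<Rightarrow> var set" where
  "unguarded_vars Zero = {}"
| "unguarded_vars (Var x) = {x}"
| "unguarded_vars (Prefix \<alpha> E) = (if \<alpha> = Tau then unguarded_vars E else {})"
| "unguarded_vars (Plus E F) = unguarded_vars E \<union> unguarded_vars F"
| "unguarded_vars (Par A E F) = unguarded_vars E \<union> unguarded_vars F"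
| "unguarded_vars (Hide I E) = unguarded_vars E"
| "unguarded_vars (Rename R E) = unguarded_vars E"
| "unguarded_vars (Theta L U E) = unguarded_vars E"
| "unguarded_vars (Psi X E) = unguarded_vars E"
| "unguarded_vars (Rec y S) = \<Union> (ran (\<lambda>x. map_option unguarded_vars (S x))) - dom S"

definition manifestly_well_guarded :: "'a spec \<Rightarrow> bool" where
  "manifestly_well_guarded S \<longleftrightarrow>
     (\<forall>E \<in> ran S. (\<forall>I F. \<not> subexpr (Hide I F) E) \<and> unguarded_vars E \<inter> dom S = {})"

text \<open>One unfolding step replaces the variables \<open>y\<close> in some \<open>Y \<subseteq> V\<^sub>S\<close> by their \<open>S\<^sub>y\<close>.\<close>

definition unfolds :: "'a spec \<Rightarrow> 'a expr \<Rightarrow> 'a expr \<Rightarrow> bool" where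
  "unfolds S E F \<longleftrightarrow>
     (\<exists>Y \<subseteq> dom S. is_subst (\<lambda>y. if y \<in> Y then the (S y) else Var y) E F)"

text \<open>As \<open>S\<close> may be infinite, each right-hand side is unfolded finitely often, but there need not
  be a common bound on the number of unfoldings.\<close>

definition well_guarded :: "'a spec \<Rightarrow> bool" where
  "well_guarded S \<longleftrightarrow>
     (\<exists>S'. dom S' = dom S \<and> (\<forall>x \<in> dom S. (unfolds S)\<^sup>*\<^sup>* (the (S x)) (the (S' x))) \<and>
           manifestly_well_guarded S')"

definition guarded :: "'a expr \<Rightarrow> bool" where
  "guarded P \<longleftrightarrow> (\<forall>y S. subexpr (Rec y S) P \<longrightarrow> well_guarded S)"

definition reachable :: "'a expr \<Rightarrow> 'a expr \<Rightarrow> bool" where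
  "reachable = (\<lambda>P Q. \<exists>\<alpha>. transition P \<alpha> Q)\<^sup>*\<^sup>*"

definition strongly_guarded :: "'a expr \<Rightarrow> bool" where
  "strongly_guarded P \<longleftrightarrow> guarded P \<and>
     (\<forall>Q. reachable P Q \<longrightarrow> \<not> (\<exists>f. f 0 = Q \<and> (\<forall>i::nat. transition (f i) Tau (f (Suc i)))))"


section \<open>Axioms and derivability\<close>

text \<open>The finite sum of all \<open>\<alpha>.E\<close> with \<open>(\<alpha>, E)\<close> in the list.\<close>

definition sum_prefix :: "('a act \<times> 'a expr) list \<Rightarrow> 'a expr" where
  "sum_prefix ps = foldr (\<lambda>(\<alpha>, E). Plus (Prefix \<alpha> E)) ps Zero"

text \<open>The axioms are schematic in expressions.  The laws \<open>hide_sum\<close> and \<open>rename_sum\<close> are taken to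
  include the empty sum (\<open>hide_zero\<close>, \<open>rename_zero\<close>): from the binary laws alone neither
  \<open>Hide I Zero = Zero\<close> nor, for total \<open>R\<close>, \<open>Rename R Zero = Zero\<close> is derivable.\<close>

inductive ax :: "'a expr \<Rightarrow> 'a expr \<Rightarrow> bool" where
  plus_assoc: "ax (Plus x (Plus y z)) (Plus (Plus x y) z)"
| plus_comm: "ax (Plus x y) (Plus y x)"
| plus_idem: "ax (Plus x x) x"
| plus_zero: "ax (Plus x Zero) x"
| hide_sum: "ax (Hide I (Plus x y)) (Plus (Hide I x) (Hide I y))"
| hide_zero: "ax (Hide I Zero) Zero"
| hide_notin: "\<alpha> \<notin> Vis ` I \<Longrightarrow> ax (Hide I (Prefix \<alpha> x)) (Prefix \<alpha> (Hide I x))"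
| hide_in: "\<alpha> \<in> Vis ` I \<Longrightarrow> ax (Hide I (Prefix \<alpha> x)) (Prefix Tau (Hide I x))"
| rename_sum: "ax (Rename R (Plus x y)) (Plus (Rename R x) (Rename R y))"
| rename_zero: "ax (Rename R Zero) Zero"
| rename_tau: "ax (Rename R (Prefix Tau x)) (Prefix Tau (Rename R x))"
| rename_tout: "ax (Rename R (Prefix Tout x)) (Prefix Tout (Rename R x))"
| rename_vis: "\<lbrakk> distinct bs; set bs = {b. (a, b) \<in> R} \<rbrakk>
    \<Longrightarrow> ax (Rename R (Prefix (Vis a) x)) (sum_prefix (map (\<lambda>b. (Vis b, Rename R x)) bs))"
| expansion: "\<lbrakk> P = sum_prefix ps; Q = sum_prefix qs \<rbrakk>
    \<Longrightarrow> ax (Par S P Q)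
      (Plus (Plus
        (sum_prefix [(\<alpha>, Par S P' Q). (\<alpha>, P') \<leftarrow> ps, \<alpha> \<notin> Vis ` S])
        (sum_prefix [(\<beta>, Par S P Q'). (\<beta>, Q') \<leftarrow> qs, \<beta> \<notin> Vis ` S]))
        (sum_prefix [(\<alpha>, Par S P' Q'). (\<alpha>, P') \<leftarrow> ps, (\<beta>, Q') \<leftarrow> qs, \<alpha> = \<beta> \<and> \<beta> \<in> Vis ` S]))"
| branching: "ax (Prefix \<alpha> (Plus (Prefix Tau (Plus x y)) x)) (Prefix \<alpha> (Plus x y))"
| RDP: "\<lbrakk> S x = Some E; is_subst (rec_subst S) E F \<rbrakk> \<Longrightarrow> ax (Rec x S) F"
| theta_idle: "\<forall>(\<alpha>, x) \<in> set ps. \<alpha> \<notin> vis_tau L \<Longrightarrow> ax (Theta L U (sum_prefix ps)) (sum_prefix ps)"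
| theta_drop: "\<lbrakk> \<alpha> \<in> vis_tau L; \<beta> \<notin> vis_tau U \<rbrakk>
    \<Longrightarrow> ax (Theta L U (Plus (Plus x (Prefix \<alpha> y)) (Prefix \<beta> z)))
           (Theta L U (Plus x (Prefix \<alpha> y)))"
| theta_split: "\<lbrakk> \<alpha> \<in> vis_tau L; \<beta> \<in> vis_tau U \<rbrakk>
    \<Longrightarrow> ax (Theta L U (Plus (Plus x (Prefix \<alpha> y)) (Prefix \<beta> z)))
           (Plus (Theta L U (Plus x (Prefix \<alpha> y))) (Theta L U (Prefix \<beta> z)))"
| theta_prefix: "\<alpha> \<noteq> Tau \<Longrightarrow> ax (Theta L U (Prefix \<alpha> x)) (Prefix \<alpha> x)"
| theta_tau: "ax (Theta L U (Prefix Tau x)) (Prefix Tau (Theta L U x))"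
| psi_other: "\<alpha> \<notin> vis_tau X \<union> {Tout}
    \<Longrightarrow> ax (Psi X (Plus x (Prefix \<alpha> y))) (Plus (Psi X x) (Prefix \<alpha> y))"
| psi_drop: "\<alpha> \<in> vis_tau X
    \<Longrightarrow> ax (Psi X (Plus (Plus x (Prefix \<alpha> y)) (Prefix Tout z))) (Psi X (Plus x (Prefix \<alpha> y)))"
| psi_split: "\<lbrakk> \<alpha> \<in> vis_tau X; \<beta> \<in> vis_tau X \<rbrakk>
    \<Longrightarrow> ax (Psi X (Plus (Plus x (Prefix \<alpha> y)) (Prefix \<beta> z)))
           (Plus (Psi X (Plus x (Prefix \<alpha> y))) (Prefix \<beta> z))"
| psi_prefix: "\<alpha> \<noteq> Tout \<Longrightarrow> ax (Psi X (Prefix \<alpha> x)) (Prefix \<alpha> x)"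
| psi_tout: "ax (Psi X (sum_prefix (map (\<lambda>y. (Tout, y)) ys)))
                (sum_prefix (map (\<lambda>y. (Tout, Theta X X y)) ys))"

text \<open>\<open>in_context E F G H\<close>: \<open>G\<close> and \<open>H\<close> are \<open>C[E]\<close> and \<open>C[F]\<close> for a one-hole context \<open>C\<close>, which
  may bind variables of \<open>E\<close> and \<open>F\<close>.\<close>

inductive in_context :: "'a expr \<Rightarrow> 'a expr \<Rightarrow> 'a expr \<Rightarrow> 'a expr \<Rightarrow> bool"
  for E F :: "'a expr" where
  "in_context E F E F"
| "in_context E F G H \<Longrightarrow> in_context E F (Prefix \<alpha> G) (Prefix \<alpha> H)"
| "in_context E F G H \<Longrightarrow> in_context E F (Plus G K) (Plus H K)"
| "in_context E F G H \<Longrightarrow> in_context E F (Plus K G) (Plus K H)"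
| "in_context E F G H \<Longrightarrow> in_context E F (Par A G K) (Par A H K)"
| "in_context E F G H \<Longrightarrow> in_context E F (Par A K G) (Par A K H)"
| "in_context E F G H \<Longrightarrow> in_context E F (Hide I G) (Hide I H)"
| "in_context E F G H \<Longrightarrow> in_context E F (Rename R G) (Rename R H)"
| "in_context E F G H \<Longrightarrow> in_context E F (Theta L U G) (Theta L U H)"
| "in_context E F G H \<Longrightarrow> in_context E F (Psi X G) (Psi X H)"
| "\<lbrakk> in_context E F G H; S x = Some G \<rbrakk>
    \<Longrightarrow> in_context E F (Rec y S) (Rec y (S(x \<mapsto> H)))"

text \<open>Derivability of an equation from the axioms; only valid expressions occur in derivations.\<close>

inductive derivable :: "'a expr \<Rightarrow> 'a expr \<Rightarrow> bool"  (\<open>Ax\<^sub>r \<turnstile> _ \<approx> _\<close> [51, 51] 50) where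
  by_axiom: "\<lbrakk> ax E F; ccsp E; ccsp F \<rbrakk> \<Longrightarrow> derivable E F"
| reflexivity: "ccsp E \<Longrightarrow> derivable E E"
| symmetry: "derivable E F \<Longrightarrow> derivable F E"
| transitivity: "\<lbrakk> derivable E F; derivable F G \<rbrakk> \<Longrightarrow> derivable E G"
| substitution: "\<lbrakk> derivable E F; is_subst \<sigma> E E'; is_subst \<sigma> F F'; ccsp E'; ccsp F' \<rbrakk>
    \<Longrightarrow> derivable E' F'"
| replacement: "\<lbrakk> derivable E F; in_context E F G H; ccsp G; ccsp H \<rbrakk> \<Longrightarrow> derivable G H"
| RSP: "\<lbrakk> well_guarded S; x \<in> dom S; ccsp (Rec x S);
     \<forall>y \<in> dom S. \<exists>E. is_subst (\<lambda>v. if v \<in> dom S then \<rho> v else Var v) (the (S y)) E \<and>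
                     derivable (\<rho> y) E \<rbrakk>
    \<Longrightarrow> derivable (\<rho> x) (Rec x S)"
| reactive_approximation: "\<forall>X. derivable (Psi X E) (Psi X F) \<Longrightarrow> derivable E F"

end

theory Submission
  imports Defs "HOL-Library.Countable_Set"
begin

text \<open>Every guarded process equals the finite sum of its transitions.  Let \<open>R\<close> be the countable set of
  processes reachable from \<open>P\<close> or \<open>Q\<close>.  As \<open>\<tau>\<close> is well-founded on \<open>R\<close>, each \<open>\<simeq>\<^sub>b\<^sub>r\<close>-class has a
  member \<open>\<chi>\<close> from which no \<open>\<tau>\<close>-path returns to the class, and the transitions of these members form a
  guarded recursive specification with a canonical solution \<open>K\<close>, one process for each class.  Let
  \<open>H(P) = \<Sum> \<alpha>.K[P']\<close>, the sum ranging over the transitions from \<open>P\<close> to \<open>P'\<close>.  The branching axiom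
  contracts inert \<open>\<tau>\<close>-summands, so that \<open>\<alpha>.H(P) = \<alpha>.K[P]\<close>; hence \<open>H\<close> satisfies the same equations as
  the identity on \<open>R\<close>, and \<open>P = H(P)\<close> by RSP.  If \<open>P\<close> and \<open>Q\<close> are rooted bisimilar then
  \<open>H(P) = H(Q)\<close> by reactive approximation: all summands of \<open>\<psi>\<^sub>X(H(P))\<close> occur literally in \<open>\<psi>\<^sub>X(H(Q))\<close>,
  except that \<open>t.\<theta>\<^sub>X(K[P'])\<close> is matched by some \<open>t.\<theta>\<^sub>X(K[Q'])\<close> with \<open>P' \<simeq>\<^sup>X\<^sub>b\<^sub>r Q'\<close>.  For a fixed \<open>X\<close> the
  latter two are equal by the same quotient argument applied to \<open>\<simeq>\<^sup>X\<^sub>b\<^sub>r\<close>.  Treating one \<open>X\<close> at a time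
  keeps all specifications countable.\<close>

section \<open>Closed expressions and substitution\<close>

text \<open>Representatives must be bottom members: an inert \<tau>-step inside a class would yield
  an unguarded equation \<open>c = \<tau>.c + ...\<close>, to which RSP does not apply. Bottom
  members also pin down matching. If P is equivalent to a bottom member b, the \<tau>-path from b to
  the process making a matching \<tau>- or visible move ends in the class of b, so it is empty and b
  itself makes the move. A member with an inert \<tau>-step may have time-outs that its
  representative lacks. Reactive approximation removes them, because a \<tau>-summand makes every
  \<psi> discard time-outs; only then can the sum be contracted. As the branching axiom works under
  a prefix, so do the comparisons with \<open>K\<close>; this suffices because the equations mention
  their unknowns only under prefixes. A time-out is matched for one environment X, which stays in
  force until a visible action occurs or the process idles. Hence \<theta>_X(K[P]) has to be studied
  modulo \<open>\<simeq>\<^sup>X\<^sub>b\<^sub>r\<close>. Drawing the representatives of this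
  coarser equivalence from those of \<open>\<simeq>\<^sub>b\<^sub>r\<close> makes the two quotients
  agree on processes that idle in X.\<close>

text \<open>This consequence of well-guardedness suffices for head normal forms and, unlike well-guardedness
  itself, is preserved when processes containing \<open>\<tau>\<^sub>I\<close> are substituted.\<close>

definition guard_wf :: "'a spec \<Rightarrow> bool" where
  "guard_wf S \<longleftrightarrow> wf {(y, x). \<exists>E. S x = Some E \<and> y \<in> dom S \<and> y \<in> unguarded_vars E}"

fun node_ok :: "'a expr \<Rightarrow> bool" where
  "node_ok (Theta L U E) \<longleftrightarrow> L \<subseteq> U"
| "node_ok (Rename R E) \<longleftrightarrow> (\<forall>a. finite {b. (a, b) \<in> R})"
| "node_ok (Rec y S) \<longleftrightarrow> y \<in> dom S \<and> guard_wf S"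
| "node_ok _ \<longleftrightarrow> True"

definition regular :: "'a expr \<Rightarrow> bool" where
  "regular E \<longleftrightarrow> (\<forall>G. subexpr G E \<longrightarrow> node_ok G)"

text \<open>In a closed expression every variable occurrence is bound somewhere, so there
  \<open>valid\<close> amounts to this condition. In this form it is plain that a substitution never
  changes the argument of a \<theta> or \<psi>.\<close>

definition closed_bodies :: "'a expr \<Rightarrow> bool" where
  "closed_bodies E \<longleftrightarrow> (\<forall>F. body F E \<longrightarrow> fv F = {})"

definition good :: "'a expr \<Rightarrow> bool" where
  "good E \<longleftrightarrow> regular E \<and> closed_bodies E \<and> fv E = {}"

lemma regular_unfold: "regular E \<longleftrightarrow> node_ok E \<and> (\<forall>C \<in> children E. regular C)"
  unfolding regular_def by (subst subexpr_simps) blast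

lemma regular_simps [simp]:
  "regular Zero" "regular (Var x)"
  "regular (Prefix \<alpha> E) \<longleftrightarrow> regular E"
  "regular (Plus E F) \<longleftrightarrow> regular E \<and> regular F"
  "regular (Par A E F) \<longleftrightarrow> regular E \<and> regular F"
  "regular (Hide I E) \<longleftrightarrow> regular E"
  "regular (Rename R E) \<longleftrightarrow> (\<forall>a. finite {b. (a, b) \<in> R}) \<and> regular E"
  "regular (Theta L U E) \<longleftrightarrow> L \<subseteq> U \<and> regular E"
  "regular (Psi X E) \<longleftrightarrow> regular E"
  "regular (Rec y S) \<longleftrightarrow> y \<in> dom S \<and> guard_wf S \<and> (\<forall>E \<in> ran S. regular E)"
  by (subst regular_unfold; auto)+

lemma closed_bodies_simps [simp]:
  "closed_bodies Zero" "closed_bodies (Var x)"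
  "closed_bodies (Prefix \<alpha> E) \<longleftrightarrow> closed_bodies E"
  "closed_bodies (Plus E F) \<longleftrightarrow> closed_bodies E \<and> closed_bodies F"
  "closed_bodies (Par A E F) \<longleftrightarrow> closed_bodies E \<and> closed_bodies F"
  "closed_bodies (Hide I E) \<longleftrightarrow> closed_bodies E"
  "closed_bodies (Rename R E) \<longleftrightarrow> closed_bodies E"
  "closed_bodies (Theta L U E) \<longleftrightarrow> fv E = {} \<and> closed_bodies E"
  "closed_bodies (Psi X E) \<longleftrightarrow> fv E = {} \<and> closed_bodies E"
  "closed_bodies (Rec y S) \<longleftrightarrow> (\<forall>E \<in> ran S. closed_bodies E)"
  unfolding closed_bodies_def by auto

lemma good_simps [simp]:
  "good Zero" "\<not> good (Var x)"
  "good (Prefix \<alpha> E) \<longleftrightarrow> good E"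
  "good (Plus E F) \<longleftrightarrow> good E \<and> good F"
  "good (Par A E F) \<longleftrightarrow> good E \<and> good F"
  "good (Hide I E) \<longleftrightarrow> good E"
  "good (Rename R E) \<longleftrightarrow> (\<forall>a. finite {b. (a, b) \<in> R}) \<and> good E"
  "good (Theta L U E) \<longleftrightarrow> L \<subseteq> U \<and> good E"
  "good (Psi X E) \<longleftrightarrow> good E"
  unfolding good_def by auto

lemma good_process:
  assumes "good P"
  shows "process P"
proof -
  have "wf_expr P"
    using assms unfolding good_def regular_def wf_expr_def by fastforce
  moreover have "valid P"
    using assms subexpr_trans unfolding good_def closed_bodies_def valid_def body_def by blast
  ultimately show ?thesis
    using assms by (simp add: process_def ccsp_def good_def)
qed

section \<open>Unguarded occurrences and guardedness\<close>

lemma unguarded_vars_fv: "unguarded_vars E \<subseteq> fv E"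
proof (induction E)
  case (Rec y S)
  then show ?case by (fastforce simp: ran_def)
qed auto

lemma fv_spec: "S z = Some E \<Longrightarrow> fv E \<subseteq> fv (Rec x S) \<union> dom S"
  using ranI[of "\<lambda>x. map_option fv (S x)" z "fv E"] by auto

text \<open>An unguarded occurrence of \<open>v\<close> becomes an unguarded occurrence of
  \<open>\<sigma> v\<close>. The freshness condition on the renamed binders prevents its variables
  from being captured on the way out.\<close>

lemma is_subst_unguarded:
  assumes "is_subst \<sigma> E F" "v \<in> unguarded_vars E"
  shows "unguarded_vars (\<sigma> v) \<subseteq> unguarded_vars F"
  using assms
proof (induction arbitrary: v rule: is_subst.induct)
  case (10 \<pi> S T y \<sigma>)
  from 10(5) obtain x E where x: "S x = Some E" "v \<in> unguarded_vars E" "v \<notin> dom S"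
    by (auto simp: ran_def)
  from 10(4) x(1) obtain F where F: "T (\<pi> x) = Some F"
    "\<And>v. v \<in> unguarded_vars E \<Longrightarrow>
       unguarded_vars (if v \<in> dom S then Var (\<pi> v) else \<sigma> v) \<subseteq> unguarded_vars F"
    by blast
  have "v \<in> fv (Rec y S)"
    using 10(5) unguarded_vars_fv[of "Rec y S"] by blast
  then have "unguarded_vars (\<sigma> v) \<inter> dom T = {}"
    using 10(2,3) unguarded_vars_fv[of "\<sigma> v"] by fastforce
  moreover have "unguarded_vars (\<sigma> v) \<subseteq> unguarded_vars F"
    using F(2)[OF x(2)] x(3) by simp
  ultimately show ?case
    using F(1) by (fastforce simp: ran_def)
qed (auto split: if_splits)

text \<open>Unfolding never removes the unguarded occurrence of a variable from which an infinite chain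
  of unguarded dependencies starts.\<close>

lemma well_guarded_guard_wf:
  assumes "well_guarded S"
  shows "guard_wf S"
proof -
  let ?r = "{(y, x). \<exists>E. S x = Some E \<and> y \<in> dom S \<and> y \<in> unguarded_vars E}"
  \<comment> \<open>Inaccessible variables start infinite chains of unguarded dependencies, so each
    of them has an unguarded variable from \<open>W\<close> on its right-hand side.\<close>
  define W where "W = {x \<in> dom S. x \<notin> Wellfounded.acc ?r}"
  have W: "\<exists>y \<in> W. y \<in> unguarded_vars (the (S x))" if "x \<in> W" for x
  proof (rule ccontr)
    assume "\<not> ?thesis"
    then have "x \<in> Wellfounded.acc ?r" by (intro accI[of x]) (auto simp: W_def)
    then show False using that by (simp add: W_def)
  qed
  obtain S' where S': "dom S' = dom S"
    "\<And>x. x \<in> dom S \<Longrightarrow> (unfolds S)\<^sup>*\<^sup>* (the (S x)) (the (S' x))"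
    "manifestly_well_guarded S'"
    using assms unfolding well_guarded_def by blast
  have keep: "W \<inter> unguarded_vars F \<noteq> {}" if "(unfolds S)\<^sup>*\<^sup>* E F" "W \<inter> unguarded_vars E \<noteq> {}" for E F
    using that
  proof (induction rule: rtranclp_induct)
    case (step F G)
    then obtain v where v: "v \<in> W" "v \<in> unguarded_vars F" by blast
    obtain Y where Y: "Y \<subseteq> dom S" "is_subst (\<lambda>y. if y \<in> Y then the (S y) else Var y) F G"
      using step.hyps(2) unfolding unfolds_def by blast
    show ?case
      using is_subst_unguarded[OF Y(2) v(2)] W[OF v(1)] v(1) by (auto split: if_splits)
  qed
  have "W = {}"
  proof (rule ccontr)
    assume "W \<noteq> {}"
    then obtain x where x: "x \<in> W" by blast
    then have xd: "x \<in> dom S" by (simp add: W_def)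
    have "W \<inter> unguarded_vars (the (S' x)) \<noteq> {}"
      using keep[OF S'(2)[OF xd]] W[OF x] by blast
    moreover have "the (S' x) \<in> ran S'"
      using xd S'(1) by (metis domD option.sel ranI)
    ultimately show False
      using S'(1,3) unfolding manifestly_well_guarded_def W_def by blast
  qed
  then have "x \<in> Wellfounded.acc ?r" for x
    by (cases "x \<in> dom S") (use accI[of x ?r] in \<open>auto simp: W_def\<close>)
  then show ?thesis unfolding guard_wf_def by (simp add: wf_iff_acc)
qed

lemma guarded_process_good:
  assumes "process P" "guarded P"
  shows "good P"
proof -
  have "node_ok G" if "subexpr G P" for G
  proof -
    have wf: "wf_expr P" using assms(1) by (simp add: process_def ccsp_def)
    show ?thesis
    proof (cases G)
      case (Theta L U F)
      then show ?thesis using that wf by (simp add: wf_expr_def) blast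
    next
      case (Rename R F)
      then show ?thesis using that wf by (simp add: wf_expr_def) blast
    next
      case (Rec y S)
      then have "well_guarded S" using that assms(2) by (auto simp: guarded_def)
      moreover have "y \<in> dom S" using that wf Rec unfolding wf_expr_def by blast
      ultimately show ?thesis using Rec well_guarded_guard_wf by simp
    qed simp_all
  qed
  then show ?thesis
    using assms process_bodies_closed
    by (auto simp: good_def regular_def closed_bodies_def process_def)
qed

text \<open>Replaced variables receive closed values, so literal substitution cannot capture
  anything, and it stays of this kind below a binder (\<open>closing_restrict\<close>).\<close>

definition closing :: "(var \<Rightarrow> 'a expr) \<Rightarrow> bool" where
  "closing \<sigma> \<longleftrightarrow> (\<forall>v. \<sigma> v = Var v \<or> good (\<sigma> v))"

lemma closing_restrict: "closing \<sigma> \<Longrightarrow> closing (\<lambda>v. if v \<in> D then Var v else \<sigma> v)"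
  by (auto simp: closing_def)

lemma fv_subst: "closing \<sigma> \<Longrightarrow> fv (subst E \<sigma>) \<subseteq> {v \<in> fv E. \<sigma> v = Var v}"
proof (induction E arbitrary: \<sigma>)
  case (Var x)
  then have "\<sigma> x = Var x \<or> good (\<sigma> x)" by (simp add: closing_def)
  then show ?case by (auto simp: good_def)
next
  case (Rec y S)
  show ?case
  proof
    fix v assume "v \<in> fv (subst (Rec y S) \<sigma>)"
    then obtain x E where x: "S x = Some E" "v \<notin> dom S"
      "v \<in> fv (subst E (\<lambda>v. if v \<in> dom S then Var v else \<sigma> v))"
      by (auto simp: ran_def dom_def)
    have "fv (subst E (\<lambda>v. if v \<in> dom S then Var v else \<sigma> v)) \<subseteq>
        {v \<in> fv E. (if v \<in> dom S then Var v else \<sigma> v) = Var v}"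
      using Rec.IH[OF rangeI[of S x] _ closing_restrict[OF Rec.prems]] x(1) by simp
    then have "v \<in> fv E \<and> \<sigma> v = Var v" using x(2,3) by (auto simp: subset_iff domIff)
    then show "v \<in> {v \<in> fv (Rec y S). \<sigma> v = Var v}"
      using x by (auto simp: ran_def)
  qed
qed (simp_all, blast+)

text \<open>A closed value contributes no variables. Hence the dependency relation of a
  specification can only shrink under substitution, which preserves \<open>guard_wf\<close>.\<close>

lemma unguarded_subst: "closing \<sigma> \<Longrightarrow> unguarded_vars (subst E \<sigma>) \<subseteq> unguarded_vars E"
proof (induction E arbitrary: \<sigma>)
  case (Var x)
  then have "\<sigma> x = Var x \<or> good (\<sigma> x)" by (simp add: closing_def)
  then show ?case using unguarded_vars_fv[of "\<sigma> x"] by (auto simp: good_def)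
next
  case (Rec y S)
  show ?case
  proof
    fix v assume "v \<in> unguarded_vars (subst (Rec y S) \<sigma>)"
    then obtain x E where x: "S x = Some E" "v \<notin> dom S"
      "v \<in> unguarded_vars (subst E (\<lambda>v. if v \<in> dom S then Var v else \<sigma> v))"
      by (auto simp: ran_def dom_def)
    have "v \<in> unguarded_vars E"
      using Rec.IH[OF rangeI[of S x], of E, OF _ closing_restrict[OF Rec.prems]] x by fastforce
    then show "v \<in> unguarded_vars (Rec y S)"
      using x by (auto simp: ran_def)
  qed
qed (simp_all, blast+)

definition subst_spec :: "'a spec \<Rightarrow> (var \<Rightarrow> 'a expr) \<Rightarrow> 'a spec" where
  "subst_spec S \<sigma> =
     (\<lambda>x. map_option (\<lambda>E. subst E (\<lambda>v. if v \<in> dom S then Var v else \<sigma> v)) (S x))"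

lemma subst_Rec: "subst (Rec y S) \<sigma> = Rec y (subst_spec S \<sigma>)"
  by (simp add: subst_spec_def)

lemma dom_subst_spec [simp]: "dom (subst_spec S \<sigma>) = dom S"
  by (auto simp: subst_spec_def)

lemma guard_wf_subst:
  assumes "guard_wf S" "closing \<sigma>"
  shows "guard_wf (subst_spec S \<sigma>)"
proof -
  have "\<exists>E. S x = Some E \<and> y \<in> dom S \<and> y \<in> unguarded_vars E"
    if "subst_spec S \<sigma> x = Some F" "y \<in> dom S" "y \<in> unguarded_vars F" for x y F
    using that unguarded_subst[OF closing_restrict[OF assms(2)], of _ "dom S"]
    by (auto simp: subst_spec_def)
  then have "{(y, x). \<exists>E. subst_spec S \<sigma> x = Some E \<and> y \<in> dom S \<and> y \<in> unguarded_vars E}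
      \<subseteq> {(y, x). \<exists>E. S x = Some E \<and> y \<in> dom S \<and> y \<in> unguarded_vars E}" by blast
  then show ?thesis
    using assms(1) unfolding guard_wf_def dom_subst_spec by (rule wf_subset[rotated])
qed

lemma regular_subst: "closing \<sigma> \<Longrightarrow> regular E \<Longrightarrow> regular (subst E \<sigma>)"
proof (induction E arbitrary: \<sigma>)
  case (Var x)
  then have "\<sigma> x = Var x \<or> good (\<sigma> x)" by (simp add: closing_def)
  then show ?case by (auto simp: good_def)
next
  case (Rec y S)
  have "regular F" if "F \<in> ran (subst_spec S \<sigma>)" for F
  proof -
    from that obtain x E where x: "S x = Some E"
      "F = subst E (\<lambda>v. if v \<in> dom S then Var v else \<sigma> v)"
      by (auto simp: subst_spec_def ran_def)
    have "regular E" using Rec.prems(2) x(1) by (auto simp: ran_def)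
    then show ?thesis
      using Rec.IH[OF rangeI[of S x], of E, OF _ closing_restrict[OF Rec.prems(1)]] x by simp
  qed
  then show ?case
    using Rec.prems(2) guard_wf_subst[OF _ Rec.prems(1)] by (simp add: subst_Rec del: subst.simps(10))
qed auto

lemma good_subst:
  assumes "closing \<sigma>" "regular E" "closed_bodies E" "\<forall>v \<in> fv E. good (\<sigma> v)"
  shows "good (subst E \<sigma>)"
proof -
  have "closed_bodies (\<sigma> v)" for v
  proof -
    have "\<sigma> v = Var v \<or> good (\<sigma> v)" using assms(1) by (simp add: closing_def)
    then show ?thesis by (auto simp: good_def)
  qed
  then have "closed_bodies (subst E \<sigma>)"
    using body_subst assms(3) unfolding closed_bodies_def by metis
  moreover have "fv (subst E \<sigma>) = {}"
    using fv_subst[OF assms(1), of E] assms(4) good_simps(2) by fastforce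
  ultimately show ?thesis
    using regular_subst[OF assms(1,2)] by (simp add: good_def)
qed

text \<open>A closed \<open>\<sigma> v\<close> is untouched by the second substitution, even in its
  restricted form below a binder; variables left alone by \<open>\<sigma>\<close> meet the second
  substitution in the same place on both sides.\<close>

lemma subst_subst:
  "closing \<sigma> \<Longrightarrow> subst (subst E \<sigma>) \<tau> = subst E (\<lambda>v. subst (\<sigma> v) \<tau>)"
proof (induction E arbitrary: \<sigma> \<tau>)
  case (Rec y S)
  let ?r = "\<lambda>\<sigma> v. if v \<in> dom S then Var v else \<sigma> v"
  have eq: "(\<lambda>v. subst (?r \<sigma> v) (?r \<tau>)) = ?r (\<lambda>v. subst (\<sigma> v) \<tau>)"
  proof
    fix v
    have "\<sigma> v = Var v \<or> good (\<sigma> v)" using Rec.prems by (simp add: closing_def)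
    then show "subst (?r \<sigma> v) (?r \<tau>) = ?r (\<lambda>v. subst (\<sigma> v) \<tau>) v"
      using subst_closed[of "\<sigma> v" "?r \<tau>"] subst_closed[of "\<sigma> v" \<tau>] by (auto simp: good_def domIff)
  qed
  have "subst (subst E (?r \<sigma>)) (?r \<tau>) = subst E (?r (\<lambda>v. subst (\<sigma> v) \<tau>))"
    if "S x = Some E" for x E
    using Rec.IH[OF rangeI[of S x], of E, OF _ closing_restrict[OF Rec.prems]] that
    unfolding eq[symmetric] by simp
  then have "subst_spec (subst_spec S \<sigma>) \<tau> = subst_spec S (\<lambda>v. subst (\<sigma> v) \<tau>)"
    unfolding subst_spec_def[of "subst_spec S \<sigma>"] dom_subst_spec
    by (auto simp: subst_spec_def fun_eq_iff option.map_comp comp_def intro!: option.map_cong)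
  then show ?case by (simp only: subst_Rec)
qed simp_all

text \<open>The identity serves as the renaming of binders: a free variable of the recursion is sent
  either to a closed process or to itself, and it is not among the binders.\<close>

lemma is_subst_subst: "closing \<sigma> \<Longrightarrow> is_subst \<sigma> E (subst E \<sigma>)"
proof (induction E arbitrary: \<sigma>)
  case (Rec y S)
  have "is_subst \<sigma> (Rec y S) (Rec ((\<lambda>x. x) y) (subst_spec S \<sigma>))"
  proof (rule is_subst.intros(10))
    show "\<forall>v \<in> fv (Rec y S). fv (\<sigma> v) \<inter> (\<lambda>x. x) ` dom S = {}"
    proof
      fix v assume "v \<in> fv (Rec y S)"
      moreover have "\<sigma> v = Var v \<or> good (\<sigma> v)" using Rec.prems by (simp add: closing_def)
      ultimately show "fv (\<sigma> v) \<inter> (\<lambda>x. x) ` dom S = {}" by (auto simp: good_def)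
    qed
    show "\<forall>x E. S x = Some E \<longrightarrow> (\<exists>F. subst_spec S \<sigma> x = Some F \<and>
            is_subst (\<lambda>v. if v \<in> dom S then Var v else \<sigma> v) E F)"
      using Rec.IH[OF rangeI _ closing_restrict[OF Rec.prems]]
      by (auto simp: subst_spec_def)
  qed (auto simp: inj_on_def)
  then show ?case by (simp only: subst_Rec)
qed (auto intro: is_subst.intros)

lemma good_Rec_var: "good (Rec x S) \<Longrightarrow> y \<in> dom S \<Longrightarrow> good (Rec y S)"
  by (simp add: good_def)

lemma closing_rec_subst: "good (Rec x S) \<Longrightarrow> closing (rec_subst S)"
  using good_Rec_var by (auto simp: closing_def rec_subst_def)

lemma good_unfold:
  assumes "good (Rec x S)" "S z = Some E"
  shows "good (subst E (rec_subst S))"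
proof (rule good_subst)
  have E: "E \<in> ran S" using assms(2) by (rule ranI)
  show "closing (rec_subst S)" using closing_rec_subst[OF assms(1)] .
  show "regular E" "closed_bodies E" using assms(1) E by (auto simp: good_def)
  have "fv E \<subseteq> dom S" using assms fv_spec[where S = S and z = z and x = x] by (simp add: good_def) blast
  then show "\<forall>v \<in> fv E. good (rec_subst S v)"
    using good_Rec_var[OF assms(1)] by (auto simp: rec_subst_def)
qed

lemma good_transition:
  assumes "transition P \<alpha> P'" "good P"
  shows "good P'"
  using assms unfolding transition_def
proof (induction rule: trans_wrt.induct)
  case (recursion S x E \<alpha> x')
  then show ?case using good_unfold by blast
qed auto

section \<open>Equational reasoning\<close>

lemma wf_expr_alt:
  "wf_expr E \<longleftrightarrow> (\<forall>G. subexpr G E \<longrightarrow> (case G of Theta L U F \<Rightarrow> L \<subseteq> U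
     | Rename R F \<Rightarrow> \<forall>a. finite {b. (a, b) \<in> R} | Rec y S \<Rightarrow> y \<in> dom S | _ \<Rightarrow> True))"
  unfolding wf_expr_def by (rule iffI; intro allI impI conjI; force split: expr.splits)

lemma wf_expr_unfold:
  "wf_expr E \<longleftrightarrow> (case E of Theta L U F \<Rightarrow> L \<subseteq> U | Rename R F \<Rightarrow> \<forall>a. finite {b. (a, b) \<in> R}
     | Rec y S \<Rightarrow> y \<in> dom S | _ \<Rightarrow> True) \<and> (\<forall>C \<in> children E. wf_expr C)"
  unfolding wf_expr_alt by (subst subexpr_simps) blast

lemma valid_unfold: "\<forall>y S. E \<noteq> Rec y S \<Longrightarrow> valid E \<longleftrightarrow> (\<forall>C \<in> children E. valid C)"
  unfolding valid_def by (subst (1) subexpr_simps) blast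

lemma ccsp_simps [simp]:
  "ccsp Zero" "ccsp (Var x)"
  "ccsp (Prefix \<alpha> E) \<longleftrightarrow> ccsp E"
  "ccsp (Plus E F) \<longleftrightarrow> ccsp E \<and> ccsp F"
  "ccsp (Par A E F) \<longleftrightarrow> ccsp E \<and> ccsp F"
  "ccsp (Hide I E) \<longleftrightarrow> ccsp E"
  "ccsp (Rename R E) \<longleftrightarrow> (\<forall>a. finite {b. (a, b) \<in> R}) \<and> ccsp E"
  "ccsp (Theta L U E) \<longleftrightarrow> L \<subseteq> U \<and> ccsp E"
  "ccsp (Psi X E) \<longleftrightarrow> ccsp E"
  unfolding ccsp_def by (subst wf_expr_unfold; subst valid_unfold; auto)+

lemma derivable_ccsp: "Ax\<^sub>r \<turnstile> E \<approx> F \<Longrightarrow> ccsp E \<and> ccsp F"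
proof (induction rule: derivable.induct)
  case (RSP S x \<rho>)
  then show ?case by blast
qed auto

lemmas derivable_ccsp1 = derivable_ccsp[THEN conjunct1]
  and derivable_ccsp2 = derivable_ccsp[THEN conjunct2]

declare derivable.transitivity [trans]

lemma derivable_prefix: "Ax\<^sub>r \<turnstile> E \<approx> F \<Longrightarrow> Ax\<^sub>r \<turnstile> Prefix \<alpha> E \<approx> Prefix \<alpha> F"
  by (rule derivable.replacement[where E = E and F = F])
    (auto intro: in_context.intros dest: derivable_ccsp)

lemma derivable_plus_left: "Ax\<^sub>r \<turnstile> E \<approx> F \<Longrightarrow> ccsp G \<Longrightarrow> Ax\<^sub>r \<turnstile> Plus E G \<approx> Plus F G"
  by (rule derivable.replacement[where E = E and F = F])
    (auto intro: in_context.intros dest: derivable_ccsp)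

lemma derivable_plus_right: "Ax\<^sub>r \<turnstile> E \<approx> F \<Longrightarrow> ccsp G \<Longrightarrow> Ax\<^sub>r \<turnstile> Plus G E \<approx> Plus G F"
  by (rule derivable.replacement[where E = E and F = F])
    (auto intro: in_context.intros dest: derivable_ccsp)

lemma derivable_plus: "Ax\<^sub>r \<turnstile> E \<approx> E' \<Longrightarrow> Ax\<^sub>r \<turnstile> F \<approx> F' \<Longrightarrow> Ax\<^sub>r \<turnstile> Plus E F \<approx> Plus E' F'"
  by (meson derivable.transitivity derivable_ccsp1 derivable_ccsp2 derivable_plus_left
      derivable_plus_right)

lemma derivable_par:
  assumes "Ax\<^sub>r \<turnstile> E \<approx> E'" "Ax\<^sub>r \<turnstile> F \<approx> F'"
  shows "Ax\<^sub>r \<turnstile> Par A E F \<approx> Par A E' F'"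
proof (rule derivable.transitivity)
  show "Ax\<^sub>r \<turnstile> Par A E F \<approx> Par A E' F"
    by (rule derivable.replacement[OF assms(1)])
      (use assms in \<open>auto intro: in_context.intros dest: derivable_ccsp\<close>)
  show "Ax\<^sub>r \<turnstile> Par A E' F \<approx> Par A E' F'"
    by (rule derivable.replacement[OF assms(2)])
      (use assms in \<open>auto intro: in_context.intros dest: derivable_ccsp\<close>)
qed

lemma derivable_hide: "Ax\<^sub>r \<turnstile> E \<approx> F \<Longrightarrow> Ax\<^sub>r \<turnstile> Hide I E \<approx> Hide I F"
  by (rule derivable.replacement[where E = E and F = F])
    (auto intro: in_context.intros dest: derivable_ccsp)

lemma derivable_rename:
  "Ax\<^sub>r \<turnstile> E \<approx> F \<Longrightarrow> \<forall>a. finite {b. (a, b) \<in> R} \<Longrightarrow> Ax\<^sub>r \<turnstile> Rename R E \<approx> Rename R F"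
  by (rule derivable.replacement[where E = E and F = F])
    (auto intro: in_context.intros dest: derivable_ccsp)

lemma derivable_theta: "Ax\<^sub>r \<turnstile> E \<approx> F \<Longrightarrow> L \<subseteq> U \<Longrightarrow> Ax\<^sub>r \<turnstile> Theta L U E \<approx> Theta L U F"
  by (rule derivable.replacement[where E = E and F = F])
    (auto intro: in_context.intros dest: derivable_ccsp)

lemma derivable_psi: "Ax\<^sub>r \<turnstile> E \<approx> F \<Longrightarrow> Ax\<^sub>r \<turnstile> Psi X E \<approx> Psi X F"
  by (rule derivable.replacement[where E = E and F = F])
    (auto intro: in_context.intros dest: derivable_ccsp)

lemma derivable_assoc:
  "ccsp x \<Longrightarrow> ccsp y \<Longrightarrow> ccsp z \<Longrightarrow> Ax\<^sub>r \<turnstile> Plus x (Plus y z) \<approx> Plus (Plus x y) z"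
  by (simp add: derivable.by_axiom ax.plus_assoc)

lemma derivable_comm: "ccsp x \<Longrightarrow> ccsp y \<Longrightarrow> Ax\<^sub>r \<turnstile> Plus x y \<approx> Plus y x"
  by (simp add: derivable.by_axiom ax.plus_comm)

text \<open>The natural order of an idempotent sum. It is antisymmetric up to provable equality
  (\<open>summand_antisym\<close>), so equations between sums reduce to inclusions and no
  rearrangement of summands is ever spelled out.\<close>

definition summand :: "'a expr \<Rightarrow> 'a expr \<Rightarrow> bool" where
  "summand E F \<longleftrightarrow> Ax\<^sub>r \<turnstile> Plus E F \<approx> F"

lemma summand_ccsp: "summand E F \<Longrightarrow> ccsp E \<and> ccsp F"
  using derivable_ccsp[of "Plus E F" F] by (simp add: summand_def)

lemma summand_eq: 
  assumes "Ax\<^sub>r \<turnstile> E \<approx> F" shows "summand E F"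
proof -
  have F: "ccsp F" using assms derivable_ccsp by blast
  have "Ax\<^sub>r \<turnstile> Plus E F \<approx> Plus F F" using assms F by (rule derivable_plus_left)
  also have "Ax\<^sub>r \<turnstile> Plus F F \<approx> F" by (simp add: F derivable.by_axiom ax.plus_idem)
  finally show ?thesis unfolding summand_def .
qed

lemma summand_trans [trans]:
  assumes "summand E F" "summand F G"
  shows "summand E G"
proof -
  note c = summand_ccsp[OF assms(1)] summand_ccsp[OF assms(2)]
  have "Ax\<^sub>r \<turnstile> Plus E G \<approx> Plus E (Plus F G)"
    using assms(2) c by (auto simp: summand_def intro: derivable_plus_right[OF derivable.symmetry])
  also have "Ax\<^sub>r \<turnstile> Plus E (Plus F G) \<approx> Plus (Plus E F) G" using c by (simp add: derivable_assoc)
  also have "Ax\<^sub>r \<turnstile> Plus (Plus E F) G \<approx> Plus F G"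
    using assms(1) c by (auto simp: summand_def intro: derivable_plus_left)
  also have "Ax\<^sub>r \<turnstile> Plus F G \<approx> G" using assms(2) by (simp add: summand_def)
  finally show ?thesis unfolding summand_def .
qed

lemma summand_antisym:
  assumes "summand E F" "summand F E"
  shows "Ax\<^sub>r \<turnstile> E \<approx> F"
proof -
  have "Ax\<^sub>r \<turnstile> E \<approx> Plus F E" using assms(2) by (simp add: summand_def derivable.symmetry)
  also have "Ax\<^sub>r \<turnstile> Plus F E \<approx> Plus E F" using summand_ccsp[OF assms(1)] by (simp add: derivable_comm)
  also have "Ax\<^sub>r \<turnstile> Plus E F \<approx> F" using assms(1) by (simp add: summand_def)
  finally show ?thesis .
qed

lemma summand_plus_least:
  assumes "summand E G" "summand F G"
  shows "summand (Plus E F) G"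
proof -
  note c = summand_ccsp[OF assms(1)] summand_ccsp[OF assms(2)]
  have "Ax\<^sub>r \<turnstile> Plus (Plus E F) G \<approx> Plus E (Plus F G)"
    using c by (simp add: derivable_assoc derivable.symmetry)
  also have "Ax\<^sub>r \<turnstile> Plus E (Plus F G) \<approx> Plus E G"
    using assms(2) c by (simp add: summand_def derivable_plus_right)
  also have "Ax\<^sub>r \<turnstile> Plus E G \<approx> G" using assms(1) by (simp add: summand_def)
  finally show ?thesis unfolding summand_def .
qed

lemma summand_plus1: 
  assumes "ccsp E" "ccsp F" shows "summand E (Plus E F)"
proof -
  have "Ax\<^sub>r \<turnstile> Plus E (Plus E F) \<approx> Plus (Plus E E) F" using assms by (simp add: derivable_assoc)
  also have "Ax\<^sub>r \<turnstile> Plus (Plus E E) F \<approx> Plus E F"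
    using assms by (simp add: derivable_plus_left derivable.by_axiom ax.plus_idem)
  finally show ?thesis unfolding summand_def .
qed

lemma summand_plus2: "ccsp E \<Longrightarrow> ccsp F \<Longrightarrow> summand F (Plus E F)"
  using summand_trans[OF summand_plus1[of F E] summand_eq[OF derivable_comm]] by blast

lemma summand_zero: "ccsp E \<Longrightarrow> summand Zero E"
  unfolding summand_def
  by (rule derivable.transitivity[OF derivable_comm]) (simp_all add: derivable.by_axiom ax.plus_zero)

section \<open>Finite sums of prefixed expressions\<close>

lemma sum_prefix_Nil [simp]: "sum_prefix [] = Zero"
  by (simp add: sum_prefix_def)

lemma sum_prefix_Cons [simp]:
  "sum_prefix (p # ps) = Plus (Prefix (fst p) (snd p)) (sum_prefix ps)"
  by (simp add: sum_prefix_def case_prod_beta)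

lemma ccsp_sum [simp]: "ccsp (sum_prefix ps) \<longleftrightarrow> (\<forall>p \<in> set ps. ccsp (snd p))"
  by (induction ps) auto

lemma summand_mem:
  "(\<alpha>, E) \<in> set ps \<Longrightarrow> ccsp (sum_prefix ps) \<Longrightarrow> summand (Prefix \<alpha> E) (sum_prefix ps)"
proof (induction ps)
  case (Cons p ps)
  show ?case
  proof (cases "p = (\<alpha>, E)")
    case True
    then show ?thesis using Cons.prems by (auto intro: summand_plus1)
  next
    case False
    then have "summand (Prefix \<alpha> E) (sum_prefix ps)" using Cons by auto
    also have "summand (sum_prefix ps) (sum_prefix (p # ps))"
      using Cons.prems by (auto intro: summand_plus2)
    finally show ?thesis .
  qed
qed simp

text \<open>Equality is asked of the prefixed summands and not of their bodies, since the branching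
  axiom provides equations only under a prefix.\<close>

lemma summand_sum:
  assumes "\<And>\<alpha> E. (\<alpha>, E) \<in> set ps \<Longrightarrow>
      \<exists>F. (\<alpha>, F) \<in> set qs \<and> Ax\<^sub>r \<turnstile> Prefix \<alpha> E \<approx> Prefix \<alpha> F"
    and "ccsp (sum_prefix qs)"
  shows "summand (sum_prefix ps) (sum_prefix qs)"
  using assms(1)
proof (induction ps)
  case Nil
  then show ?case using assms(2) by (auto intro: summand_zero)
next
  case (Cons p ps)
  obtain F where "(fst p, F) \<in> set qs" "Ax\<^sub>r \<turnstile> Prefix (fst p) (snd p) \<approx> Prefix (fst p) F"
    using Cons.prems[of "fst p" "snd p"] by auto
  then have "summand (Prefix (fst p) (snd p)) (sum_prefix qs)"
    using summand_trans[OF summand_eq summand_mem[OF _ assms(2)]] by blast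
  then show ?case using Cons by (auto intro: summand_plus_least)
qed

lemma derivable_sum:
  assumes "\<And>\<alpha> E. (\<alpha>, E) \<in> set ps \<Longrightarrow>
      \<exists>F. (\<alpha>, F) \<in> set qs \<and> Ax\<^sub>r \<turnstile> Prefix \<alpha> E \<approx> Prefix \<alpha> F"
    and "\<And>\<alpha> F. (\<alpha>, F) \<in> set qs \<Longrightarrow>
      \<exists>E. (\<alpha>, E) \<in> set ps \<and> Ax\<^sub>r \<turnstile> Prefix \<alpha> E \<approx> Prefix \<alpha> F"
  shows "Ax\<^sub>r \<turnstile> sum_prefix ps \<approx> sum_prefix qs"
proof (rule summand_antisym)
  have ps: "ccsp (sum_prefix ps)" and qs: "ccsp (sum_prefix qs)"
    using assms by (fastforce dest: derivable_ccsp)+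
  show "summand (sum_prefix ps) (sum_prefix qs)"
    using assms(1) qs by (rule summand_sum)
  show "summand (sum_prefix qs) (sum_prefix ps)"
    by (rule summand_sum[OF _ ps]) (use assms(2) derivable.symmetry in blast)
qed

lemma derivable_sum_set:
  assumes "set ps = set qs" "ccsp (sum_prefix ps)"
  shows "Ax\<^sub>r \<turnstile> sum_prefix ps \<approx> sum_prefix qs"
  by (rule derivable_sum)
    (use assms in \<open>force intro: derivable_prefix derivable.reflexivity\<close>)+

lemma derivable_sum_map:
  assumes "\<And>\<alpha> E. (\<alpha>, E) \<in> set ps \<Longrightarrow> fst (f (\<alpha>, E)) = fst (g (\<alpha>, E)) \<and>
     Ax\<^sub>r \<turnstile> Prefix (fst (f (\<alpha>, E))) (snd (f (\<alpha>, E))) \<approx> Prefix (fst (f (\<alpha>, E))) (snd (g (\<alpha>, E)))"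
  shows "Ax\<^sub>r \<turnstile> sum_prefix (map f ps) \<approx> sum_prefix (map g ps)"
proof (rule derivable_sum)
  fix \<alpha> E assume "(\<alpha>, E) \<in> set (map f ps)"
  then obtain p where p: "p \<in> set ps" "f p = (\<alpha>, E)" by auto
  then show "\<exists>F. (\<alpha>, F) \<in> set (map g ps) \<and> Ax\<^sub>r \<turnstile> Prefix \<alpha> E \<approx> Prefix \<alpha> F"
    using assms[of "fst p" "snd p"] by (auto intro!: exI[of _ "snd (g p)"] image_eqI[of _ _ p] prod_eqI)
next
  fix \<alpha> E assume "(\<alpha>, E) \<in> set (map g ps)"
  then obtain p where p: "p \<in> set ps" "g p = (\<alpha>, E)" by auto
  then show "\<exists>F. (\<alpha>, F) \<in> set (map f ps) \<and> Ax\<^sub>r \<turnstile> Prefix \<alpha> F \<approx> Prefix \<alpha> E"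
    using assms[of "fst p" "snd p"] by (auto intro!: exI[of _ "snd (f p)"] image_eqI[of _ _ p] prod_eqI)
qed

lemma derivable_sum_append:
  "ccsp (sum_prefix ps) \<Longrightarrow> ccsp (sum_prefix qs) \<Longrightarrow>
    Ax\<^sub>r \<turnstile> sum_prefix (ps @ qs) \<approx> Plus (sum_prefix ps) (sum_prefix qs)"
proof (induction ps)
  case Nil
  then have "summand Zero (sum_prefix qs)" by (intro summand_zero)
  then show ?case by (simp add: summand_def derivable.symmetry)
next
  case (Cons p ps)
  have "Ax\<^sub>r \<turnstile> sum_prefix ((p # ps) @ qs)
      \<approx> Plus (Prefix (fst p) (snd p)) (Plus (sum_prefix ps) (sum_prefix qs))"
    using Cons by (simp add: derivable_plus_right)
  also have "Ax\<^sub>r \<turnstile> \<dots> \<approx> Plus (sum_prefix (p # ps)) (sum_prefix qs)"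
    using Cons.prems by (simp add: derivable_assoc)
  finally show ?case .
qed

lemma derivable_rotate:
  assumes "ccsp x" "ccsp y" "ccsp z"
  shows "Ax\<^sub>r \<turnstile> Plus (Plus x y) z \<approx> Plus (Plus y z) x"
  by (rule derivable.transitivity[OF derivable.symmetry[OF derivable_assoc] derivable_comm])
    (use assms in auto)

subsection \<open>The operators on sums\<close>

text \<open>The active summand \<open>\<alpha>.y\<close> is kept apart throughout the induction,
  because the axioms that drop a time-out or split off another active summand need it as an explicit
  witness.\<close>

lemma psi_active_aux:
  assumes "\<alpha> \<in> vis_tau X" "ccsp y" "ccsp (sum_prefix ps)"
  shows "Ax\<^sub>r \<turnstile> Psi X (Plus (sum_prefix ps) (Prefix \<alpha> y))
     \<approx> Plus (sum_prefix (filter (\<lambda>p. fst p \<noteq> Tout) ps)) (Prefix \<alpha> y)"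
  using assms(3)
proof (induction ps)
  case Nil
  have t: "\<alpha> \<noteq> Tout" using assms(1) by auto
  have z: "Ax\<^sub>r \<turnstile> Plus Zero (Prefix \<alpha> y) \<approx> Prefix \<alpha> y"
    using summand_zero[of "Prefix \<alpha> y"] assms(2) by (simp add: summand_def)
  have "Ax\<^sub>r \<turnstile> Psi X (Plus Zero (Prefix \<alpha> y)) \<approx> Psi X (Prefix \<alpha> y)"
    using z by (rule derivable_psi)
  also have "Ax\<^sub>r \<turnstile> Psi X (Prefix \<alpha> y) \<approx> Prefix \<alpha> y"
    using t assms(2) by (simp add: derivable.by_axiom ax.psi_prefix)
  also have "Ax\<^sub>r \<turnstile> Prefix \<alpha> y \<approx> Plus Zero (Prefix \<alpha> y)" using z by (rule derivable.symmetry)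
  finally show ?case by simp
next
  case (Cons p ps)
  let ?s = "sum_prefix ps" and ?f = "\<lambda>ps. sum_prefix (filter (\<lambda>p. fst p \<noteq> Tout) ps)"
  obtain \<beta> z where p: "p = (\<beta>, z)" by (cases p)
  have c: "ccsp z" "ccsp ?s" "ccsp (?f ps)" using Cons.prems p by auto
  have IH: "Ax\<^sub>r \<turnstile> Psi X (Plus ?s (Prefix \<alpha> y)) \<approx> Plus (?f ps) (Prefix \<alpha> y)"
    using Cons by simp
  have 1: "Ax\<^sub>r \<turnstile> Psi X (Plus (sum_prefix (p # ps)) (Prefix \<alpha> y))
      \<approx> Psi X (Plus (Plus ?s (Prefix \<alpha> y)) (Prefix \<beta> z))"
    using c assms(2) p by (simp add: derivable_psi derivable_rotate)
  show ?case
  proof (cases "\<beta> = Tout")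
    case True
    have "Ax\<^sub>r \<turnstile> Psi X (Plus (Plus ?s (Prefix \<alpha> y)) (Prefix \<beta> z)) \<approx> Psi X (Plus ?s (Prefix \<alpha> y))"
      using c assms True by (intro derivable.by_axiom) (auto intro!: ax.psi_drop)
    then show ?thesis using 1 IH True p by (auto intro: derivable.transitivity)
  next
    case False
    have "Ax\<^sub>r \<turnstile> Psi X (Plus (Plus ?s (Prefix \<alpha> y)) (Prefix \<beta> z))
        \<approx> Plus (Psi X (Plus ?s (Prefix \<alpha> y))) (Prefix \<beta> z)"
    proof (cases "\<beta> \<in> vis_tau X")
      case True
      then show ?thesis
        using c assms by (intro derivable.by_axiom ax.psi_split) auto
    next
      case notin: False
      then show ?thesis
        using c assms False by (intro derivable.by_axiom ax.psi_other) auto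
    qed
    also have "Ax\<^sub>r \<turnstile> \<dots> \<approx> Plus (Plus (?f ps) (Prefix \<alpha> y)) (Prefix \<beta> z)"
      using IH c by (intro derivable_plus_left) auto
    also have "Ax\<^sub>r \<turnstile> \<dots> \<approx> Plus (Plus (Prefix \<beta> z) (?f ps)) (Prefix \<alpha> y)"
      using c assms by (intro derivable.symmetry[OF derivable_rotate]) auto
    finally show ?thesis using 1 False p by (auto intro: derivable.transitivity)
  qed
qed

text \<open>By idempotence a copy of an active summand is added to serve as the witness for
  \<open>psi_active_aux\<close>; afterwards it is absorbed again.\<close>

lemma psi_sum_active:
  assumes "\<exists>p \<in> set ps. fst p \<in> vis_tau X" "ccsp (sum_prefix ps)"
  shows "Ax\<^sub>r \<turnstile> Psi X (sum_prefix ps) \<approx> sum_prefix (filter (\<lambda>p. fst p \<noteq> Tout) ps)"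
proof -
  obtain \<alpha> y where p: "(\<alpha>, y) \<in> set ps" "\<alpha> \<in> vis_tau X" using assms(1) by auto
  let ?f = "filter (\<lambda>p. fst p \<noteq> Tout) ps"
  have c: "ccsp y" using p assms(2) by auto
  have cf: "ccsp (sum_prefix ?f)" using assms(2) by auto
  have add: "Ax\<^sub>r \<turnstile> Plus (sum_prefix qs) (Prefix \<alpha> y) \<approx> sum_prefix qs"
    if "(\<alpha>, y) \<in> set qs" "ccsp (sum_prefix qs)" for qs
  proof -
    have "Ax\<^sub>r \<turnstile> Plus (sum_prefix qs) (Prefix \<alpha> y) \<approx> Plus (Prefix \<alpha> y) (sum_prefix qs)"
      using that(2) c by (intro derivable_comm) simp_all
    also have "Ax\<^sub>r \<turnstile> \<dots> \<approx> sum_prefix qs"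
      using summand_mem[OF that] by (simp add: summand_def)
    finally show ?thesis .
  qed
  have "Ax\<^sub>r \<turnstile> Psi X (sum_prefix ps) \<approx> Psi X (Plus (sum_prefix ps) (Prefix \<alpha> y))"
    by (rule derivable_psi[OF derivable.symmetry[OF add[OF p(1) assms(2)]]])
  also have "Ax\<^sub>r \<turnstile> \<dots> \<approx> Plus (sum_prefix ?f) (Prefix \<alpha> y)"
    using p(2) c assms(2) by (rule psi_active_aux)
  also have "Ax\<^sub>r \<turnstile> \<dots> \<approx> sum_prefix ?f"
    using p cf by (intro add) auto
  finally show ?thesis .
qed

text \<open>The list \<open>ys\<close> accumulates the targets of time-outs. The axiom for idle
  time-outs applies to pure sums of time-outs only, so these are collected while the visible
  summands are pulled out one by one.\<close>

lemma psi_idle_aux: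
  assumes "\<forall>p \<in> set ps. fst p \<notin> vis_tau X" "ccsp (sum_prefix ps)" "\<forall>y \<in> set ys. ccsp y"
  shows "Ax\<^sub>r \<turnstile> Psi X (Plus (sum_prefix (map (\<lambda>y. (Tout, y)) ys)) (sum_prefix ps))
     \<approx> Plus (sum_prefix (map (\<lambda>y. (Tout, Theta X X y)) ys))
        (sum_prefix (map (\<lambda>p. (fst p, if fst p = Tout then Theta X X (snd p) else snd p)) ps))"
  using assms
proof (induction ps arbitrary: ys)
  case Nil
  let ?t = "sum_prefix (map (\<lambda>y. (Tout, y)) ys)"
    and ?u = "sum_prefix (map (\<lambda>y. (Tout, Theta X X y)) ys)"
  have c: "ccsp ?t" "ccsp ?u" using Nil by auto
  have "Ax\<^sub>r \<turnstile> Psi X (Plus ?t Zero) \<approx> Psi X ?t"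
    using c by (intro derivable_psi derivable.by_axiom ax.plus_zero) auto
  also have "Ax\<^sub>r \<turnstile> \<dots> \<approx> ?u"
    using c by (intro derivable.by_axiom ax.psi_tout) auto
  also have "Ax\<^sub>r \<turnstile> \<dots> \<approx> Plus ?u Zero"
    using c by (intro derivable.symmetry[OF derivable.by_axiom] ax.plus_zero) auto
  finally show ?case by simp
next
  case (Cons p ps)
  let ?t = "\<lambda>ys. sum_prefix (map (\<lambda>y. (Tout, y)) ys)"
    and ?u = "\<lambda>ys. sum_prefix (map (\<lambda>y. (Tout, Theta X X y)) ys)"
    and ?g = "\<lambda>ps. sum_prefix (map (\<lambda>p. (fst p, if fst p = Tout then Theta X X (snd p) else snd p)) ps)"
  obtain \<beta> z where p: "p = (\<beta>, z)" by (cases p)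
  have c: "ccsp z" "ccsp (sum_prefix ps)" "ccsp (?t ys)" "ccsp (?u ys)" "ccsp (?g ps)"
    using Cons.prems p by auto
  show ?case
  proof (cases "\<beta> = Tout")
    case True
    have "Ax\<^sub>r \<turnstile> Psi X (Plus (?t ys) (sum_prefix (p # ps))) \<approx> Psi X (Plus (?t (z # ys)) (sum_prefix ps))"
    proof (rule derivable_psi)
      have "Ax\<^sub>r \<turnstile> Plus (?t ys) (sum_prefix (p # ps)) \<approx> Plus (Plus (Prefix \<beta> z) (sum_prefix ps)) (?t ys)"
        using c p by (simp add: derivable_comm)
      also have "Ax\<^sub>r \<turnstile> \<dots> \<approx> Plus (Plus (?t ys) (Prefix \<beta> z)) (sum_prefix ps)"
        using c by (intro derivable.symmetry[OF derivable_rotate]) auto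
      also have "Ax\<^sub>r \<turnstile> \<dots> \<approx> Plus (?t (z # ys)) (sum_prefix ps)"
        using c True by (simp add: derivable_plus_left derivable_comm)
      finally show "Ax\<^sub>r \<turnstile> Plus (?t ys) (sum_prefix (p # ps)) \<approx> Plus (?t (z # ys)) (sum_prefix ps)" .
    qed
    also have "Ax\<^sub>r \<turnstile> \<dots> \<approx> Plus (?u (z # ys)) (?g ps)"
      using Cons.prems p by (intro Cons.IH) auto
    also have "Ax\<^sub>r \<turnstile> \<dots> \<approx> Plus (Plus (?u ys) (?g ps)) (Prefix \<beta> (Theta X X z))"
      using c True by (simp add: derivable_rotate)
    also have "Ax\<^sub>r \<turnstile> \<dots> \<approx> Plus (?u ys) (?g (p # ps))"
    proof -
      have "Ax\<^sub>r \<turnstile> Plus (Plus (?u ys) (?g ps)) (Prefix \<beta> (Theta X X z))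
          \<approx> Plus (?u ys) (Plus (?g ps) (Prefix \<beta> (Theta X X z)))"
        using c by (intro derivable.symmetry[OF derivable_assoc]) auto
      also have "Ax\<^sub>r \<turnstile> \<dots> \<approx> Plus (?u ys) (?g (p # ps))"
        using c p True by (simp add: derivable_plus_right derivable_comm)
      finally show ?thesis .
    qed
    finally show ?thesis .
  next
    case False
    then have \<beta>: "\<beta> \<notin> vis_tau X \<union> {Tout}" using Cons.prems(1) p by auto
    have "Ax\<^sub>r \<turnstile> Psi X (Plus (?t ys) (sum_prefix (p # ps)))
        \<approx> Psi X (Plus (Plus (?t ys) (sum_prefix ps)) (Prefix \<beta> z))"
    proof (rule derivable_psi)
      have "Ax\<^sub>r \<turnstile> Plus (?t ys) (Plus (Prefix \<beta> z) (sum_prefix ps)) \<approx> Plus (Plus (Prefix \<beta> z) (sum_prefix ps)) (?t ys)"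
        using c p by (simp add: derivable_comm)
      also have "Ax\<^sub>r \<turnstile> \<dots> \<approx> Plus (Plus (sum_prefix ps) (?t ys)) (Prefix \<beta> z)"
        using c by (intro derivable_rotate) auto
      also have "Ax\<^sub>r \<turnstile> \<dots> \<approx> Plus (Plus (?t ys) (sum_prefix ps)) (Prefix \<beta> z)"
        using c by (intro derivable_plus_left derivable_comm) auto
      finally show "Ax\<^sub>r \<turnstile> Plus (?t ys) (sum_prefix (p # ps)) \<approx> Plus (Plus (?t ys) (sum_prefix ps)) (Prefix \<beta> z)"
        using p by simp
    qed
    also have "Ax\<^sub>r \<turnstile> \<dots> \<approx> Plus (Psi X (Plus (?t ys) (sum_prefix ps))) (Prefix \<beta> z)"
      using c \<beta> by (intro derivable.by_axiom ax.psi_other) auto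
    also have "Ax\<^sub>r \<turnstile> \<dots> \<approx> Plus (Plus (?u ys) (?g ps)) (Prefix \<beta> z)"
      using Cons c by (intro derivable_plus_left Cons.IH) auto
    also have "Ax\<^sub>r \<turnstile> \<dots> \<approx> Plus (?u ys) (Plus (?g ps) (Prefix \<beta> z))"
      using c by (intro derivable.symmetry[OF derivable_assoc]) auto
    also have "Ax\<^sub>r \<turnstile> \<dots> \<approx> Plus (?u ys) (?g (p # ps))"
      using c p False by (simp add: derivable_plus_right derivable_comm)
    finally show ?thesis .
  qed
qed

lemma derivable_zero_plus: "ccsp E \<Longrightarrow> Ax\<^sub>r \<turnstile> Plus Zero E \<approx> E"
  using summand_zero by (simp add: summand_def)

lemma psi_sum_idle:
  assumes "\<forall>p \<in> set ps. fst p \<notin> vis_tau X" "ccsp (sum_prefix ps)"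
  shows "Ax\<^sub>r \<turnstile> Psi X (sum_prefix ps)
     \<approx> sum_prefix (map (\<lambda>p. (fst p, if fst p = Tout then Theta X X (snd p) else snd p)) ps)"
    (is "Ax\<^sub>r \<turnstile> _ \<approx> ?g")
proof -
  have c: "ccsp ?g" using assms(2) by auto
  have "Ax\<^sub>r \<turnstile> Psi X (sum_prefix ps) \<approx> Psi X (Plus Zero (sum_prefix ps))"
    using assms(2) by (intro derivable_psi derivable.symmetry[OF derivable_zero_plus])
  also have "Ax\<^sub>r \<turnstile> \<dots> \<approx> Plus Zero ?g"
    using psi_idle_aux[OF assms, of "[]"] by simp
  also have "Ax\<^sub>r \<turnstile> \<dots> \<approx> ?g" using c by (rule derivable_zero_plus)
  finally show ?thesis .
qed

text \<open>The same technique as for \<psi>: with \<open>\<alpha>.y\<close> as witness, each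
  further summand is either dropped or split off, and a separated prefix keeps \<theta> on its
  target exactly when it is \<tau>.\<close>

lemma theta_active_aux:
  assumes "\<alpha> \<in> vis_tau L" "L \<subseteq> U" "ccsp y" "ccsp (sum_prefix ps)"
  shows "Ax\<^sub>r \<turnstile> Theta L U (Plus (sum_prefix ps) (Prefix \<alpha> y))
     \<approx> Plus (sum_prefix (map (\<lambda>p. (fst p, if fst p = Tau then Theta L U (snd p) else snd p))
          (filter (\<lambda>p. fst p \<in> vis_tau U) ps)))
        (Prefix \<alpha> (if \<alpha> = Tau then Theta L U y else y))"
  using assms(4)
proof (induction ps)
  case Nil
  let ?y = "Prefix \<alpha> (if \<alpha> = Tau then Theta L U y else y)"
  have "Ax\<^sub>r \<turnstile> Theta L U (Plus Zero (Prefix \<alpha> y)) \<approx> Theta L U (Prefix \<alpha> y)"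
    using assms by (intro derivable_theta derivable_zero_plus) auto
  also have "Ax\<^sub>r \<turnstile> Theta L U (Prefix \<alpha> y) \<approx> ?y"
    using assms by (auto intro!: derivable.by_axiom ax.theta_prefix ax.theta_tau)
  also have "Ax\<^sub>r \<turnstile> ?y \<approx> Plus Zero ?y"
    using assms by (intro derivable.symmetry[OF derivable_zero_plus]) auto
  finally show ?case by simp
next
  case (Cons p ps)
  let ?s = "sum_prefix ps" and ?y = "Prefix \<alpha> (if \<alpha> = Tau then Theta L U y else y)"
  let ?f = "\<lambda>ps. sum_prefix (map (\<lambda>p. (fst p, if fst p = Tau then Theta L U (snd p) else snd p))
          (filter (\<lambda>p. fst p \<in> vis_tau U) ps))"
  obtain \<beta> z where p: "p = (\<beta>, z)" by (cases p)
  let ?z = "Prefix \<beta> (if \<beta> = Tau then Theta L U z else z)"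
  have c: "ccsp z" "ccsp ?s" "ccsp (?f ps)" "ccsp ?y" "ccsp ?z" using assms Cons.prems p by auto
  have IH: "Ax\<^sub>r \<turnstile> Theta L U (Plus ?s (Prefix \<alpha> y)) \<approx> Plus (?f ps) ?y"
    using Cons by simp
  have 1: "Ax\<^sub>r \<turnstile> Theta L U (Plus (sum_prefix (p # ps)) (Prefix \<alpha> y))
      \<approx> Theta L U (Plus (Plus ?s (Prefix \<alpha> y)) (Prefix \<beta> z))"
    using c assms p by (simp add: derivable_theta derivable_rotate)
  show ?case
  proof (cases "\<beta> \<in> vis_tau U")
    case False
    have "Ax\<^sub>r \<turnstile> Theta L U (Plus (Plus ?s (Prefix \<alpha> y)) (Prefix \<beta> z)) \<approx> Theta L U (Plus ?s (Prefix \<alpha> y))"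
      using c assms False by (intro derivable.by_axiom ax.theta_drop) auto
    then have "Ax\<^sub>r \<turnstile> Theta L U (Plus (sum_prefix (p # ps)) (Prefix \<alpha> y)) \<approx> Plus (?f ps) ?y"
      using 1 IH by (blast intro: derivable.transitivity)
    then show ?thesis using False p by simp
  next
    case True
    have "Ax\<^sub>r \<turnstile> Theta L U (Plus (Plus ?s (Prefix \<alpha> y)) (Prefix \<beta> z))
        \<approx> Plus (Theta L U (Plus ?s (Prefix \<alpha> y))) (Theta L U (Prefix \<beta> z))"
      using c assms True by (intro derivable.by_axiom ax.theta_split) auto
    also have "Ax\<^sub>r \<turnstile> \<dots> \<approx> Plus (Plus (?f ps) ?y) ?z"
      using IH c assms
      by (intro derivable_plus) (auto intro!: derivable.by_axiom ax.theta_prefix ax.theta_tau)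
    also have "Ax\<^sub>r \<turnstile> \<dots> \<approx> Plus (Plus ?z (?f ps)) ?y"
      using c by (intro derivable.symmetry[OF derivable_rotate])
    finally have "Ax\<^sub>r \<turnstile> Theta L U (Plus (sum_prefix (p # ps)) (Prefix \<alpha> y)) \<approx> Plus (Plus ?z (?f ps)) ?y"
      using 1 by (blast intro: derivable.transitivity)
    moreover have "filter (\<lambda>p. fst p \<in> vis_tau U) (p # ps) = (\<beta>, z) # filter (\<lambda>p. fst p \<in> vis_tau U) ps"
      using True p by simp
    ultimately show ?thesis by (simp only: list.map sum_prefix_Cons fst_conv snd_conv)
  qed
qed

lemma theta_sum_active:
  assumes "\<exists>p \<in> set ps. fst p \<in> vis_tau L" "L \<subseteq> U" "ccsp (sum_prefix ps)"
  shows "Ax\<^sub>r \<turnstile> Theta L U (sum_prefix ps)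
    \<approx> sum_prefix (map (\<lambda>p. (fst p, if fst p = Tau then Theta L U (snd p) else snd p))
          (filter (\<lambda>p. fst p \<in> vis_tau U) ps))"
    (is "Ax\<^sub>r \<turnstile> _ \<approx> sum_prefix ?f")
proof -
  obtain \<alpha> y where p: "(\<alpha>, y) \<in> set ps" "\<alpha> \<in> vis_tau L" using assms(1) by auto
  let ?y = "if \<alpha> = Tau then Theta L U y else y"
  have c: "ccsp y" using p assms(3) by auto
  have cf: "ccsp (sum_prefix ?f)" using assms by auto
  have add: "Ax\<^sub>r \<turnstile> Plus (sum_prefix qs) (Prefix \<alpha> y) \<approx> sum_prefix qs"
    if "(\<alpha>, y) \<in> set qs" "ccsp (sum_prefix qs)" for qs y
  proof -
    have "Ax\<^sub>r \<turnstile> Plus (sum_prefix qs) (Prefix \<alpha> y) \<approx> Plus (Prefix \<alpha> y) (sum_prefix qs)"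
      using that by (intro derivable_comm) auto
    also have "Ax\<^sub>r \<turnstile> \<dots> \<approx> sum_prefix qs"
      using summand_mem[OF that] by (simp add: summand_def)
    finally show ?thesis .
  qed
  have "Ax\<^sub>r \<turnstile> Theta L U (sum_prefix ps) \<approx> Theta L U (Plus (sum_prefix ps) (Prefix \<alpha> y))"
    by (rule derivable_theta[OF derivable.symmetry[OF add[OF p(1) assms(3)]] assms(2)])
  also have "Ax\<^sub>r \<turnstile> \<dots> \<approx> Plus (sum_prefix ?f) (Prefix \<alpha> ?y)"
    using p(2) assms(2) c assms(3) by (rule theta_active_aux)
  also have "Ax\<^sub>r \<turnstile> \<dots> \<approx> sum_prefix ?f"
  proof (rule add[OF _ cf])
    \<comment> \<open>The witness lies in L, hence in U, and so passes the filter; this is where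
      \<open>L \<subseteq> U\<close> makes the extra copy redundant.\<close>
    show "(\<alpha>, ?y) \<in> set ?f" using p assms(2) by (force simp: image_iff)
  qed
  finally show ?thesis .
qed

lemma theta_sum_idle:
  assumes "\<forall>p \<in> set ps. fst p \<notin> vis_tau L" "L \<subseteq> U" "ccsp (sum_prefix ps)"
  shows "Ax\<^sub>r \<turnstile> Theta L U (sum_prefix ps) \<approx> sum_prefix ps"
  using assms by (intro derivable.by_axiom ax.theta_idle) auto

lemma hide_sum:
  assumes "ccsp (sum_prefix ps)"
  shows "Ax\<^sub>r \<turnstile> Hide I (sum_prefix ps)
    \<approx> sum_prefix (map (\<lambda>p. (if fst p \<in> Vis ` I then Tau else fst p, Hide I (snd p))) ps)"
  using assms
proof (induction ps)
  case Nil
  then show ?case by (simp add: derivable.by_axiom ax.hide_zero)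
next
  case (Cons p ps)
  then have c: "ccsp (snd p)" "ccsp (sum_prefix ps)" by auto
  have "Ax\<^sub>r \<turnstile> Hide I (sum_prefix (p # ps))
      \<approx> Plus (Hide I (Prefix (fst p) (snd p))) (Hide I (sum_prefix ps))"
    using c by (intro derivable.by_axiom) (auto intro: ax.hide_sum)
  also have "Ax\<^sub>r \<turnstile> \<dots> \<approx> sum_prefix (map (\<lambda>p. (if fst p \<in> Vis ` I then Tau else fst p, Hide I (snd p))) (p # ps))"
    unfolding list.map sum_prefix_Cons fst_conv snd_conv
    using c Cons by (intro derivable_plus) (auto intro!: derivable.by_axiom ax.hide_in ax.hide_notin)
  finally show ?case .
qed

definition relabels :: "('a \<times> 'a) set \<Rightarrow> 'a act \<Rightarrow> 'a act set" where
  "relabels R \<alpha> = (case \<alpha> of Vis a \<Rightarrow> Vis ` {b. (a, b) \<in> R} | _ \<Rightarrow> {\<alpha>})"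

text \<open>Only the set of summands is fixed, because the finitely many images of an action are
  enumerated in an arbitrary order.\<close>

lemma rename_sum:
  assumes "ccsp (sum_prefix ps)" "\<forall>a. finite {b. (a, b) \<in> R}"
  shows "\<exists>qs. set qs = {(\<beta>, Rename R E) | \<alpha> \<beta> E. (\<alpha>, E) \<in> set ps \<and> \<beta> \<in> relabels R \<alpha>} \<and>
    Ax\<^sub>r \<turnstile> Rename R (sum_prefix ps) \<approx> sum_prefix qs"
  using assms(1)
proof (induction ps)
  case Nil
  then show ?case using assms(2) by (auto intro!: exI[of _ "[]"] derivable.by_axiom ax.rename_zero)
next
  case (Cons p ps)
  obtain \<alpha> E where p: "p = (\<alpha>, E)" by (cases p)
  have c: "ccsp E" "ccsp (sum_prefix ps)" using Cons.prems p by auto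
  obtain qs where qs: "set qs = {(\<beta>, Rename R E) | \<alpha> \<beta> E. (\<alpha>, E) \<in> set ps \<and> \<beta> \<in> relabels R \<alpha>}"
    "Ax\<^sub>r \<turnstile> Rename R (sum_prefix ps) \<approx> sum_prefix qs"
    using Cons.IH c by blast
  have "\<exists>rs. set rs = {(\<beta>, Rename R E) | \<beta>. \<beta> \<in> relabels R \<alpha>} \<and>
      Ax\<^sub>r \<turnstile> Rename R (Prefix \<alpha> E) \<approx> sum_prefix rs"
  proof (cases \<alpha>)
    case (Vis a)
    obtain bs where bs: "set bs = {b. (a, b) \<in> R}" "distinct bs"
      using assms(2) finite_distinct_list by metis
    show ?thesis
      using Vis c assms(2) bs
      by (intro exI[of _ "map (\<lambda>b. (Vis b, Rename R E)) bs"])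
        (auto simp: relabels_def intro!: derivable.by_axiom ax.rename_vis)
  next
    case Tau
    have "Ax\<^sub>r \<turnstile> Rename R (Prefix \<alpha> E) \<approx> Prefix \<alpha> (Rename R E)"
      using Tau c assms(2) by (auto intro!: derivable.by_axiom ax.rename_tau)
    also have "Ax\<^sub>r \<turnstile> \<dots> \<approx> Plus (Prefix \<alpha> (Rename R E)) Zero"
      using c assms(2) by (intro derivable.symmetry[OF derivable.by_axiom] ax.plus_zero) auto
    finally show ?thesis
      using Tau by (intro exI[of _ "[(\<alpha>, Rename R E)]"]) (simp add: relabels_def)
  next
    case Tout
    have "Ax\<^sub>r \<turnstile> Rename R (Prefix \<alpha> E) \<approx> Prefix \<alpha> (Rename R E)"
      using Tout c assms(2) by (auto intro!: derivable.by_axiom ax.rename_tout)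
    also have "Ax\<^sub>r \<turnstile> \<dots> \<approx> Plus (Prefix \<alpha> (Rename R E)) Zero"
      using c assms(2) by (intro derivable.symmetry[OF derivable.by_axiom] ax.plus_zero) auto
    finally show ?thesis
      using Tout by (intro exI[of _ "[(\<alpha>, Rename R E)]"]) (simp add: relabels_def)
  qed
  then obtain rs where rs: "set rs = {(\<beta>, Rename R E) | \<beta>. \<beta> \<in> relabels R \<alpha>}"
    "Ax\<^sub>r \<turnstile> Rename R (Prefix \<alpha> E) \<approx> sum_prefix rs" by blast
  have "Ax\<^sub>r \<turnstile> Rename R (sum_prefix (p # ps))
      \<approx> Plus (Rename R (Prefix \<alpha> E)) (Rename R (sum_prefix ps))"
    using c p assms(2) by (intro derivable.by_axiom) (auto intro: ax.rename_sum)
  also have "Ax\<^sub>r \<turnstile> \<dots> \<approx> Plus (sum_prefix rs) (sum_prefix qs)"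
    using rs(2) qs(2) by (rule derivable_plus)
  also have "Ax\<^sub>r \<turnstile> \<dots> \<approx> sum_prefix (rs @ qs)"
    using derivable_ccsp2[OF rs(2)] derivable_ccsp2[OF qs(2)]
    by (intro derivable.symmetry[OF derivable_sum_append])
  finally show ?case
    using rs(1) qs(1) p by (intro exI[of _ "rs @ qs"]) auto
qed

text \<open>An instance of the branching axiom. Let x be the sum of those members of
  \<open>ps\<close> that also occur in \<open>qs\<close>, and q the sum of \<open>qs\<close>. Then K
  = x + q because x consists of summands of q, and the sum of \<open>ps\<close> is \<tau>.(x + q) +
  x.\<close>

lemma absorb_inert:
  assumes K: "Ax\<^sub>r \<turnstile> K \<approx> sum_prefix qs" and inert: "(Tau, K) \<in> set ps"
    and others: "\<And>p. p \<in> set ps \<Longrightarrow> p = (Tau, K) \<or> p \<in> set qs"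
  shows "Ax\<^sub>r \<turnstile> Prefix \<alpha> (sum_prefix ps) \<approx> Prefix \<alpha> K"
proof -
  define xs where "xs = filter (\<lambda>p. p \<in> set qs) ps"
  let ?x = "sum_prefix xs" and ?q = "sum_prefix qs"
  have c: "ccsp K" "ccsp ?q" using K derivable_ccsp by blast+
  then have cx: "ccsp ?x" by (auto simp: xs_def)
  have xq: "Ax\<^sub>r \<turnstile> K \<approx> Plus ?x ?q"
  proof (rule derivable.transitivity[OF K derivable.symmetry])
    have "summand ?x ?q"
      using c by (intro summand_sum) (force simp: xs_def intro: derivable_prefix derivable.reflexivity)+
    then show "Ax\<^sub>r \<turnstile> Plus ?x ?q \<approx> ?q" by (simp add: summand_def)
  qed
  have "set ps = set ((Tau, K) # xs)" using inert others by (auto simp: xs_def)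
  then have "Ax\<^sub>r \<turnstile> sum_prefix ((Tau, K) # xs) \<approx> sum_prefix ps"
    using c cx by (intro derivable_sum_set) auto
  then have "Ax\<^sub>r \<turnstile> Prefix \<alpha> (sum_prefix ps) \<approx> Prefix \<alpha> (Plus (Prefix Tau K) ?x)"
    by (intro derivable_prefix[OF derivable.symmetry]) simp
  also have "Ax\<^sub>r \<turnstile> \<dots> \<approx> Prefix \<alpha> (Plus (Prefix Tau (Plus ?x ?q)) ?x)"
    using xq cx by (intro derivable_prefix derivable_plus_left)
  also have "Ax\<^sub>r \<turnstile> \<dots> \<approx> Prefix \<alpha> (Plus ?x ?q)"
    using c cx by (intro derivable.by_axiom ax.branching) auto
  also have "Ax\<^sub>r \<turnstile> \<dots> \<approx> Prefix \<alpha> K"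
    by (rule derivable_prefix[OF derivable.symmetry[OF xq]])
  finally show ?thesis .
qed

text \<open>Every \<open>\<psi>\<^sub>X\<close> is active in the presence of a \<open>\<tau>\<close>-summand.\<close>

lemma drop_timeouts:
  assumes "(Tau, E) \<in> set ps" "ccsp (sum_prefix ps)"
  shows "Ax\<^sub>r \<turnstile> sum_prefix ps \<approx> sum_prefix (filter (\<lambda>p. fst p \<noteq> Tout) ps)"
proof (rule derivable.reactive_approximation, rule allI)
  fix X
  let ?f = "filter (\<lambda>p. fst p \<noteq> Tout)"
  have "Ax\<^sub>r \<turnstile> Psi X (sum_prefix ps) \<approx> sum_prefix (?f ps)"
    using assms by (intro psi_sum_active) force+
  also have "Ax\<^sub>r \<turnstile> \<dots> \<approx> Psi X (sum_prefix (?f ps))"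
  proof (rule derivable.symmetry)
    have "Ax\<^sub>r \<turnstile> Psi X (sum_prefix (?f ps)) \<approx> sum_prefix (?f (?f ps))"
      using assms by (intro psi_sum_active) force+
    then show "Ax\<^sub>r \<turnstile> Psi X (sum_prefix (?f ps)) \<approx> sum_prefix (?f ps)" by simp
  qed
  finally show "Ax\<^sub>r \<turnstile> Psi X (sum_prefix ps) \<approx> Psi X (sum_prefix (?f ps))" .
qed

section \<open>Head normal forms\<close>

lemma relabels_iff:
  "\<beta> \<in> relabels R \<alpha> \<longleftrightarrow>
     (\<exists>a b. \<alpha> = Vis a \<and> \<beta> = Vis b \<and> (a, b) \<in> R) \<or> \<beta> = \<alpha> \<and> (\<alpha> = Tau \<or> \<alpha> = Tout)"
  by (cases \<alpha>) (auto simp: relabels_def)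

lemma transition_simps:
  "transition Zero \<alpha> P' \<longleftrightarrow> False"
  "transition (Prefix \<beta> P) \<alpha> P' \<longleftrightarrow> \<alpha> = \<beta> \<and> P' = P"
  "transition (Plus P Q) \<alpha> P' \<longleftrightarrow> transition P \<alpha> P' \<or> transition Q \<alpha> P'"
  "transition (Par A P Q) \<alpha> R \<longleftrightarrow>
     (\<exists>P'. transition P \<alpha> P' \<and> \<alpha> \<notin> Vis ` A \<and> R = Par A P' Q) \<or>
     (\<exists>Q'. transition Q \<alpha> Q' \<and> \<alpha> \<notin> Vis ` A \<and> R = Par A P Q') \<or>
     (\<exists>P' Q'. transition P \<alpha> P' \<and> transition Q \<alpha> Q' \<and> \<alpha> \<in> Vis ` A \<and> R = Par A P' Q')"
  "transition (Hide I P) \<alpha> R \<longleftrightarrow>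
     (\<exists>\<beta> P'. transition P \<beta> P' \<and> \<alpha> = (if \<beta> \<in> Vis ` I then Tau else \<beta>) \<and> R = Hide I P')"
  "transition (Rename B P) \<alpha> R \<longleftrightarrow>
     (\<exists>\<beta> P'. transition P \<beta> P' \<and> \<alpha> \<in> relabels B \<beta> \<and> R = Rename B P')"
  "transition (Rec x S) \<alpha> P' \<longleftrightarrow> (\<exists>E. S x = Some E \<and> transition (subst E (rec_subst S)) \<alpha> P')"
  unfolding transition_def
proof goal_cases
  case 1 show ?case by (subst trans_wrt.simps) auto
next
  case 2 show ?case by (subst trans_wrt.simps) auto
next
  case 3 show ?case by (subst trans_wrt.simps) auto
next
  case 4 show ?case by (subst trans_wrt.simps) (auto simp: image_iff; blast)
next
  case 5 show ?case by (subst trans_wrt.simps) (auto split: if_splits)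
next
  case 6 show ?case by (subst trans_wrt.simps) (auto simp: relabels_iff)
next
  case 7 show ?case by (subst trans_wrt.simps) auto
qed

text \<open>On processes the overapproximation \<open>possible_initials\<close> in the negative
  premises is exact, so the rules can be read with the actual initials.\<close>

lemma transition_Theta:
  "process P \<Longrightarrow> transition (Theta L U P) \<alpha> R \<longleftrightarrow>
     (if initials P \<inter> vis_tau L = {} then transition P \<alpha> R \<or> (\<exists>P'. transition P Tau P' \<and> \<alpha> = Tau \<and> R = Theta L U P')
      else (\<exists>P'. transition P \<alpha> P' \<and> \<alpha> \<in> vis_tau U \<and> R = (if \<alpha> = Tau then Theta L U P' else P')))
       \<or> (\<exists>a\<in>U. \<alpha> = Vis a \<and> transition P \<alpha> R)"
  unfolding transition_def by (subst trans_wrt.simps) (auto simp: possible_initials_eq_initials)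

lemma transition_Psi:
  "process P \<Longrightarrow> transition (Psi X P) \<alpha> R \<longleftrightarrow>
     (\<alpha> \<noteq> Tout \<and> transition P \<alpha> R) \<or>
     (initials P \<inter> vis_tau X = {} \<and> \<alpha> = Tout \<and> (\<exists>P'. transition P \<alpha> P' \<and> R = Theta X X P'))"
  unfolding transition_def by (subst trans_wrt.simps) (auto simp: possible_initials_eq_initials)

text \<open>The list enumerates exactly the transitions, so a head normal form includes finite
  branching, and its targets are literally those of the transition relation.\<close>

definition hnf :: "'a expr \<Rightarrow> bool" where
  "hnf P \<longleftrightarrow> (\<exists>ps. set ps = {(\<alpha>, P'). transition P \<alpha> P'} \<and> Ax\<^sub>r \<turnstile> P \<approx> sum_prefix ps)"

lemma hnfI:
  "Ax\<^sub>r \<turnstile> P \<approx> sum_prefix ps \<Longrightarrow> (\<And>\<alpha> P'. (\<alpha>, P') \<in> set ps \<longleftrightarrow> transition P \<alpha> P') \<Longrightarrow> hnf P"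
  unfolding hnf_def by auto

lemma hnfE:
  assumes "hnf P"
  obtains ps where "Ax\<^sub>r \<turnstile> P \<approx> sum_prefix ps" "\<And>\<alpha> P'. (\<alpha>, P') \<in> set ps \<longleftrightarrow> transition P \<alpha> P'"
    "ccsp P" "ccsp (sum_prefix ps)"
  using assms derivable_ccsp unfolding hnf_def by blast

lemma hnf_zero: "hnf Zero"
  by (rule hnfI[of _ "[]"]) (auto simp: transition_simps intro: derivable.reflexivity)

lemma hnf_prefix: "ccsp P \<Longrightarrow> hnf (Prefix \<alpha> P)"
  by (rule hnfI[of _ "[(\<alpha>, P)]"])
    (auto simp: transition_simps intro!: derivable.symmetry[OF derivable.by_axiom] ax.plus_zero)

lemma hnf_plus:
  assumes "hnf P" "hnf Q" shows "hnf (Plus P Q)"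
proof -
  from assms(1) obtain ps where ps: "Ax\<^sub>r \<turnstile> P \<approx> sum_prefix ps" "\<And>\<alpha> P'. (\<alpha>, P') \<in> set ps \<longleftrightarrow> transition P \<alpha> P'"
    "ccsp P" "ccsp (sum_prefix ps)" by (rule hnfE) blast
  from assms(2) obtain qs where qs: "Ax\<^sub>r \<turnstile> Q \<approx> sum_prefix qs" "\<And>\<alpha> P'. (\<alpha>, P') \<in> set qs \<longleftrightarrow> transition Q \<alpha> P'"
    "ccsp Q" "ccsp (sum_prefix qs)" by (rule hnfE) blast
  have "Ax\<^sub>r \<turnstile> Plus P Q \<approx> Plus (sum_prefix ps) (sum_prefix qs)"
    using ps(1) qs(1) by (rule derivable_plus)
  also have "Ax\<^sub>r \<turnstile> \<dots> \<approx> sum_prefix (ps @ qs)"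
    using ps(4) qs(4) by (rule derivable.symmetry[OF derivable_sum_append])
  finally show ?thesis by (rule hnfI) (auto simp: ps(2) qs(2) transition_simps)
qed

lemma hnf_hide:
  assumes "hnf P" shows "hnf (Hide I P)"
proof -
  from assms(1) obtain ps where ps: "Ax\<^sub>r \<turnstile> P \<approx> sum_prefix ps" "\<And>\<alpha> P'. (\<alpha>, P') \<in> set ps \<longleftrightarrow> transition P \<alpha> P'"
    "ccsp P" "ccsp (sum_prefix ps)" by (rule hnfE) blast
  have "Ax\<^sub>r \<turnstile> Hide I P \<approx> Hide I (sum_prefix ps)" using ps(1) by (rule derivable_hide)
  also have "Ax\<^sub>r \<turnstile> \<dots> \<approx> sum_prefix (map (\<lambda>p. (if fst p \<in> Vis ` I then Tau else fst p, Hide I (snd p))) ps)"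
    using ps(4) by (rule hide_sum)
  finally show ?thesis
  proof (rule hnfI)
    fix \<alpha> P'
    show "(\<alpha>, P') \<in> set (map (\<lambda>p. (if fst p \<in> Vis ` I then Tau else fst p, Hide I (snd p))) ps)
        \<longleftrightarrow> transition (Hide I P) \<alpha> P'"
      unfolding transition_simps ps(2)[symmetric] by (auto simp: image_iff Bex_def)
  qed
qed

lemma hnf_rename:
  assumes "hnf P" "\<forall>a. finite {b. (a, b) \<in> R}" shows "hnf (Rename R P)"
proof -
  from assms(1) obtain ps where ps: "Ax\<^sub>r \<turnstile> P \<approx> sum_prefix ps" "\<And>\<alpha> P'. (\<alpha>, P') \<in> set ps \<longleftrightarrow> transition P \<alpha> P'"
    "ccsp P" "ccsp (sum_prefix ps)" by (rule hnfE) blast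
  obtain qs where qs: "set qs = {(\<beta>, Rename R E) | \<alpha> \<beta> E. (\<alpha>, E) \<in> set ps \<and> \<beta> \<in> relabels R \<alpha>}"
    "Ax\<^sub>r \<turnstile> Rename R (sum_prefix ps) \<approx> sum_prefix qs"
    using rename_sum[OF ps(4) assms(2)] by blast
  have "Ax\<^sub>r \<turnstile> Rename R P \<approx> sum_prefix qs"
    using derivable_rename[OF ps(1) assms(2)] qs(2) by (rule derivable.transitivity)
  then show ?thesis by (rule hnfI) (auto simp: qs(1) ps(2) transition_simps)
qed

lemma initials_hnf:
  assumes "\<And>\<alpha> P'. (\<alpha>, P') \<in> set ps \<longleftrightarrow> transition P \<alpha> P'"
  shows "initials P \<inter> vis_tau X = {} \<longleftrightarrow> (\<forall>p \<in> set ps. fst p \<notin> vis_tau X)"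
  unfolding initials_def assms[symmetric] by (auto simp: Ball_def disjoint_iff)

lemma hnf_theta:
  assumes "process P" "hnf P" "L \<subseteq> U" shows "hnf (Theta L U P)"
proof -
  from assms(2) obtain ps where ps: "Ax\<^sub>r \<turnstile> P \<approx> sum_prefix ps" "\<And>\<alpha> P'. (\<alpha>, P') \<in> set ps \<longleftrightarrow> transition P \<alpha> P'"
    "ccsp P" "ccsp (sum_prefix ps)" by (rule hnfE) blast
  have 1: "Ax\<^sub>r \<turnstile> Theta L U P \<approx> Theta L U (sum_prefix ps)" using ps(1) assms(3) by (rule derivable_theta)
  show ?thesis
  proof (cases "initials P \<inter> vis_tau L = {}")
    case True
    then have i: "\<forall>p \<in> set ps. fst p \<notin> vis_tau L" using initials_hnf[OF ps(2)] by blast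
    have "Ax\<^sub>r \<turnstile> Theta L U P \<approx> sum_prefix ps"
      using 1 theta_sum_idle[OF i assms(3) ps(4)] by (rule derivable.transitivity)
    then show ?thesis
    proof (rule hnfI)
      have "\<not> transition P Tau P'" for P' using i ps(2)[of Tau P'] by force
      then show "(\<alpha>, P') \<in> set ps \<longleftrightarrow> transition (Theta L U P) \<alpha> P'" for \<alpha> P'
        using True assms(1) by (auto simp: transition_Theta ps(2))
    qed
  next
    case False
    then have i: "\<exists>p \<in> set ps. fst p \<in> vis_tau L" using initials_hnf[OF ps(2)] by blast
    show ?thesis
    proof (rule hnfI[OF derivable.transitivity[OF 1 theta_sum_active[OF i assms(3) ps(4)]]])
      fix \<alpha> R
      show "(\<alpha>, R) \<in> set (map (\<lambda>p. (fst p, if fst p = Tau then Theta L U (snd p) else snd p))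
          (filter (\<lambda>p. fst p \<in> vis_tau U) ps)) \<longleftrightarrow> transition (Theta L U P) \<alpha> R"
        unfolding transition_Theta[OF assms(1)] ps(2)[symmetric]
        using False by (auto simp: image_iff)
    qed
  qed
qed

lemma hnf_psi:
  assumes "process P" "hnf P" shows "hnf (Psi X P)"
proof -
  from assms(2) obtain ps where ps: "Ax\<^sub>r \<turnstile> P \<approx> sum_prefix ps" "\<And>\<alpha> P'. (\<alpha>, P') \<in> set ps \<longleftrightarrow> transition P \<alpha> P'"
    "ccsp P" "ccsp (sum_prefix ps)" by (rule hnfE) blast
  have 1: "Ax\<^sub>r \<turnstile> Psi X P \<approx> Psi X (sum_prefix ps)" using ps(1) by (rule derivable_psi)
  show ?thesis
  proof (cases "initials P \<inter> vis_tau X = {}")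
    case True
    then have i: "\<forall>p \<in> set ps. fst p \<notin> vis_tau X" using initials_hnf[OF ps(2)] by blast
    show ?thesis
    proof (rule hnfI[OF derivable.transitivity[OF 1 psi_sum_idle[OF i ps(4)]]])
      fix \<alpha> R
      show "(\<alpha>, R) \<in> set (map (\<lambda>p. (fst p, if fst p = Tout then Theta X X (snd p) else snd p)) ps)
          \<longleftrightarrow> transition (Psi X P) \<alpha> R"
        unfolding transition_Psi[OF assms(1)] ps(2)[symmetric] using True by (auto simp: image_iff Bex_def)
    qed
  next
    case False
    then have i: "\<exists>p \<in> set ps. fst p \<in> vis_tau X" using initials_hnf[OF ps(2)] by blast
    show ?thesis
      using False
      by (intro hnfI[OF derivable.transitivity[OF 1 psi_sum_active[OF i ps(4)]]])
        (auto simp: transition_Psi[OF assms(1)] ps(2))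
  qed
qed

text \<open>The expansion law needs literal sums as arguments and leaves them inside the targets of
  the resulting summands. There they are rewritten back to P and Q, below the prefixes, so that the
  targets become those of the transitions.\<close>

lemma hnf_par:
  assumes "hnf P" "hnf Q" shows "hnf (Par A P Q)"
proof -
  from assms(1) obtain ps where ps: "Ax\<^sub>r \<turnstile> P \<approx> sum_prefix ps" "\<And>\<alpha> P'. (\<alpha>, P') \<in> set ps \<longleftrightarrow> transition P \<alpha> P'"
    "ccsp P" "ccsp (sum_prefix ps)" by (rule hnfE) blast
  from assms(2) obtain qs where qs: "Ax\<^sub>r \<turnstile> Q \<approx> sum_prefix qs" "\<And>\<alpha> P'. (\<alpha>, P') \<in> set qs \<longleftrightarrow> transition Q \<alpha> P'"
    "ccsp Q" "ccsp (sum_prefix qs)" by (rule hnfE) blast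
  let ?l = "\<lambda>Q. [(\<alpha>, Par A P' Q). (\<alpha>, P') \<leftarrow> ps, \<alpha> \<notin> Vis ` A]"
    and ?r = "\<lambda>P. [(\<beta>, Par A P Q'). (\<beta>, Q') \<leftarrow> qs, \<beta> \<notin> Vis ` A]"
    and ?s = "[(\<alpha>, Par A P' Q'). (\<alpha>, P') \<leftarrow> ps, (\<beta>, Q') \<leftarrow> qs, \<alpha> = \<beta> \<and> \<beta> \<in> Vis ` A]"
  let ?P = "sum_prefix ps" and ?Q = "sum_prefix qs"
  have cP: "ccsp P'" if "(\<alpha>, P') \<in> set ps" for \<alpha> P' using ps(4) that by auto
  have cQ: "ccsp Q'" if "(\<alpha>, Q') \<in> set qs" for \<alpha> Q' using qs(4) that by auto
  have c: "ccsp (sum_prefix (?l Q))" "ccsp (sum_prefix (?l ?Q))" "ccsp (sum_prefix (?r P))"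
      "ccsp (sum_prefix (?r ?P))" "ccsp (sum_prefix ?s)"
    using cP cQ ps(3,4) qs(3,4) by (auto simp del: ccsp_sum simp: ccsp_sum[of "concat _"])
  have "Ax\<^sub>r \<turnstile> Par A P Q \<approx> Par A ?P ?Q" using ps(1) qs(1) by (rule derivable_par)
  also have "Ax\<^sub>r \<turnstile> \<dots> \<approx> Plus (Plus (sum_prefix (?l ?Q)) (sum_prefix (?r ?P))) (sum_prefix ?s)"
    using c ps(4) qs(4) by (intro derivable.by_axiom ax.expansion) (auto simp del: ccsp_sum)
  also have "Ax\<^sub>r \<turnstile> \<dots> \<approx> Plus (Plus (sum_prefix (?l Q)) (sum_prefix (?r P))) (sum_prefix ?s)"
  proof (intro derivable_plus derivable.reflexivity c)
    have l: "Ax\<^sub>r \<turnstile> Prefix \<alpha> (Par A P' ?Q) \<approx> Prefix \<alpha> (Par A P' Q)" if "(\<alpha>, P') \<in> set ps" for \<alpha> P'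
      using that cP qs(1) by (auto intro!: derivable_prefix derivable_par intro: derivable.reflexivity derivable.symmetry)
    show "Ax\<^sub>r \<turnstile> sum_prefix (?l ?Q) \<approx> sum_prefix (?l Q)"
      by (rule derivable_sum) (use l in \<open>auto split: if_splits\<close>)
    have r: "Ax\<^sub>r \<turnstile> Prefix \<alpha> (Par A ?P Q') \<approx> Prefix \<alpha> (Par A P Q')" if "(\<alpha>, Q') \<in> set qs" for \<alpha> Q'
      using that cQ ps(1) by (auto intro!: derivable_prefix derivable_par intro: derivable.reflexivity derivable.symmetry)
    show "Ax\<^sub>r \<turnstile> sum_prefix (?r ?P) \<approx> sum_prefix (?r P)"
      by (rule derivable_sum) (use r in \<open>auto split: if_splits\<close>)
  qed
  also have "Ax\<^sub>r \<turnstile> \<dots> \<approx> Plus (sum_prefix (?l Q @ ?r P)) (sum_prefix ?s)"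
    using c by (intro derivable_plus derivable.reflexivity derivable.symmetry[OF derivable_sum_append])
  also have "Ax\<^sub>r \<turnstile> \<dots> \<approx> sum_prefix ((?l Q @ ?r P) @ ?s)"
  proof (intro derivable.symmetry[OF derivable_sum_append] c)
    show "ccsp (sum_prefix (?l Q @ ?r P))"
      using c(1,3) unfolding ccsp_sum set_append by blast
  qed
  finally show ?thesis
  proof (rule hnfI)
    fix \<alpha> R
    show "(\<alpha>, R) \<in> set ((?l Q @ ?r P) @ ?s) \<longleftrightarrow> transition (Par A P Q) \<alpha> R"
      unfolding transition_simps ps(2)[symmetric] qs(2)[symmetric]
      by (auto split: if_splits)
  qed
qed

lemma hnf_rec:
  assumes "good (Rec x S)" "S x = Some E" "hnf (subst E (rec_subst S))"
  shows "hnf (Rec x S)"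
proof -
  from assms(3) obtain ps where ps: "Ax\<^sub>r \<turnstile> subst E (rec_subst S) \<approx> sum_prefix ps"
    "\<And>\<alpha> P'. (\<alpha>, P') \<in> set ps \<longleftrightarrow> transition (subst E (rec_subst S)) \<alpha> P'"
    by (rule hnfE) blast
  have "Ax\<^sub>r \<turnstile> Rec x S \<approx> subst E (rec_subst S)"
  proof (rule derivable.by_axiom[OF ax.RDP])
    show "S x = Some E" by fact
    show "is_subst (rec_subst S) E (subst E (rec_subst S))"
      by (rule is_subst_subst[OF closing_rec_subst[OF assms(1)]])
    show "ccsp (Rec x S)" "ccsp (subst E (rec_subst S))"
      using good_process[OF assms(1)] good_process[OF good_unfold[OF assms(1,2)]]
      by (auto simp: process_def)
  qed
  then show ?thesis
    using ps(1) by (rule hnfI[OF derivable.transitivity]) (simp add: ps(2) transition_simps assms(2))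
qed

text \<open>Unfolding a recursion enlarges the expression, so induction on closed expressions fails.
  For open E the unfolded right-hand side is an instance of a proper subexpression, and the
  structural hypothesis applies once its unguarded variables have head normal forms. An inner
  induction along \<open>guard_wf\<close> supplies these for the bound variables.\<close>

lemma hnf_subst:
  assumes "closing \<sigma>" "regular E" "closed_bodies E" "\<forall>v \<in> fv E. good (\<sigma> v)"
    and "\<forall>v \<in> unguarded_vars E. hnf (\<sigma> v)"
  shows "hnf (subst E \<sigma>)"
  using assms
proof (induction E arbitrary: \<sigma>)
  case Zero
  then show ?case by (simp add: hnf_zero)
next
  case (Prefix \<alpha> E)
  have "good (subst E \<sigma>)" using Prefix.prems by (intro good_subst) auto
  then have "ccsp (subst E \<sigma>)" using good_process process_def by blast
  then show ?case by (simp add: hnf_prefix)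
next
  case (Theta L U E)
  then have "good (subst E \<sigma>)" by (intro good_subst) auto
  then show ?case using Theta good_process by (auto intro!: hnf_theta)
next
  case (Psi X E)
  then have "good (subst E \<sigma>)" by (intro good_subst) auto
  then show ?case using Psi good_process by (auto intro!: hnf_psi)
next
  case (Rec y S)
  let ?T = "subst_spec S \<sigma>" and ?r = "\<lambda>v. if v \<in> dom S then Var v else \<sigma> v"
  have y: "y \<in> dom S" and wf: "guard_wf S" using Rec.prems(2) by simp_all
  have good: "good (Rec x ?T)" if "x \<in> dom S" for x
    using good_subst[OF Rec.prems(1-4)] that by (simp add: subst_Rec good_def del: subst.simps(10))
  \<comment> \<open>The outer substitution and the unfolding of the recursion in one go, so that the
    unfolded process is an instance of the original right-hand side.\<close>
  define \<sigma>' where "\<sigma>' = (\<lambda>v. if v \<in> dom S then Rec v ?T else \<sigma> v)"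
  have comp: "subst (subst E ?r) (rec_subst ?T) = subst E \<sigma>'" for E
  proof -
    have eq: "(\<lambda>v. subst (?r v) (rec_subst ?T)) = \<sigma>'"
    proof
      fix v
      have "\<sigma> v = Var v \<or> good (\<sigma> v)" using Rec.prems(1) by (simp add: closing_def)
      then show "subst (?r v) (rec_subst ?T) = \<sigma>' v"
        using subst_closed[of "\<sigma> v" "rec_subst ?T"]
        by (auto simp: \<sigma>'_def rec_subst_def good_def domIff)
    qed
    show ?thesis by (simp only: subst_subst[OF closing_restrict[OF Rec.prems(1)]] eq)
  qed
  have cl: "closing \<sigma>'" 
    unfolding closing_def \<sigma>'_def using Rec.prems(1)[unfolded closing_def] good by presburger
  have "hnf (Rec x ?T)" if "x \<in> dom S" for x
    using wf[unfolded guard_wf_def] that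
  proof (induction x rule: wf_induct_rule)
    case (less x)
    from less.prems obtain E where E: "S x = Some E" by auto
    have "hnf (subst E \<sigma>')"
    proof (rule Rec.IH[OF rangeI[of S x]])
      show "E \<in> set_option (S x)" using E by simp
      show "closing \<sigma>'" by (rule cl)
      show "regular E" "closed_bodies E" using Rec.prems(2,3) ranI[of S x E, OF E] by auto
      show "\<forall>v \<in> fv E. good (\<sigma>' v)"
      proof
        fix v assume v: "v \<in> fv E"
        then have "v \<in> fv (Rec y S) \<or> v \<in> dom S" using fv_spec[where S = S and z = x and x = y] E by blast
        then show "good (\<sigma>' v)" using Rec.prems(4) good by (auto simp: \<sigma>'_def simp del: fv.simps)
      qed
      show "\<forall>v \<in> unguarded_vars E. hnf (\<sigma>' v)"
      proof
        fix v assume v: "v \<in> unguarded_vars E"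
        show "hnf (\<sigma>' v)"
        proof (cases "v \<in> dom S")
          case True
          then show ?thesis using less.IH[of v] E v by (auto simp: \<sigma>'_def)
        next
          case False
          then have "v \<in> unguarded_vars (Rec y S)"
            using v E ranI[of "\<lambda>x. map_option unguarded_vars (S x)" x "unguarded_vars E"] by auto
          then show ?thesis using Rec.prems(5) False by (simp add: \<sigma>'_def)
        qed
      qed
    qed
    then have "hnf (subst (subst E ?r) (rec_subst ?T))" by (simp only: comp)
    moreover have "?T x = Some (subst E ?r)" using E by (simp add: subst_spec_def)
    ultimately show ?case using hnf_rec[OF good[OF less.prems]] by blast
  qed
  from this[OF y] show ?case by (simp only: subst_Rec)
qed (auto intro: hnf_plus hnf_par hnf_hide hnf_rename)

lemma hnf_good:
  assumes "good P" shows "hnf P"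
proof -
  have "hnf (subst P Var)"
    using assms unguarded_vars_fv[of P]
    by (intro hnf_subst) (auto simp: good_def closing_def)
  then show ?thesis by (simp add: subst_closed)
qed

section \<open>Countable guarded systems of equations\<close>

text \<open>Without binders, literal substitution of arbitrary expressions is capture-free
  (\<open>is_subst_flat\<close>). Without hiding, the first requirement of manifest well-guardedness
  holds, also after unfolding.\<close>

fun flat :: "'a expr \<Rightarrow> bool" where
  "flat Zero \<longleftrightarrow> True"
| "flat (Var x) \<longleftrightarrow> True"
| "flat (Prefix \<alpha> E) \<longleftrightarrow> flat E"
| "flat (Plus E F) \<longleftrightarrow> flat E \<and> flat F"
| "flat _ \<longleftrightarrow> False"

lemma flat_subexpr: "subexpr G E \<Longrightarrow> flat E \<Longrightarrow> flat G"
proof (induction rule: subexpr.induct)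
  case (subexpr_child G F E)
  then show ?case by (cases E) auto
qed

lemma flat_subst: "flat E \<Longrightarrow> (\<And>v. flat (\<sigma> v)) \<Longrightarrow> flat (subst E \<sigma>)"
  by (induction E) auto

lemma unguarded_subst_flat:
  "flat E \<Longrightarrow> unguarded_vars (subst E \<sigma>) = (\<Union>v \<in> unguarded_vars E. unguarded_vars (\<sigma> v))"
  by (induction E) auto

lemma is_subst_flat: "flat E \<Longrightarrow> is_subst \<sigma> E (subst E \<sigma>)"
  by (induction E) (auto intro: is_subst.intros)

lemma ccsp_Rec_flat:
  assumes "\<And>E. E \<in> ran S \<Longrightarrow> flat E" "x \<in> dom S"
  shows "ccsp (Rec x S)"
proof -
  have sub: "G = Rec x S \<or> flat G" if "subexpr G (Rec x S)" for G
    using that assms(1) flat_subexpr by (subst (asm) subexpr_simps) auto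
  have "wf_expr (Rec x S)"
    unfolding wf_expr_def using sub assms(2) by fastforce
  moreover have "valid (Rec x S)"
    unfolding valid_def
  proof (intro notI, elim exE conjE)
    fix y T F z
    assume "subexpr (Rec y T) (Rec x S)"
      "(\<exists>L U. subexpr (Theta L U F) (Rec y T)) \<or> (\<exists>X. subexpr (Psi X F) (Rec y T))"
    then show False using sub subexpr_trans by (metis expr.distinct flat.simps(8,9))
  qed
  ultimately show ?thesis by (simp add: ccsp_def)
qed

text \<open>A system of equations \<open>i = \<Sum> \<alpha>.j\<close> assigns to each index \<open>i\<close> the list of pairs \<open>(\<alpha>, j)\<close>.\<close>

definition sum_at :: "('i \<Rightarrow> 'a expr) \<Rightarrow> ('a act \<times> 'i) list \<Rightarrow> 'a expr" where
  "sum_at \<rho> ps = sum_prefix (map (\<lambda>p. (fst p, \<rho> (snd p))) ps)"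

definition solution :: "'i set \<Rightarrow> ('i \<Rightarrow> ('a act \<times> 'i) list) \<Rightarrow> ('i \<Rightarrow> 'a expr) \<Rightarrow> bool" where
  "solution I tr \<rho> \<longleftrightarrow> (\<forall>i \<in> I. Ax\<^sub>r \<turnstile> \<rho> i \<approx> sum_at \<rho> (tr i))"

lemma flat_sum_at: "flat (sum_at (\<lambda>j. Var (c j)) ps)"
  unfolding sum_at_def by (induction ps) auto

lemma unguarded_sum_at:
  "unguarded_vars (sum_at (\<lambda>j. Var (c j)) ps) = c ` {j. (Tau, j) \<in> set ps}"
  unfolding sum_at_def by (induction ps) (auto split: if_splits)

lemma subst_sum_at: "subst (sum_at (\<lambda>j. Var (c j)) ps) \<sigma> = sum_at (\<lambda>j. \<sigma> (c j)) ps"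
  unfolding sum_at_def by (induction ps) auto

lemma sum_at_cong: "(\<And>p. p \<in> set ps \<Longrightarrow> \<rho> (snd p) = \<rho>' (snd p)) \<Longrightarrow> sum_at \<rho> ps = sum_at \<rho>' ps"
  unfolding sum_at_def by (rule arg_cong[of _ _ sum_prefix]) simp

text \<open>After m simultaneous unfoldings of x, the unguarded variables are the ends of the
  dependency paths of length m from x. By well-foundedness and finite branching these paths have
  bounded length for each x. The bound \<open>n x\<close> may vary with x, as the definition of
  \<open>well_guarded\<close> allows.\<close>

lemma well_guarded_flat:
  assumes flat: "\<And>E. E \<in> ran S \<Longrightarrow> flat E"
    and fin: "\<And>E. E \<in> ran S \<Longrightarrow> finite (unguarded_vars E)"
    and dep: "\<And>E. E \<in> ran S \<Longrightarrow> unguarded_vars E \<subseteq> dom S"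
    and wf: "guard_wf S"
  shows "well_guarded S"
proof -
  define u where "u = (\<lambda>y. if y \<in> dom S then the (S y) else Var y)"
  define unf where "unf E = subst E u" for E
  have unf_Var: "unf (Var y) = u y" for y by (simp add: unf_def)
  have fu: "flat (u y)" for y by (auto simp: u_def intro!: flat ranI)
  have f_unf: "flat ((unf ^^ m) E)" if "flat E" for m E
    using that by (induction m) (auto simp: unf_def intro: flat_subst fu)
  have step: "unfolds S E (unf E)" if "flat E" for E
    unfolding unfolds_def unf_def u_def
    by (rule exI[of _ "dom S"]) (simp add: is_subst_flat[OF that])
  have steps: "(unfolds S)\<^sup>*\<^sup>* E ((unf ^^ m) E)" if "flat E" for m E
  proof (induction m)
    case (Suc m)
    then show ?case using step[OF f_unf[OF that, of m]] by (auto intro: rtranclp.rtrancl_into_rtrancl)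
  qed simp
  have var: "unguarded_vars ((unf ^^ m) E) = (\<Union>v \<in> unguarded_vars E. unguarded_vars ((unf ^^ m) (Var v)))"
    if "flat E" for m E
    using that
  proof (induction m arbitrary: E)
    case (Suc m)
    have "unguarded_vars ((unf ^^ Suc m) (Var v)) = (\<Union>w \<in> unguarded_vars (u v). unguarded_vars ((unf ^^ m) (Var w)))" for v
      using Suc.IH[OF fu] by (simp only: funpow_Suc_right comp_apply unf_Var)
    moreover have "unguarded_vars ((unf ^^ Suc m) E)
        = (\<Union>w \<in> unguarded_vars (unf E). unguarded_vars ((unf ^^ m) (Var w)))"
      using Suc.IH[of "unf E"] f_unf[OF Suc.prems, of 1] by (simp only: funpow_Suc_right comp_apply) simp
    moreover have "unguarded_vars (unf E) = (\<Union>v \<in> unguarded_vars E. unguarded_vars (u v))"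
      by (simp add: unf_def unguarded_subst_flat[OF Suc.prems])
    ultimately show ?case by (simp only: UN_UN_flatten)
  qed simp
  \<comment> \<open>Stated for all large m, so that the finitely many unguarded variables of a
    right-hand side share a common m.\<close>
  have ev: "eventually (\<lambda>m. unguarded_vars ((unf ^^ m) (Var x)) = {}) sequentially" if "x \<in> dom S" for x
    using wf[unfolded guard_wf_def] that
  proof (induction x rule: wf_induct_rule)
    case (less x)
    then obtain E where E: "S x = Some E" by auto
    have ran: "E \<in> ran S" using E by (rule ranI)
    have "\<forall>v \<in> unguarded_vars E. eventually (\<lambda>m. unguarded_vars ((unf ^^ m) (Var v)) = {}) sequentially"
      using less.IH E dep[OF ran] by blast
    then have "eventually (\<lambda>m. \<forall>v \<in> unguarded_vars E. unguarded_vars ((unf ^^ m) (Var v)) = {}) sequentially"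
      using fin[OF ran] by (intro eventually_ball_finite)
    then have "eventually (\<lambda>m. unguarded_vars ((unf ^^ m) E) = {}) sequentially"
      by (rule eventually_mono) (simp add: var[OF flat[OF ran]])
    \<comment> \<open>Replacing x by its right-hand side already costs one unfolding, hence the
      shift.\<close>
    moreover have "(unf ^^ Suc m) (Var x) = (unf ^^ m) E" for m
      using E by (simp only: funpow_Suc_right comp_apply) (simp add: unf_def u_def domIff)
    ultimately have "eventually (\<lambda>m. unguarded_vars ((unf ^^ Suc m) (Var x)) = {}) sequentially"
      by (simp only:)
    then show ?case
      using eventually_sequentially_Suc[of "\<lambda>m. unguarded_vars ((unf ^^ m) (Var x)) = {}"] by blast
  qed
  have "\<exists>n. unguarded_vars ((unf ^^ n) (the (S x))) = {}" if "x \<in> dom S" for x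
  proof -
    have "eventually (\<lambda>m. unguarded_vars ((unf ^^ Suc m) (Var x)) = {}) sequentially"
      using ev[OF that]
        eventually_sequentially_Suc[of "\<lambda>m. unguarded_vars ((unf ^^ m) (Var x)) = {}"] by blast
    then obtain n where "unguarded_vars ((unf ^^ Suc n) (Var x)) = {}"
      by (auto simp only: eventually_sequentially)
    moreover have "(unf ^^ Suc n) (Var x) = (unf ^^ n) (the (S x))"
      using that by (simp only: funpow_Suc_right comp_apply) (simp add: unf_def u_def)
    ultimately show ?thesis by auto
  qed
  then obtain n where n: "\<And>x. x \<in> dom S \<Longrightarrow> unguarded_vars ((unf ^^ n x) (the (S x))) = {}" by metis
  define S' where "S' = (\<lambda>x. map_option (unf ^^ n x) (S x))"
  have fl: "flat (the (S x))" if "x \<in> dom S" for x using that by (auto intro!: flat ranI)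
  have ran': "flat E \<and> unguarded_vars E = {}" if "E \<in> ran S'" for E
  proof -
    from that obtain x where x: "x \<in> dom S" "E = (unf ^^ n x) (the (S x))"
      by (force simp: S'_def ran_def)
    then show ?thesis using n[OF x(1)] f_unf[OF fl[OF x(1)]] by simp
  qed
  show ?thesis unfolding well_guarded_def
  proof (intro exI[of _ S'] conjI ballI)
    show "dom S' = dom S" by (auto simp: S'_def)
    show "(unfolds S)\<^sup>*\<^sup>* (the (S x)) (the (S' x))" if "x \<in> dom S" for x
      using steps[OF fl[OF that]] that by (auto simp: S'_def)
    show "manifestly_well_guarded S'"
      unfolding manifestly_well_guarded_def
      using ran' flat_subexpr by (metis Int_empty_left flat.simps(6))
  qed
qed

text \<open>Existence is RDP and uniqueness is RSP, for one specification. Variables are natural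
  numbers, so countability of I allows the indices to be coded as variables; well-foundedness of the
  \<tau>-edges makes the specification well-guarded.\<close>

lemma system_solution:
  assumes I: "countable I" and tr: "\<And>i p. i \<in> I \<Longrightarrow> p \<in> set (tr i) \<Longrightarrow> snd p \<in> I"
    and wf: "wf {(j, i). i \<in> I \<and> (Tau, j) \<in> set (tr i)}"
  shows "\<exists>sol. solution I tr sol \<and> (\<forall>\<rho>. solution I tr \<rho> \<longrightarrow> (\<forall>i \<in> I. Ax\<^sub>r \<turnstile> \<rho> i \<approx> sol i))"
proof -
  define c where "c = to_nat_on I"
  define d where "d = inv_into I c"
  have d [simp]: "d (c i) = i" if "i \<in> I" for i
    using that I by (simp add: c_def d_def inv_into_f_f inj_on_to_nat_on)
  define rhs where "rhs i = sum_at (\<lambda>j. Var (c j)) (tr i)" for i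
  define S where "S = (\<lambda>n. if n \<in> c ` I then Some (rhs (d n)) else None)"
  have S [simp]: "S (c i) = Some (rhs i)" if "i \<in> I" for i using that by (simp add: S_def)
  have domS: "dom S = c ` I" by (auto simp: S_def dom_def)
  have ranS: "ran S = rhs ` I"
  proof
    show "ran S \<subseteq> rhs ` I" by (auto simp: S_def ran_def)
    show "rhs ` I \<subseteq> ran S" using S by (blast intro: ranI)
  qed
  have ung: "unguarded_vars (rhs i) = c ` {j. (Tau, j) \<in> set (tr i)}" for i
    by (simp add: rhs_def unguarded_sum_at)
  have wg: "well_guarded S"
  proof (rule well_guarded_flat)
    fix E assume "E \<in> ran S"
    then obtain i where i: "i \<in> I" "E = rhs i" using ranS by auto
    show "flat E" using i by (simp add: rhs_def flat_sum_at)
    have "{j. (Tau, j) \<in> set (tr i)} \<subseteq> snd ` set (tr i)" by force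
    then show "finite (unguarded_vars E)"
      using i by (auto simp: ung intro: finite_subset)
    show "unguarded_vars E \<subseteq> dom S"
      using i tr by (fastforce simp: ung domS)
  next
    show "guard_wf S"
      unfolding guard_wf_def
    proof (rule wf_subset[OF wf_inv_image[OF wf, of d]], safe)
      fix y x E z assume "S x = Some E" "y \<in> unguarded_vars E"
      moreover then obtain i where i: "i \<in> I" "x = c i" "E = rhs i" by (auto simp: S_def split: if_splits)
      ultimately obtain j where j: "(Tau, j) \<in> set (tr i)" "y = c j" by (auto simp: ung)
      have "j \<in> I" using tr[OF i(1) j(1)] by simp
      then show "(y, x) \<in> inv_image {(j, i). i \<in> I \<and> (Tau, j) \<in> set (tr i)} d"
        using i j by simp
    qed
  qed
  have ccsp: "ccsp (Rec x S)" if "x \<in> dom S" for x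
    using that by (intro ccsp_Rec_flat) (auto simp: ranS rhs_def flat_sum_at)
  define sol where "sol i = Rec (c i) S" for i
  have subst_rhs: "subst (rhs i) \<sigma> = sum_at \<rho> (tr i)" if "i \<in> I" "\<And>j. j \<in> I \<Longrightarrow> \<sigma> (c j) = \<rho> j" for i \<sigma> \<rho>
    unfolding rhs_def subst_sum_at by (rule sum_at_cong) (use tr[OF that(1)] that(2) in blast)
  have "solution I tr sol"
    unfolding solution_def
  proof
    fix i assume i: "i \<in> I"
    show "Ax\<^sub>r \<turnstile> sol i \<approx> sum_at sol (tr i)"
    proof (rule derivable.by_axiom)
      show "ccsp (sol i)" using i ccsp by (simp add: sol_def domS)
      show "ccsp (sum_at sol (tr i))" using i tr ccsp by (auto simp: sol_def sum_at_def domS)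
      have "is_subst (rec_subst S) (rhs i) (subst (rhs i) (rec_subst S))"
        by (rule is_subst_flat) (simp add: rhs_def flat_sum_at)
      moreover have "subst (rhs i) (rec_subst S) = sum_at sol (tr i)"
        using i by (rule subst_rhs) (simp add: rec_subst_def sol_def domS)
      ultimately show "ax (sol i) (sum_at sol (tr i))"
        unfolding sol_def[of i] using S[OF i] by (metis ax.RDP)
    qed
  qed
  moreover have "Ax\<^sub>r \<turnstile> \<rho> i \<approx> sol i" if \<rho>: "solution I tr \<rho>" and i: "i \<in> I" for \<rho> i
  proof -
    have "Ax\<^sub>r \<turnstile> (\<lambda>n. \<rho> (d n)) (c i) \<approx> Rec (c i) S"
    proof (rule derivable.RSP[OF wg])
      show dom: "c i \<in> dom S" using i by (simp add: domS)
      show "ccsp (Rec (c i) S)" using dom by (rule ccsp)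
      show "\<forall>y \<in> dom S. \<exists>E. is_subst (\<lambda>v. if v \<in> dom S then \<rho> (d v) else Var v) (the (S y)) E \<and>
              Ax\<^sub>r \<turnstile> \<rho> (d y) \<approx> E"
      proof
        fix y assume "y \<in> dom S"
        then obtain k where k: "k \<in> I" "y = c k" by (auto simp: domS)
        let ?\<sigma> = "\<lambda>v. if v \<in> dom S then \<rho> (d v) else Var v"
        have "is_subst ?\<sigma> (rhs k) (subst (rhs k) ?\<sigma>)"
          by (rule is_subst_flat) (simp add: rhs_def flat_sum_at)
        moreover have "subst (rhs k) ?\<sigma> = sum_at \<rho> (tr k)"
          using k(1) by (rule subst_rhs) (simp add: domS)
        ultimately show "\<exists>E. is_subst ?\<sigma> (the (S y)) E \<and> Ax\<^sub>r \<turnstile> \<rho> (d y) \<approx> E"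
          using \<rho> k by (auto simp: solution_def)
      qed
    qed
    then show ?thesis using i by (simp add: sol_def)
  qed
  ultimately show ?thesis by blast
qed

lemma solution_unique:
  assumes "countable I" "\<And>i p. i \<in> I \<Longrightarrow> p \<in> set (tr i) \<Longrightarrow> snd p \<in> I"
    and "wf {(j, i). i \<in> I \<and> (Tau, j) \<in> set (tr i)}"
    and "solution I tr \<rho>" "solution I tr \<rho>'" "i \<in> I"
  shows "Ax\<^sub>r \<turnstile> \<rho> i \<approx> \<rho>' i"
proof -
  obtain sol where "\<forall>\<rho>. solution I tr \<rho> \<longrightarrow> (\<forall>i \<in> I. Ax\<^sub>r \<turnstile> \<rho> i \<approx> sol i)"
    using system_solution[of I tr] assms(1-3) by blast
  then show ?thesis
    using assms(4-6) by (blast intro: derivable.transitivity derivable.symmetry)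
qed

section \<open>Branching reactive bisimilarity is an equivalence\<close>

abbreviation idle :: "'a expr \<Rightarrow> 'a set \<Rightarrow> bool" where
  "idle P X \<equiv> initials P \<inter> vis_tau X = {}"

lemma idle_iff: "idle P X \<longleftrightarrow> stable P \<and> (\<forall>a \<in> X. \<nexists>P'. transition P (Vis a) P')"
  by (auto simp: initials_def stable_def)

lemma br_bisimulation_sym:
  assumes "br_bisimulation B T"
  shows "B P Q \<Longrightarrow> process P \<and> process Q \<and> B Q P" "T P X Q \<Longrightarrow> process P \<and> process Q \<and> T Q X P"
  using assms[unfolded br_bisimulation_def, THEN conjunct1] unfolding sym_process_rel_def by blast+

lemma br_bisimulation_step:
  assumes "br_bisimulation B T" "B P Q" "transition P \<alpha> P'" "\<alpha> \<noteq> Tout"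
  shows "\<exists>Q1 Q2. tau_steps Q Q1 \<and> trans_opt Q1 \<alpha> Q2 \<and> B P Q1 \<and> B P' Q2"
  using assms unfolding br_bisimulation_def by blast

lemma br_bisimulation_env: "br_bisimulation B T \<Longrightarrow> B P Q \<Longrightarrow> T P X Q"
  unfolding br_bisimulation_def by blast

lemma br_bisimulation_tau:
  assumes "br_bisimulation B T" "T P X Q" "transition P Tau P'"
  shows "\<exists>Q1 Q2. tau_steps Q Q1 \<and> trans_opt Q1 Tau Q2 \<and> T P X Q1 \<and> T P' X Q2"
  using assms unfolding br_bisimulation_def by blast

lemma br_bisimulation_vis:
  assumes "br_bisimulation B T" "T P X Q" "transition P (Vis a) P'" "a \<in> X"
  shows "\<exists>Q1 Q2. tau_steps Q Q1 \<and> transition Q1 (Vis a) Q2 \<and> T P X Q1 \<and> B P' Q2"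
  using assms unfolding br_bisimulation_def by blast

lemma br_bisimulation_idle:
  assumes "br_bisimulation B T" "T P X Q" "idle P X"
  shows "\<exists>Q0. tau_steps Q Q0 \<and> B P Q0"
  using assms unfolding br_bisimulation_def by blast

lemma br_bisimulation_tout:
  assumes "br_bisimulation B T" "T P X Q" "idle P X" "transition P Tout P'"
  shows "\<exists>Q1 Q2. tau_steps Q Q1 \<and> transition Q1 Tout Q2 \<and> T P' X Q2"
  using assms unfolding br_bisimulation_def by blast

lemma br_bisimulation_stable:
  assumes "br_bisimulation B T" "T P X Q" "stable P"
  shows "\<exists>Q0. tau_steps Q Q0 \<and> stable Q0"
  using assms unfolding br_bisimulation_def by blast

lemma br_bisimI: "br_bisimulation B T \<Longrightarrow> B P Q \<Longrightarrow> br_bisim P Q"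
  unfolding br_bisim_def by blast

lemma br_bisim_envI: "br_bisimulation B T \<Longrightarrow> T P X Q \<Longrightarrow> br_bisim_env P X Q"
  unfolding br_bisim_env_def by blast

lemma br_bisimulation_br_bisim: "br_bisimulation br_bisim br_bisim_env"
  unfolding br_bisimulation_def
proof (intro conjI allI impI; (elim conjE)?)
  show "sym_process_rel br_bisim br_bisim_env"
    unfolding sym_process_rel_def br_bisim_def br_bisim_env_def using br_bisimulation_sym by meson
  fix P Q :: "'a expr"
  assume "br_bisim P Q"
  then obtain B T where BT: "br_bisimulation B T" "B P Q" unfolding br_bisim_def by blast
  show "br_bisim_env P Y Q" for Y
    using br_bisim_envI[OF BT(1) br_bisimulation_env[OF BT]] .
  show "\<exists>Q1 Q2. tau_steps Q Q1 \<and> trans_opt Q1 \<alpha> Q2 \<and> br_bisim P Q1 \<and> br_bisim P' Q2"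
    if "\<alpha> \<noteq> Tout" "transition P \<alpha> P'" for \<alpha> P'
    using br_bisimulation_step[OF BT that(2,1)] br_bisimI[OF BT(1)] by blast
next
  fix P Q :: "'a expr" and X
  assume "br_bisim_env P X Q"
  then obtain B T where BT: "br_bisimulation B T" "T P X Q" unfolding br_bisim_env_def by blast
  note I = br_bisimI[OF BT(1)] br_bisim_envI[OF BT(1)]
  show "\<exists>Q1 Q2. tau_steps Q Q1 \<and> trans_opt Q1 Tau Q2 \<and> br_bisim_env P X Q1 \<and> br_bisim_env P' X Q2"
    if "transition P Tau P'" for P'
    using br_bisimulation_tau[OF BT that] I by blast
  show "\<exists>Q1 Q2. tau_steps Q Q1 \<and> transition Q1 (Vis a) Q2 \<and> br_bisim_env P X Q1 \<and> br_bisim P' Q2"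
    if "transition P (Vis a) P'" "a \<in> X" for a P'
    using br_bisimulation_vis[OF BT that] I by blast
  show "\<exists>Q0. tau_steps Q Q0 \<and> br_bisim P Q0" if "idle P X"
    using br_bisimulation_idle[OF BT that] I by blast
  show "\<exists>Q1 Q2. tau_steps Q Q1 \<and> transition Q1 Tout Q2 \<and> br_bisim_env P' X Q2"
    if "idle P X" "transition P Tout P'" for P'
    using br_bisimulation_tout[OF BT that] I by blast
  show "\<exists>Q0. tau_steps Q Q0 \<and> stable Q0" if "stable P"
    using br_bisimulation_stable[OF BT that] .
qed

lemmas br_step = br_bisimulation_step[OF br_bisimulation_br_bisim]
  and br_env = br_bisimulation_env[OF br_bisimulation_br_bisim]
  and env_tau = br_bisimulation_tau[OF br_bisimulation_br_bisim]
  and env_vis = br_bisimulation_vis[OF br_bisimulation_br_bisim]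
  and env_idle = br_bisimulation_idle[OF br_bisimulation_br_bisim]
  and env_tout = br_bisimulation_tout[OF br_bisimulation_br_bisim]
  and env_stable = br_bisimulation_stable[OF br_bisimulation_br_bisim]

lemma br_process: "br_bisim P Q \<Longrightarrow> process P \<and> process Q"
  and env_process: "br_bisim_env P X Q \<Longrightarrow> process P \<and> process Q"
  and br_sym: "br_bisim P Q \<Longrightarrow> br_bisim Q P"
  and env_sym: "br_bisim_env P X Q \<Longrightarrow> br_bisim_env Q X P"
  using br_bisimulation_sym[OF br_bisimulation_br_bisim] by blast+

section \<open>Matching along \<tau>-paths\<close>

lemma tau_steps_refl [simp]: "tau_steps P P"
  by (simp add: tau_steps_def)

lemma tau_steps_trans: "tau_steps P Q \<Longrightarrow> tau_steps Q R \<Longrightarrow> tau_steps P R"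
  unfolding tau_steps_def by (rule rtranclp_trans)

lemma tau_steps_opt: "tau_steps P Q \<Longrightarrow> trans_opt Q Tau R \<Longrightarrow> tau_steps P R"
  unfolding tau_steps_def trans_opt_def by (auto intro: rtranclp.rtrancl_into_rtrancl)

lemma stable_tau_steps: "stable P \<Longrightarrow> tau_steps P Q \<longleftrightarrow> Q = P"
  unfolding tau_steps_def stable_def by (auto elim: converse_rtranclpE)

lemma br_path:
  assumes "tau_steps P P'" "br_bisim P Q"
  shows "\<exists>Q'. tau_steps Q Q' \<and> br_bisim P' Q'"
  using assms(1)[unfolded tau_steps_def]
proof (induction rule: rtranclp_induct)
  case base
  then show ?case using assms(2) tau_steps_refl by blast
next
  case (step P1 P2)
  then obtain Q1 where "tau_steps Q Q1" "br_bisim P1 Q1" by blast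
  then show ?case
    using br_step[OF _ step.hyps(2), of Q1] tau_steps_trans tau_steps_opt by blast
qed

lemma env_path:
  assumes "tau_steps P P'" "br_bisim_env P X Q"
  shows "\<exists>Q'. tau_steps Q Q' \<and> br_bisim_env P' X Q'"
  using assms(1)[unfolded tau_steps_def]
proof (induction rule: rtranclp_induct)
  case base
  then show ?case using assms(2) tau_steps_refl by blast
next
  case (step P1 P2)
  then obtain Q1 where "tau_steps Q Q1" "br_bisim_env P1 X Q1" by blast
  then show ?case
    using env_tau[OF _ step.hyps(2), of X Q1] tau_steps_trans tau_steps_opt by blast
qed

text \<open>By symmetry P has to follow the path of Q, and a stable process can only stay where it
  is.\<close>

lemma env_stable_path:
  assumes "stable P" "br_bisim_env P X Q" "tau_steps Q Q'"
  shows "br_bisim_env P X Q'"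
  using env_path[OF assms(3) env_sym[OF assms(2)]] stable_tau_steps[OF assms(1)] env_sym by metis

lemma env_idle_stable:
  assumes "idle P X" "br_bisim_env P X Q" "stable Q"
  shows "idle Q X"
proof -
  have P: "stable P" "\<And>a P'. a \<in> X \<Longrightarrow> \<not> transition P (Vis a) P'"
    using assms(1) unfolding idle_iff by blast+
  have "\<not> transition Q (Vis a) Q'" if "a \<in> X" for a Q'
    using env_vis[OF env_sym[OF assms(2)] _ that, of Q'] P(2)[OF that] stable_tau_steps[OF P(1)] by metis
  then show ?thesis using assms(3) unfolding idle_iff by blast
qed

text \<open>The stability clause first leads Q to a stable process; from there the clause for idling
  cannot move any further. So the clause for idling can be satisfied by a process that idles too,
  which composition of bisimulations requires.\<close>

lemma env_idle_match:
  assumes "idle P X" "br_bisim_env P X Q"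
  shows "\<exists>Q0. tau_steps Q Q0 \<and> idle Q0 X \<and> br_bisim P Q0"
proof -
  have s: "stable P" using assms(1) unfolding idle_iff by blast
  obtain Q0 where Q0: "tau_steps Q Q0" "stable Q0" using env_stable[OF assms(2) s] by blast
  have e: "br_bisim_env P X Q0" using env_stable_path[OF s assms(2) Q0(1)] .
  have "br_bisim P Q0" using env_idle[OF e assms(1)] stable_tau_steps[OF Q0(2)] by metis
  then show ?thesis using Q0 env_idle_stable[OF assms(1) e Q0(2)] by blast
qed

lemma env_tout_match:
  assumes "idle P X" "br_bisim_env P X Q" "stable Q" "transition P Tout P'"
  shows "\<exists>Q'. transition Q Tout Q' \<and> br_bisim_env P' X Q'"
  using env_tout[OF assms(2,1,4)] stable_tau_steps[OF assms(3)] by metis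

text \<open>The identity on good processes is the witness, as goodness is preserved by transitions
  and implies being a process.\<close>

lemma br_refl:
  assumes "good P"
  shows "br_bisim P P"
proof (rule br_bisimI)
  show "br_bisimulation (\<lambda>P Q :: 'a expr. good P \<and> Q = P) (\<lambda>P X Q. good P \<and> Q = P)"
    unfolding br_bisimulation_def sym_process_rel_def
    by (auto simp: good_process trans_opt_def dest: good_transition intro: tau_steps_refl)
qed (use assms in simp)

text \<open>The path found in the middle process is lifted to the third one, which then matches the
  final step from there.\<close>

lemma br_bisimulation_comp:
  "br_bisimulation (\<lambda>P R. \<exists>Q. br_bisim P Q \<and> br_bisim Q R)
     (\<lambda>P X R. \<exists>Q. br_bisim_env P X Q \<and> br_bisim_env Q X R)"
  unfolding br_bisimulation_def
proof (intro conjI allI impI; (elim conjE exE)?)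
  show "sym_process_rel (\<lambda>P R :: 'a expr. \<exists>Q. br_bisim P Q \<and> br_bisim Q R)
     (\<lambda>P X R. \<exists>Q. br_bisim_env P X Q \<and> br_bisim_env Q X R)"
    unfolding sym_process_rel_def using br_process env_process br_sym env_sym by blast
  fix P Q R :: "'a expr"
  assume PQ: "br_bisim P Q" and QR: "br_bisim Q R"
  show "\<exists>Q. br_bisim_env P Y Q \<and> br_bisim_env Q Y R" for Y
    using br_env[OF PQ] br_env[OF QR] by blast
  fix \<alpha> P' assume P': "\<alpha> \<noteq> Tout" "transition P \<alpha> P'"
  obtain Q1 Q2 where Q: "tau_steps Q Q1" "trans_opt Q1 \<alpha> Q2" "br_bisim P Q1" "br_bisim P' Q2"
    using br_step[OF PQ P'(2,1)] by blast
  obtain R1 where R1: "tau_steps R R1" "br_bisim Q1 R1" using br_path[OF Q(1) QR] by blast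
  have "\<exists>R2 R3. tau_steps R1 R2 \<and> trans_opt R2 \<alpha> R3 \<and> br_bisim Q1 R2 \<and> br_bisim Q2 R3"
  proof (cases "transition Q1 \<alpha> Q2")
    case True
    then show ?thesis using br_step[OF R1(2)] P'(1) by blast
  next
    case False
    then have "\<alpha> = Tau" "Q2 = Q1" using Q(2) by (auto simp: trans_opt_def)
    then show ?thesis using R1(2) tau_steps_refl unfolding trans_opt_def by blast
  qed
  then show "\<exists>R1 R2. tau_steps R R1 \<and> trans_opt R1 \<alpha> R2 \<and>
      (\<exists>Q. br_bisim P Q \<and> br_bisim Q R1) \<and> (\<exists>Q. br_bisim P' Q \<and> br_bisim Q R2)"
    using Q R1 tau_steps_trans by metis
next
  fix P Q R :: "'a expr" and X
  assume PQ: "br_bisim_env P X Q" and QR: "br_bisim_env Q X R"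
  show "\<exists>R1 R2. tau_steps R R1 \<and> trans_opt R1 Tau R2 \<and>
      (\<exists>Q. br_bisim_env P X Q \<and> br_bisim_env Q X R1) \<and> (\<exists>Q. br_bisim_env P' X Q \<and> br_bisim_env Q X R2)"
    if "transition P Tau P'" for P'
  proof -
    obtain Q1 Q2 where Q: "tau_steps Q Q1" "trans_opt Q1 Tau Q2" "br_bisim_env P X Q1" "br_bisim_env P' X Q2"
      using env_tau[OF PQ \<open>transition P Tau P'\<close>] by blast
    obtain R1 where R1: "tau_steps R R1" "br_bisim_env Q1 X R1" using env_path[OF Q(1) QR] by blast
    have "\<exists>R2 R3. tau_steps R1 R2 \<and> trans_opt R2 Tau R3 \<and> br_bisim_env Q1 X R2 \<and> br_bisim_env Q2 X R3"
    proof (cases "transition Q1 Tau Q2")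
      case True
      then show ?thesis using env_tau[OF R1(2)] by blast
    next
      case False
      then have "Q2 = Q1" using Q(2) by (auto simp: trans_opt_def)
      then show ?thesis using R1(2) tau_steps_refl unfolding trans_opt_def by blast
    qed
    then show ?thesis using Q R1 tau_steps_trans by metis
  qed
  show "\<exists>R1 R2. tau_steps R R1 \<and> transition R1 (Vis a) R2 \<and>
      (\<exists>Q. br_bisim_env P X Q \<and> br_bisim_env Q X R1) \<and> (\<exists>Q. br_bisim P' Q \<and> br_bisim Q R2)"
    if "transition P (Vis a) P'" "a \<in> X" for a P'
  proof -
    obtain Q1 Q2 where Q: "tau_steps Q Q1" "transition Q1 (Vis a) Q2" "br_bisim_env P X Q1" "br_bisim P' Q2"
      using env_vis[OF PQ \<open>transition P (Vis a) P'\<close> \<open>a \<in> X\<close>] by blast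
    obtain R1 where R1: "tau_steps R R1" "br_bisim_env Q1 X R1" using env_path[OF Q(1) QR] by blast
    show ?thesis
      using env_vis[OF R1(2) Q(2) \<open>a \<in> X\<close>] Q R1 tau_steps_trans by metis
  qed
  \<comment> \<open>Both processes are brought to idle, hence stable, positions. There a time-out is
    matched without intermediate \<tau>-steps, so the two matches can be chained.\<close>
  have idle: "\<exists>Q0 R0. tau_steps Q Q0 \<and> tau_steps R R0 \<and> idle Q0 X \<and> idle R0 X \<and> br_bisim P Q0 \<and> br_bisim Q0 R0"
    if P: "idle P X"
  proof -
    obtain Q0 where Q0: "tau_steps Q Q0" "idle Q0 X" "br_bisim P Q0"
      using env_idle_match[OF P PQ] by blast
    obtain R1 where R1: "tau_steps R R1" "br_bisim_env Q0 X R1" using env_path[OF Q0(1) QR] by blast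
    obtain R0 where R0: "tau_steps R1 R0" "idle R0 X" "br_bisim Q0 R0"
      using env_idle_match[OF Q0(2) R1(2)] by blast
    show ?thesis
      by (intro exI[of _ Q0] exI[of _ R0] conjI Q0 R0(2,3) tau_steps_trans[OF R1(1) R0(1)])
  qed
  then show "\<exists>R0. tau_steps R R0 \<and> (\<exists>Q. br_bisim P Q \<and> br_bisim Q R0)" if "idle P X"
    using that by blast
  show "\<exists>R1 R2. tau_steps R R1 \<and> transition R1 Tout R2 \<and> (\<exists>Q. br_bisim_env P' X Q \<and> br_bisim_env Q X R2)"
    if P': "idle P X" "transition P Tout P'" for P'
  proof -
    obtain Q0 R0 where QR0: "tau_steps R R0" "idle Q0 X" "idle R0 X" "br_bisim P Q0" "br_bisim Q0 R0"
      using idle[OF P'(1)] by blast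
    have s: "stable Q0" "stable R0" using QR0(2,3) unfolding idle_iff by blast+
    obtain Q2 where Q2: "transition Q0 Tout Q2" "br_bisim_env P' X Q2"
      using env_tout_match[OF P'(1) br_env[OF QR0(4)] s(1) P'(2)] by blast
    obtain R2 where "transition R0 Tout R2" "br_bisim_env Q2 X R2"
      using env_tout_match[OF QR0(2) br_env[OF QR0(5)] s(2) Q2(1)] by blast
    then show ?thesis using QR0(1) Q2(2) by blast
  qed
  show "\<exists>R0. tau_steps R R0 \<and> stable R0" if "stable P"
  proof -
    obtain Q0 where Q0: "tau_steps Q Q0" "stable Q0" using env_stable[OF PQ \<open>stable P\<close>] by blast
    obtain R1 where R1: "tau_steps R R1" "br_bisim_env Q0 X R1" using env_path[OF Q0(1) QR] by blast
    show ?thesis using env_stable[OF R1(2) Q0(2)] R1(1) tau_steps_trans by blast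
  qed
qed

lemma br_trans: "br_bisim P Q \<Longrightarrow> br_bisim Q R \<Longrightarrow> br_bisim P R"
  by (rule br_bisimI[OF br_bisimulation_comp]) blast

lemma env_trans: "br_bisim_env P X Q \<Longrightarrow> br_bisim_env Q X R \<Longrightarrow> br_bisim_env P X R"
  by (rule br_bisim_envI[OF br_bisimulation_comp]) blast

section \<open>Quotients without inert transitions\<close>

definition tau_plus :: "'a expr \<Rightarrow> 'a expr \<Rightarrow> bool" where
  "tau_plus = (\<lambda>P Q. transition P Tau Q)\<^sup>+\<^sup>+"

lemma tau_plus_steps: "tau_plus P R \<longleftrightarrow> (\<exists>Q. transition P Tau Q \<and> tau_steps Q R)"
  unfolding tau_plus_def tau_steps_def
  by (meson rtranclp_into_tranclp2 tranclpD)

lemma tau_steps_cases: "tau_steps P Q \<longleftrightarrow> Q = P \<or> tau_plus P Q"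
  unfolding tau_plus_def tau_steps_def by (metis rtranclpD rtranclp.rtrancl_refl tranclp_into_rtranclp)

text \<open>The properties shared by \<open>\<simeq>\<^sub>b\<^sub>r\<close> and each
  \<open>\<simeq>\<^sup>X\<^sub>b\<^sub>r\<close>, so that bottom members and well-foundedness are
  treated once for both quotients.\<close>

definition tau_bisim :: "('a expr \<Rightarrow> 'a expr \<Rightarrow> bool) \<Rightarrow> bool" where
  "tau_bisim eqv \<longleftrightarrow> (\<forall>P. good P \<longrightarrow> eqv P P) \<and> (\<forall>P Q. eqv P Q \<longrightarrow> eqv Q P) \<and>
     (\<forall>P Q R. eqv P Q \<longrightarrow> eqv Q R \<longrightarrow> eqv P R) \<and>
     (\<forall>P Q P'. eqv P Q \<longrightarrow> transition P Tau P' \<longrightarrow>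
        (\<exists>Q1 Q2. tau_steps Q Q1 \<and> trans_opt Q1 Tau Q2 \<and> eqv P Q1 \<and> eqv P' Q2))"

lemma tau_bisim_br: "tau_bisim br_bisim"
  unfolding tau_bisim_def using br_refl br_sym br_trans br_step[of _ _ Tau] by blast

lemma tau_bisim_env: "tau_bisim (\<lambda>P Q. br_bisim_env P X Q)"
  unfolding tau_bisim_def using br_env[OF br_refl] env_sym env_trans env_tau by blast

lemma tau_bisimD:
  assumes "tau_bisim eqv"
  shows "good P \<Longrightarrow> eqv P P" "eqv P Q \<Longrightarrow> eqv Q P" "eqv P Q \<Longrightarrow> eqv Q R \<Longrightarrow> eqv P R"
    "eqv P Q \<Longrightarrow> transition P Tau P' \<Longrightarrow>
       \<exists>Q1 Q2. tau_steps Q Q1 \<and> trans_opt Q1 Tau Q2 \<and> eqv P Q1 \<and> eqv P' Q2"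
  using assms unfolding tau_bisim_def by blast+

lemma tau_bisim_path:
  assumes "tau_bisim eqv" "tau_steps P P'" "eqv P Q"
  shows "\<exists>Q'. tau_steps Q Q' \<and> eqv P' Q'"
  using assms(2)[unfolded tau_steps_def]
proof (induction rule: rtranclp_induct)
  case base
  then show ?case using assms(3) tau_steps_refl by blast
next
  case (step P1 P2)
  then obtain Q1 where "tau_steps Q Q1" "eqv P1 Q1" by blast
  then show ?case
    using tau_bisimD(4)[OF assms(1) _ step.hyps(2), of Q1] tau_steps_trans tau_steps_opt by blast
qed

text \<open>Paths instead of single steps are considered because the path provided by a transfer
  clause is only known to end in the class; its intermediate processes may a priori lie
  outside.\<close>

definition bottom :: "('a expr \<Rightarrow> 'a expr \<Rightarrow> bool) \<Rightarrow> 'a expr \<Rightarrow> bool" where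
  "bottom eqv P \<longleftrightarrow> (\<forall>P'. tau_plus P P' \<longrightarrow> \<not> eqv P P')"

lemma bottom_steps: "bottom eqv P \<Longrightarrow> tau_steps P Q \<Longrightarrow> eqv P Q \<Longrightarrow> Q = P"
  unfolding bottom_def tau_steps_cases by blast

lemma bottom_tau:
  assumes "tau_bisim eqv" "bottom eqv b" "eqv P b" "transition P Tau P'"
  shows "eqv P' b \<or> (\<exists>b'. transition b Tau b' \<and> eqv P' b')"
proof -
  obtain Q1 Q2 where Q: "tau_steps b Q1" "trans_opt Q1 Tau Q2" "eqv P Q1" "eqv P' Q2"
    using tau_bisimD(4)[OF assms(1,3,4)] by blast
  have "eqv b Q1" using tau_bisimD(2,3)[OF assms(1)] assms(3) Q(3) by blast
  then have "Q1 = b" using bottom_steps[OF assms(2) Q(1)] by blast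
  then show ?thesis using Q(2,4) unfolding trans_opt_def by blast
qed

text \<open>A \<tau>-path from P back into its class would start with a step leaving the class. The
  bottom member b has to match this by a step of its own and then follow the rest of the path, so it
  would return to the class as well. Given b, only single inert steps of P need to be
  excluded.\<close>

lemma bottomI:
  assumes "tau_bisim eqv" "bottom eqv b" "eqv P b" "\<And>P'. transition P Tau P' \<Longrightarrow> \<not> eqv P P'"
  shows "bottom eqv P"
  unfolding bottom_def
proof (intro allI impI notI)
  note D = tau_bisimD[OF assms(1)]
  fix P2 assume "tau_plus P P2" and P2: "eqv P P2"
  then obtain P1 where P1: "transition P Tau P1" "tau_steps P1 P2" unfolding tau_plus_steps by blast
  have "\<not> eqv P1 b" using assms(4)[OF P1(1)] assms(3) D(2,3) by blast
  then obtain b1 where b1: "transition b Tau b1" "eqv P1 b1"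
    using bottom_tau[OF assms(1-3) P1(1)] by blast
  obtain b2 where b2: "tau_steps b1 b2" "eqv P2 b2"
    using tau_bisim_path[OF assms(1) P1(2) b1(2)] by blast
  have "tau_plus b b2" using b1(1) b2(1) unfolding tau_plus_steps by blast
  moreover have "eqv b b2" using assms(3) P2 b2(2) D(2,3) by blast
  ultimately show False using assms(2) unfolding bottom_def by blast
qed

locale tau_wf =
  fixes R :: "'a expr set"
  assumes goodR: "P \<in> R \<Longrightarrow> good P"
    and closedR: "P \<in> R \<Longrightarrow> transition P \<alpha> P' \<Longrightarrow> P' \<in> R"
    and countableR: "countable R"
    and wfR: "wf {(P', P). P \<in> R \<and> transition P Tau P'}"
begin

lemma tau_steps_R: "tau_steps P Q \<Longrightarrow> P \<in> R \<Longrightarrow> Q \<in> R"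
  unfolding tau_steps_def by (induction rule: rtranclp_induct) (auto intro: closedR)

lemma tau_plus_R: "tau_plus P Q \<Longrightarrow> P \<in> R \<Longrightarrow> Q \<in> R"
  using tau_steps_R tau_steps_cases by blast

lemma wf_tau_plus: "wf {(P', P). P \<in> R \<and> tau_plus P P'}"
proof (rule wf_subset[OF wf_trancl[OF wfR]], safe)
  fix Q P assume P: "P \<in> R" and Q: "tau_plus P Q"
  show "(Q, P) \<in> {(P', P). P \<in> R \<and> transition P Tau P'}\<^sup>+"
    using Q[unfolded tau_plus_def]
  proof (induction rule: tranclp_induct)
    case (base Q)
    then show ?case using P by blast
  next
    case (step Q1 Q2)
    have "Q1 \<in> R" using tau_plus_R[OF _ P] step.hyps(1) by (simp add: tau_plus_def)
    then have "(Q2, Q1) \<in> {(P', P). P \<in> R \<and> transition P Tau P'}" using step.hyps(2) by blast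
    then show ?case using step.IH by (rule trancl_into_trancl2)
  qed
qed

lemma bottom_exists:
  assumes "tau_bisim eqv" "P \<in> R"
  shows "\<exists>b \<in> R. bottom eqv b \<and> eqv P b"
  using wf_tau_plus assms(2)
proof (induction P rule: wf_induct_rule)
  case (less P)
  note D = tau_bisimD[OF assms(1)]
  show ?case
  proof (cases "bottom eqv P")
    case True
    then show ?thesis using less.prems D(1)[OF goodR] by blast
  next
    case False
    then obtain P' where P': "tau_plus P P'" "eqv P P'" unfolding bottom_def by blast
    then obtain b where "b \<in> R" "bottom eqv b" "eqv P' b"
      using less.IH[of P'] less.prems tau_plus_R by blast
    then show ?thesis using D(3) P'(2) by blast
  qed
qed

text \<open>The choice depends on the class alone, so equivalent processes have literally the same
  representative. The parameter \<open>M\<close> allows the representatives of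
  \<open>\<simeq>\<^sup>X\<^sub>b\<^sub>r\<close> to be drawn from those of
  \<open>\<simeq>\<^sub>b\<^sub>r\<close>.\<close>

definition rep :: "'a expr set \<Rightarrow> ('a expr \<Rightarrow> 'a expr \<Rightarrow> bool) \<Rightarrow> 'a expr \<Rightarrow> 'a expr" where
  "rep M eqv P = (SOME b. b \<in> M \<and> bottom eqv b \<and> eqv P b)"

lemma rep_cong: "tau_bisim eqv \<Longrightarrow> eqv P Q \<Longrightarrow> rep M eqv P = rep M eqv Q"
  unfolding rep_def by (rule arg_cong[where f = Eps]) (use tau_bisimD(2,3)[of eqv] in blast)

text \<open>A \<tau>-step of a bottom member leaves its class, so every member P of that class
  mimics it by a nonempty \<tau>-path. The induction runs over such a P, not over b, since the next
  representative \<open>f P'\<close> need not be reachable from b.\<close>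

lemma wf_rep:
  assumes e: "tau_bisim eqv"
    and rep: "\<And>P. P \<in> R \<Longrightarrow> f P \<in> R \<and> bottom eqv (f P) \<and> eqv P (f P)"
  shows "wf {(f P', b) | b P'. b \<in> f ` R \<and> transition b Tau P'}" (is "wf ?r")
proof -
  note D = tau_bisimD[OF e]
  have acc: "b \<in> Wellfounded.acc ?r" if "P \<in> R" "b \<in> f ` R" "eqv P b" for P b
    using wf_tau_plus that
  proof (induction P arbitrary: b rule: wf_induct_rule)
    case (less P)
    show ?case
    proof (rule accI)
      fix c assume "(c, b) \<in> ?r"
      then obtain P' where P': "c = f P'" "transition b Tau P'" by blast
      have b: "b \<in> R" "bottom eqv b" using less.prems(2) rep by blast+
      then have "\<not> eqv b P'" using P'(2) tau_steps_refl unfolding bottom_def tau_plus_steps by blast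
      have P'R: "P' \<in> R" using closedR[OF b(1) P'(2)] .
      obtain P1 P2 where P: "tau_steps P P1" "trans_opt P1 Tau P2" "eqv b P1" "eqv P' P2"
        using D(4)[OF D(2)[OF less.prems(3)] P'(2)] by blast
      have "P2 \<noteq> P" using \<open>\<not> eqv b P'\<close> P(4) less.prems(3) D(2,3) by blast
      then have "tau_plus P P2" using tau_steps_opt[OF P(1,2)] tau_steps_cases by blast
      moreover have "eqv P2 c" using P(4) rep[OF P'R] P'(1) D(2,3) by blast
      ultimately show "c \<in> Wellfounded.acc ?r"
        using less.IH[of P2 c] less.prems(1) P'(1) P'R tau_plus_R by blast
    qed
  qed
  have "b \<in> Wellfounded.acc ?r" for b
  proof (cases "b \<in> f ` R")
    case True
    then have "b \<in> R" using rep by blast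
    then show ?thesis using acc[OF _ True] D(1)[OF goodR] by blast
  next
    case False
    then show ?thesis by (intro accI[of b]) blast
  qed
  then show ?thesis by (simp add: wf_iff_acc)
qed

section \<open>The quotient by branching reactive bisimilarity\<close>

definition trs :: "'a expr \<Rightarrow> ('a act \<times> 'a expr) list" where
  "trs P = (SOME ps. set ps = {(\<alpha>, P'). transition P \<alpha> P'} \<and> Ax\<^sub>r \<turnstile> P \<approx> sum_prefix ps)"

lemma trs:
  assumes "P \<in> R"
  shows "(\<alpha>, P') \<in> set (trs P) \<longleftrightarrow> transition P \<alpha> P'" "Ax\<^sub>r \<turnstile> P \<approx> sum_prefix (trs P)"
proof -
  have "set (trs P) = {(\<alpha>, P'). transition P \<alpha> P'} \<and> Ax\<^sub>r \<turnstile> P \<approx> sum_prefix (trs P)"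
    unfolding trs_def by (rule someI_ex) (use hnf_good[OF goodR[OF assms]] in \<open>simp add: hnf_def\<close>)
  then show "(\<alpha>, P') \<in> set (trs P) \<longleftrightarrow> transition P \<alpha> P'" "Ax\<^sub>r \<turnstile> P \<approx> sum_prefix (trs P)" by auto
qed

abbreviation chi :: "'a expr \<Rightarrow> 'a expr" where
  "chi \<equiv> rep R br_bisim"

abbreviation xi :: "'a set \<Rightarrow> 'a expr \<Rightarrow> 'a expr" where
  "xi X \<equiv> rep (chi ` R) (\<lambda>P Q. br_bisim_env P X Q)"

lemma chi:
  assumes "P \<in> R"
  shows "chi P \<in> R \<and> bottom br_bisim (chi P) \<and> br_bisim P (chi P)"
proof -
  have "\<exists>b. b \<in> R \<and> bottom br_bisim b \<and> br_bisim P b"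
    using bottom_exists[OF tau_bisim_br assms] by blast
  then show ?thesis unfolding rep_def by (rule someI_ex)
qed

lemma chi_eq: "br_bisim P Q \<Longrightarrow> chi P = chi Q"
  by (rule rep_cong[OF tau_bisim_br])

lemma chi_idem: "b \<in> chi ` R \<Longrightarrow> chi b = b"
  using chi_eq[OF chi[THEN conjunct2, THEN conjunct2]] by force

lemma chi_R: "b \<in> chi ` R \<Longrightarrow> b \<in> R"
  using chi by blast

lemma xi_eq: "br_bisim_env P X Q \<Longrightarrow> xi X P = xi X Q"
  by (rule rep_cong[OF tau_bisim_env])

text \<open>The representatives of the coarser classes can be chosen among those of the finer ones: if \<open>b\<close> is
  at the bottom of its \<open>\<simeq>\<^sup>X\<^sub>b\<^sub>r\<close>-class, so is \<open>\<chi>(b)\<close>.\<close>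

lemma xi:
  assumes "P \<in> R"
  shows "xi X P \<in> chi ` R \<and> bottom (\<lambda>P Q. br_bisim_env P X Q) (xi X P) \<and> br_bisim_env P X (xi X P)"
proof -
  let ?e = "\<lambda>P Q. br_bisim_env P X Q"
  obtain b where b: "b \<in> R" "bottom ?e b" "?e P b"
    using bottom_exists[OF tau_bisim_env assms] by blast
  have bc: "br_bisim b (chi b)" using chi[OF b(1)] by blast
  have "bottom ?e (chi b)"
    unfolding bottom_def
  proof (intro allI impI notI)
    fix q assume q: "tau_plus (chi b) q" "br_bisim_env (chi b) X q"
    obtain b' where b': "tau_steps b b'" "br_bisim q b'"
      using br_path[OF _ br_sym[OF bc]] q(1) tau_steps_cases by blast
    have "br_bisim_env b X b'" using env_trans[OF br_env[OF bc] env_trans[OF q(2) br_env[OF b'(2)]]] .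
    then have "b' = b" using bottom_steps[OF b(2) b'(1)] by blast
    then have "br_bisim (chi b) q" using br_trans[OF br_sym[OF bc] br_sym] b'(2) by blast
    then show False using chi[OF b(1)] q(1) unfolding bottom_def by blast
  qed
  moreover have "?e P (chi b)" using env_trans[OF b(3) br_env[OF bc]] .
  ultimately have "\<exists>b. b \<in> chi ` R \<and> bottom ?e b \<and> ?e P b" using b(1) by blast
  then show ?thesis unfolding rep_def by (rule someI_ex)
qed

lemma sum_at_map: "sum_at \<rho> (map (\<lambda>p. (fst p, f (snd p))) ps) = sum_at (\<lambda>x. \<rho> (f x)) ps"
  by (simp add: sum_at_def comp_def)

definition quot :: "'a expr \<Rightarrow> ('a act \<times> 'a expr) list" where
  "quot b = map (\<lambda>p. (fst p, chi (snd p))) (trs b)"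

lemma quot_closed: "b \<in> chi ` R \<Longrightarrow> p \<in> set (quot b) \<Longrightarrow> snd p \<in> chi ` R"
  using trs(1)[OF chi_R, of b] closedR[OF chi_R, of b] by (auto simp: quot_def)

lemma wf_quot: "wf {(c, b). b \<in> chi ` R \<and> (Tau, c) \<in> set (quot b)}"
proof (rule wf_subset[OF wf_rep[OF tau_bisim_br chi]], safe)
  fix b c P assume P: "P \<in> R" and "(Tau, c) \<in> set (quot (chi P))"
  then obtain P' where "(Tau, P') \<in> set (trs (chi P))" "c = chi P'" by (auto simp: quot_def)
  then show "\<exists>b P'. (c, chi P) = (chi P', b) \<and> b \<in> chi ` R \<and> transition b Tau P'"
    using trs(1)[of "chi P"] chi[OF P] P by blast
qed

definition K :: "'a expr \<Rightarrow> 'a expr" where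
  "K = (SOME \<rho>. solution (chi ` R) quot \<rho>)"

lemma solution_K: "solution (chi ` R) quot K"
proof -
  have "\<exists>\<rho>. solution (chi ` R) quot \<rho>"
    using system_solution[of "chi ` R" quot, OF _ _ wf_quot] countableR quot_closed by blast
  then show ?thesis unfolding K_def by (rule someI_ex)
qed

definition H :: "'a expr \<Rightarrow> 'a expr" where
  "H P = sum_at (\<lambda>P'. K (chi P')) (trs P)"

lemma K_H: "b \<in> chi ` R \<Longrightarrow> Ax\<^sub>r \<turnstile> K b \<approx> H b"
  using solution_K by (auto simp: solution_def quot_def sum_at_map H_def)

lemma ccsp_K: "P \<in> R \<Longrightarrow> ccsp (K (chi P))"
  using K_H[of "chi P"] derivable_ccsp by blast

lemma ccsp_sum_at: "ccsp (sum_at \<rho> ps) \<longleftrightarrow> (\<forall>p \<in> set ps. ccsp (\<rho> (snd p)))"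
  by (simp add: sum_at_def)

lemma ccsp_H: "P \<in> R \<Longrightarrow> ccsp (H P)"
  using closedR ccsp_K by (fastforce simp: H_def ccsp_sum_at trs(1))

end

lemma derivable_sum_at:
  assumes "\<And>\<alpha> i. (\<alpha>, i) \<in> set ps \<Longrightarrow> Ax\<^sub>r \<turnstile> Prefix \<alpha> (\<rho> i) \<approx> Prefix \<alpha> (\<rho>' i)"
  shows "Ax\<^sub>r \<turnstile> sum_at \<rho> ps \<approx> sum_at \<rho>' ps"
  unfolding sum_at_def by (rule derivable_sum_map) (use assms in auto)

context tau_wf
begin

section \<open>Congruence of the canonical solution for the environments\<close>

text \<open>The transitions of \<open>\<theta>\<^sub>X(b)\<close>; a target tagged by \<open>Inl\<close> remains in the scope of \<open>\<theta>\<^sub>X\<close>.\<close>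

definition theta_trs :: "'a set \<Rightarrow> 'a expr \<Rightarrow> ('a act \<times> ('a expr + 'a expr)) list" where
  "theta_trs X b = (if idle b X then map (\<lambda>p. (fst p, Inr (snd p))) (trs b)
     else map (\<lambda>p. (fst p, if fst p = Tau then Inl (snd p) else Inr (snd p)))
       (filter (\<lambda>p. fst p \<in> vis_tau X) (trs b)))"

lemma theta_trs_idle:
  "b \<in> R \<Longrightarrow> idle b X \<Longrightarrow> (\<alpha>, z) \<in> set (theta_trs X b) \<longleftrightarrow> (\<exists>P'. transition b \<alpha> P' \<and> z = Inr P')"
  by (auto simp: theta_trs_def trs(1)[symmetric] image_iff Bex_def)

lemma theta_trs_active:
  "b \<in> R \<Longrightarrow> \<not> idle b X \<Longrightarrow> (\<alpha>, z) \<in> set (theta_trs X b) \<longleftrightarrow>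
     (\<exists>P'. transition b \<alpha> P' \<and> \<alpha> \<in> vis_tau X \<and> z = (if \<alpha> = Tau then Inl P' else Inr P'))"
  by (auto simp: theta_trs_def trs(1)[symmetric] image_iff Bex_def)

text \<open>The map f collapses the targets still in the scope of \<theta>. With \<open>chi\<close>
  the system has the processes \<theta>_X(K b) among its solutions; with \<open>xi X\<close> it is
  the quotient system solved by \<open>W X\<close>. The \<open>Inr\<close> part copies the system
  solved by \<open>K\<close>.\<close>

definition theta_quot ::
  "('a expr \<Rightarrow> 'a expr) \<Rightarrow> 'a set \<Rightarrow> 'a expr + 'a expr \<Rightarrow> ('a act \<times> ('a expr + 'a expr)) list" where
  "theta_quot f X i = (case i of
      Inl b \<Rightarrow> map (\<lambda>p. (fst p, map_sum f chi (snd p))) (theta_trs X b)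
    | Inr b \<Rightarrow> map (\<lambda>p. (fst p, Inr (snd p))) (quot b))"

abbreviation theta_index :: "('a expr \<Rightarrow> 'a expr) \<Rightarrow> ('a expr + 'a expr) set" where
  "theta_index f \<equiv> Inl ` f ` R \<union> Inr ` chi ` R"

lemma sum_at_theta_quot:
  "sum_at \<rho> (theta_quot f X (Inl b)) = sum_at (\<lambda>z. \<rho> (map_sum f chi z)) (theta_trs X b)"
  "sum_at \<rho> (theta_quot f X (Inr b)) = sum_at (\<lambda>b. \<rho> (Inr b)) (quot b)"
  by (simp_all add: theta_quot_def sum_at_map)

lemma theta_trs_R: "b \<in> R \<Longrightarrow> (\<alpha>, z) \<in> set (theta_trs X b) \<Longrightarrow> z \<in> Inl ` R \<union> Inr ` R"
  by (cases "idle b X") (auto simp: theta_trs_idle theta_trs_active dest: closedR)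

lemma countable_theta_index: "countable (theta_index f)"
  using countableR by simp

lemma theta_quot_closed:
  assumes "\<And>P. P \<in> R \<Longrightarrow> f P \<in> R" "i \<in> theta_index f" "p \<in> set (theta_quot f X i)"
  shows "snd p \<in> theta_index f"
proof (cases i)
  case (Inl b)
  then have "b \<in> R" using assms(1,2) by auto
  then show ?thesis
    using assms(3) Inl theta_trs_R[of b] by (fastforce simp: theta_quot_def)
next
  case (Inr b)
  then show ?thesis using assms(2,3) quot_closed[of b] by (auto simp: theta_quot_def)
qed

text \<open>A \<tau>-step never leaves the scope of \<theta>, and an idle b has none. Hence the
  \<tau>-edges form a disjoint union of the well-founded relation given for f and that of
  \<open>quot\<close>.\<close>

lemma wf_theta_quot:
  assumes f: "\<And>P. P \<in> R \<Longrightarrow> f P \<in> R"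
    and wf: "wf {(f P', b) | b P'. b \<in> f ` R \<and> transition b Tau P'}" (is "wf ?r")
  shows "wf {(j, i). i \<in> theta_index f \<and> (Tau, j) \<in> set (theta_quot f X i)}"
proof (rule wf_subset)
  let ?s = "{(c, b). b \<in> chi ` R \<and> (Tau, c) \<in> set (quot b)}"
  show "wf (map_prod Inl Inl ` ?r \<union> map_prod Inr Inr ` ?s)"
    by (rule wf_Un[OF wf_map_prod_image[OF wf] wf_map_prod_image[OF wf_quot]]) auto
  show "{(j, i). i \<in> theta_index f \<and> (Tau, j) \<in> set (theta_quot f X i)}
      \<subseteq> map_prod Inl Inl ` ?r \<union> map_prod Inr Inr ` ?s"
  proof
    fix p assume p: "p \<in> {(j, i). i \<in> theta_index f \<and> (Tau, j) \<in> set (theta_quot f X i)}"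
    obtain j i where ji: "p = (j, i)" by (cases p)
    have ij: "i \<in> theta_index f" "(Tau, j) \<in> set (theta_quot f X i)" using p ji by auto
    show "p \<in> map_prod Inl Inl ` ?r \<union> map_prod Inr Inr ` ?s"
    proof (cases i)
      case (Inl b)
      then have b: "b \<in> f ` R" "b \<in> R" using ij(1) f by auto
      obtain z where z: "(Tau, z) \<in> set (theta_trs X b)" "j = map_sum f chi z"
        using ij(2) Inl by (auto simp: theta_quot_def)
      have "\<not> idle b X"
      proof
        assume i: "idle b X"
        then have "\<exists>P'. transition b Tau P'" using z(1) theta_trs_idle[OF b(2) i] by blast
        then show False using i unfolding idle_iff stable_def by blast
      qed
      then obtain P' where "transition b Tau P'" "z = Inl P'"
        using z(1) theta_trs_active[OF b(2)] by auto
      then have "(f P', b) \<in> ?r" using b(1) by blast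
      have "p = map_prod Inl Inl (f P', b)" using z(2) Inl ji \<open>z = Inl P'\<close> by simp
      then show ?thesis using \<open>(f P', b) \<in> ?r\<close> by (rule UnI1[OF image_eqI])
    next
      case (Inr b)
      then obtain c where c: "(Tau, c) \<in> set (quot b)" "j = Inr c"
        using ij(2) by (auto simp: theta_quot_def)
      have "b \<in> chi ` R" using ij(1) Inr by auto
      then have "p \<in> map_prod Inr Inr ` ?s" using c Inr ji by (intro image_eqI[of _ _ "(c, b)"]) auto
      then show ?thesis by blast
    qed
  qed
qed

lemma wf_chi: "wf {(chi P', b) | b P'. b \<in> chi ` R \<and> transition b Tau P'}"
  by (rule wf_rep[OF tau_bisim_br chi])

lemma wf_xi: "wf {(xi X P', b) | b P'. b \<in> xi X ` R \<and> transition b Tau P'}"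
proof (rule wf_rep[OF tau_bisim_env])
  fix P assume "P \<in> R"
  then show "xi X P \<in> R \<and> bottom (\<lambda>P Q. br_bisim_env P X Q) (xi X P) \<and> br_bisim_env P X (xi X P)"
    using xi[of P X] chi_R by blast
qed

section \<open>The quotient for a fixed environment X\<close>

definition W :: "'a set \<Rightarrow> 'a expr + 'a expr \<Rightarrow> 'a expr" where
  "W X = (SOME \<rho>. solution (theta_index (xi X)) (theta_quot (xi X) X) \<rho>)"

lemma xi_in_R: "P \<in> R \<Longrightarrow> xi X P \<in> R"
  using xi chi_R by blast

lemma solution_W: "solution (theta_index (xi X)) (theta_quot (xi X) X) (W X)"
proof -
  have "snd p \<in> theta_index (xi X)" if "i \<in> theta_index (xi X)" "p \<in> set (theta_quot (xi X) X i)" for i p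
    using xi_in_R that by (rule theta_quot_closed)
  then have "\<exists>\<rho>. solution (theta_index (xi X)) (theta_quot (xi X) X) \<rho>"
    using system_solution[OF countable_theta_index _ wf_theta_quot[OF xi_in_R wf_xi], of X X] by blast
  then show ?thesis unfolding W_def by (rule someI_ex)
qed

text \<open>The \<open>Inr\<close> equations mention only \<open>Inr\<close> unknowns and coincide
  with the system of \<open>K\<close>, so uniqueness applies.\<close>

lemma W_Inr:
  assumes "b \<in> chi ` R"
  shows "Ax\<^sub>r \<turnstile> W X (Inr b) \<approx> K b"
proof (rule solution_unique[of "chi ` R" quot "\<lambda>b. W X (Inr b)"])
  show "solution (chi ` R) quot (\<lambda>b. W X (Inr b))"
    unfolding solution_def
  proof
    fix b assume "b \<in> chi ` R"
    then have "Inr b \<in> theta_index (xi X)" by blast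
    then have "Ax\<^sub>r \<turnstile> W X (Inr b) \<approx> sum_at (W X) (theta_quot (xi X) X (Inr b))"
      using solution_W[of X] unfolding solution_def by blast
    then show "Ax\<^sub>r \<turnstile> W X (Inr b) \<approx> sum_at (\<lambda>b. W X (Inr b)) (quot b)"
      by (simp only: sum_at_theta_quot)
  qed
qed (use countableR quot_closed wf_quot solution_K assms in auto)

definition theta_val :: "'a set \<Rightarrow> 'a expr + 'a expr \<Rightarrow> 'a expr" where
  "theta_val X = case_sum (\<lambda>P. W X (Inl (xi X P))) (\<lambda>P. K (chi P))"

text \<open>It plays for \<open>W X\<close> the role that \<open>H\<close> plays for
  \<open>K\<close>.\<close>

definition HX :: "'a set \<Rightarrow> 'a expr \<Rightarrow> 'a expr" where
  "HX X b = sum_at (theta_val X) (theta_trs X b)"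

lemma ccsp_W: "P \<in> R \<Longrightarrow> ccsp (W X (Inl (xi X P)))"
  using solution_W[of X] derivable_ccsp unfolding solution_def by blast

lemma ccsp_theta_val: "z \<in> Inl ` R \<union> Inr ` R \<Longrightarrow> ccsp (theta_val X z)"
  using ccsp_W ccsp_K by (auto simp: theta_val_def)

lemma ccsp_HX: "b \<in> R \<Longrightarrow> ccsp (HX X b)"
  unfolding HX_def ccsp_sum_at using theta_trs_R ccsp_theta_val by fastforce

lemma W_HX:
  assumes "b \<in> xi X ` R"
  shows "Ax\<^sub>r \<turnstile> W X (Inl b) \<approx> HX X b"
proof -
  have b: "b \<in> R" using assms xi_in_R by blast
  have "Inl b \<in> theta_index (xi X)" using assms by blast
  then have "Ax\<^sub>r \<turnstile> W X (Inl b) \<approx> sum_at (W X) (theta_quot (xi X) X (Inl b))"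
    using solution_W[of X] unfolding solution_def by blast
  also have "sum_at (W X) (theta_quot (xi X) X (Inl b))
      = sum_at (\<lambda>z. W X (map_sum (xi X) chi z)) (theta_trs X b)"
    by (rule sum_at_theta_quot)
  also have "Ax\<^sub>r \<turnstile> \<dots> \<approx> HX X b"
    unfolding HX_def
  proof (intro derivable_sum_at derivable_prefix)
    fix \<alpha> z assume "(\<alpha>, z) \<in> set (theta_trs X b)"
    then have "z \<in> Inl ` R \<union> Inr ` R" using theta_trs_R[OF b] by blast
    then show "Ax\<^sub>r \<turnstile> W X (map_sum (xi X) chi z) \<approx> theta_val X z"
      using ccsp_W W_Inr by (auto simp: theta_val_def intro!: derivable.reflexivity)
  qed
  finally show ?thesis .
qed

text \<open>As b is a bottom member, it matches the step itself, unless the step is inert. The value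
  of a target depends only on its class, so the matching step yields literally the same
  summand.\<close>

lemma HX_summand:
  assumes b: "b \<in> R" "bottom (\<lambda>P Q. br_bisim_env P X Q) b"
    and P: "P \<in> R" "br_bisim_env P X b" "\<not> idle P X" "transition P \<alpha> P'" "\<alpha> \<in> vis_tau X"
  shows "(\<alpha> = Tau \<and> br_bisim_env P' X b) \<or>
     (\<not> idle b X \<and> (\<exists>b'. (\<alpha>, if \<alpha> = Tau then Inl b' else Inr b') \<in> set (theta_trs X b) \<and>
        theta_val X (if \<alpha> = Tau then Inl b' else Inr b') = theta_val X (if \<alpha> = Tau then Inl P' else Inr P')))"
proof (cases "\<alpha> = Tau")
  case True
  then consider "br_bisim_env P' X b" | b' where "transition b Tau b'" "br_bisim_env P' X b'"
    using bottom_tau[OF tau_bisim_env b(2) P(2)] P(4) by blast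
  then show ?thesis
  proof cases
    case 2
    then have "\<not> idle b X" unfolding idle_iff stable_def by blast
    moreover have "xi X b' = xi X P'" using xi_eq[OF 2(2)] by simp
    ultimately show ?thesis
      using theta_trs_active[OF b(1)] True 2(1) by (auto simp: theta_val_def intro!: exI[of _ b'])
  qed (use True in blast)
next
  case False
  then obtain a where a: "\<alpha> = Vis a" "a \<in> X" using P(5) by auto
  obtain Q1 b' where Q: "tau_steps b Q1" "transition Q1 (Vis a) b'" "br_bisim_env P X Q1" "br_bisim P' b'"
    using env_vis[OF P(2) P(4)[unfolded a(1)] a(2)] by blast
  have "Q1 = b" using bottom_steps[OF b(2) Q(1)] env_trans[OF env_sym[OF P(2)] Q(3)] by blast
  then have b': "transition b (Vis a) b'" using Q(2) by simp
  then have "\<not> idle b X" using a(2) unfolding idle_iff by blast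
  moreover have "chi b' = chi P'" using chi_eq[OF Q(4)] by simp
  ultimately show ?thesis
    using theta_trs_active[OF b(1)] a b' by (auto simp: theta_val_def intro!: exI[of _ b'])
qed

lemma idle_bottom:
  assumes "idle P X" "br_bisim_env P X b" "bottom (\<lambda>P Q. br_bisim_env P X Q) b"
  shows "idle b X \<and> br_bisim P b"
proof -
  obtain b0 where b0: "tau_steps b b0" "idle b0 X" "br_bisim P b0"
    using env_idle_match[OF assms(1,2)] by blast
  have "b0 = b"
    using bottom_steps[OF assms(3) b0(1)] env_trans[OF env_sym[OF assms(2)] br_env[OF b0(3)]] by blast
  then show ?thesis using b0 by blast
qed

text \<open>If B is idle, it coincides with its representative. Otherwise \<theta> has already
  removed the time-outs: with an inert step of B the remaining sum is contracted by
  \<open>absorb_inert\<close>; without one B is itself a bottom member, and two equivalent bottom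
  members have the same summands.\<close>

lemma HX_W:
  assumes B: "B \<in> chi ` R"
  shows "Ax\<^sub>r \<turnstile> Prefix \<alpha> (HX X B) \<approx> Prefix \<alpha> (W X (Inl (xi X B)))"
proof -
  let ?e = "\<lambda>P Q. br_bisim_env P X Q"
  define b where "b = xi X B"
  have BR: "B \<in> R" using chi_R[OF B] .
  have b: "b \<in> chi ` R" "b \<in> R" "b \<in> xi X ` R" "bottom ?e b" "?e B b"
    using xi[OF BR, of X] chi_R BR by (auto simp: b_def)
  define val where "val = map (\<lambda>p :: 'a act \<times> _. (fst p, theta_val X (snd p)))"
  have HX: "HX X c = sum_prefix (val (theta_trs X c))" for c
    by (simp add: HX_def sum_at_def val_def)
  have Wb: "Ax\<^sub>r \<turnstile> W X (Inl b) \<approx> sum_prefix (val (theta_trs X b))"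
    using W_HX[OF b(3)] by (simp add: HX)
  have valI: "(\<beta>, theta_val X z) \<in> set (val ps)" if "(\<beta>, z) \<in> set ps" for \<beta> z ps
    using that by (force simp: val_def)
  have valE: "\<exists>P'. transition c \<beta> P' \<and> \<beta> \<in> vis_tau X \<and> E = theta_val X (if \<beta> = Tau then Inl P' else Inr P')"
    if "(\<beta>, E) \<in> set (val (theta_trs X c))" "\<not> idle c X" "c \<in> R" for c \<beta> E
    using that theta_trs_active[OF that(3,2)] by (fastforce simp: val_def)
  show ?thesis
  proof (cases "idle B X")
    case True
    \<comment> \<open>On idle processes the equivalence for X gives
      \<open>\<simeq>\<^sub>b\<^sub>r\<close>. Both B and b are chosen representatives for the
      latter, hence equal.\<close>
    then have "br_bisim B b" using idle_bottom[OF True b(5,4)] by blast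
    then have "B = b" using chi_eq chi_idem[OF B] chi_idem[OF b(1)] by metis
    then show ?thesis
      using derivable.symmetry[OF W_HX[OF b(3)]] by (simp add: b_def derivable_prefix)
  next
    case active: False
    show ?thesis
    proof (cases "\<exists>B'. transition B Tau B' \<and> ?e B B'")
      case True
      then obtain B' where B': "transition B Tau B'" "?e B B'" by blast
      have inl: "theta_val X (Inl P') = W X (Inl b)" if "?e P' b" for P'
        using xi_eq[OF env_trans[OF that env_sym[OF b(5)]]] by (simp add: theta_val_def b_def)
      have "Ax\<^sub>r \<turnstile> Prefix \<alpha> (sum_prefix (val (theta_trs X B))) \<approx> Prefix \<alpha> (W X (Inl b))"
      proof (rule absorb_inert[OF Wb])
        have "(Tau, Inl B') \<in> set (theta_trs X B)"
          using theta_trs_active[OF BR active] B'(1) by simp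
        moreover have "?e B' b" using env_trans[OF env_sym[OF B'(2)] b(5)] .
        ultimately show "(Tau, W X (Inl b)) \<in> set (val (theta_trs X B))" using valI inl by metis
      next
        fix p assume p: "p \<in> set (val (theta_trs X B))"
        obtain \<beta> E where pE: "p = (\<beta>, E)" by (cases p)
        obtain P' where P': "transition B \<beta> P'" "\<beta> \<in> vis_tau X"
          "E = theta_val X (if \<beta> = Tau then Inl P' else Inr P')"
          using valE[OF p[unfolded pE] active BR] by blast
        from HX_summand[OF b(2,4) BR b(5) active P'(1,2)]
        show "p = (Tau, W X (Inl b)) \<or> p \<in> set (val (theta_trs X b))"
        proof (elim disjE conjE exE)
          assume "\<beta> = Tau" "?e P' b"
          then show ?thesis using P'(3) pE inl by simp
        next
          fix b' assume "(\<beta>, if \<beta> = Tau then Inl b' else Inr b') \<in> set (theta_trs X b)"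
            "theta_val X (if \<beta> = Tau then Inl b' else Inr b') = theta_val X (if \<beta> = Tau then Inl P' else Inr P')"
          then show ?thesis using valI P'(3) pE by metis
        qed
      qed
      then show ?thesis by (simp add: HX b_def)
    next
      case False
      then have Bb: "bottom ?e B" using bottomI[OF tau_bisim_env b(4,5)] by blast
      have bB: "?e b B" using env_sym[OF b(5)] .
      have active_b: "\<not> idle b X" using idle_bottom[OF _ bB Bb] active by blast
      have sub: "set (val (theta_trs X c)) \<subseteq> set (val (theta_trs X d))"
        if c: "c \<in> R" "bottom ?e c" "\<not> idle c X" and d: "d \<in> R" "bottom ?e d" and cd: "?e c d" for c d
      proof
        fix p assume p: "p \<in> set (val (theta_trs X c))"
        obtain \<beta> E where pE: "p = (\<beta>, E)" by (cases p)
        obtain P' where P': "transition c \<beta> P'" "\<beta> \<in> vis_tau X"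
          "E = theta_val X (if \<beta> = Tau then Inl P' else Inr P')"
          using valE[OF p[unfolded pE] c(3,1)] by blast
        from HX_summand[OF d c(1) cd c(3) P'(1,2)] show "p \<in> set (val (theta_trs X d))"
        proof (elim disjE conjE exE)
          assume "\<beta> = Tau" "?e P' d"
          then have "?e c P'" "tau_plus c P'"
            using env_trans[OF cd env_sym] P'(1) tau_steps_refl unfolding tau_plus_steps by blast+
          then show ?thesis using c(2) unfolding bottom_def by blast
        next
          fix b' assume "(\<beta>, if \<beta> = Tau then Inl b' else Inr b') \<in> set (theta_trs X d)"
            "theta_val X (if \<beta> = Tau then Inl b' else Inr b') = theta_val X (if \<beta> = Tau then Inl P' else Inr P')"
          then show ?thesis using valI P'(3) pE by metis
        qed
      qed
      have "set (val (theta_trs X B)) = set (val (theta_trs X b))"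
        using sub[OF BR Bb active b(2,4,5)] sub[OF b(2,4) active_b BR Bb bB] by blast
      then have "Ax\<^sub>r \<turnstile> HX X B \<approx> HX X b"
        using ccsp_HX[OF BR, of X] unfolding HX by (intro derivable_sum_set)
      also have "Ax\<^sub>r \<turnstile> HX X b \<approx> W X (Inl b)" using W_HX[OF b(3)] by (rule derivable.symmetry)
      finally show ?thesis by (simp add: b_def derivable_prefix)
    qed
  qed
qed

text \<open>Both sides solve one system indexed by the classes of
  \<open>\<simeq>\<^sub>b\<^sub>r\<close>: the left one by the laws for \<theta> on sums, the right
  one by \<open>HX_W\<close> at the targets in the scope of \<theta>. This finer index set keeps
  \<theta>_X(K B) apart for different B; through \<open>HX_W\<close> it is then related to the
  coarser quotient.\<close>

lemma theta_K_HX: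
  assumes "B \<in> chi ` R"
  shows "Ax\<^sub>r \<turnstile> Theta X X (K B) \<approx> HX X B"
proof -
  let ?I = "theta_index chi" and ?tr = "theta_quot chi X"
  have xi_chi: "xi X (chi P) = xi X P" if "P \<in> R" for P
    using chi[OF that] xi_eq[OF br_env] by metis
  have 1: "solution ?I ?tr (case_sum (HX X) K)"
    unfolding solution_def
  proof
    fix i assume i: "i \<in> ?I"
    show "Ax\<^sub>r \<turnstile> case_sum (HX X) K i \<approx> sum_at (case_sum (HX X) K) (?tr i)"
    proof (cases i)
      case (Inr b)
      then show ?thesis
        using i solution_K by (auto simp: theta_quot_def solution_def sum_at_map)
    next
      case (Inl b)
      then have b: "b \<in> R" using i chi_R by auto
      have "Ax\<^sub>r \<turnstile> HX X b \<approx> sum_at (\<lambda>z. case_sum (HX X) K (map_sum chi chi z)) (theta_trs X b)"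
        unfolding HX_def[of X b]
      proof (rule derivable_sum_at)
        fix \<alpha> z assume "(\<alpha>, z) \<in> set (theta_trs X b)"
        then consider P where "z = Inl P" "P \<in> R" | P where "z = Inr P" "P \<in> R"
          using theta_trs_R[OF b] by blast
        then show "Ax\<^sub>r \<turnstile> Prefix \<alpha> (theta_val X z) \<approx> Prefix \<alpha> (case_sum (HX X) K (map_sum chi chi z))"
        proof cases
          case 1
          then show ?thesis
            using derivable.symmetry[OF HX_W[of "chi P" \<alpha> X]] xi_chi by (simp add: theta_val_def)
        next
          case 2
          then show ?thesis using ccsp_K by (auto simp: theta_val_def intro!: derivable.reflexivity)
        qed
      qed
      then show ?thesis using Inl by (simp add: theta_quot_def sum_at_map)
    qed
  qed
  let ?\<rho> = "case_sum (\<lambda>b. Theta X X (K b)) K"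
  have 2: "solution ?I ?tr ?\<rho>"
    unfolding solution_def
  proof
    fix i assume i: "i \<in> ?I"
    show "Ax\<^sub>r \<turnstile> ?\<rho> i \<approx> sum_at ?\<rho> (?tr i)"
    proof (cases i)
      case (Inr b)
      then show ?thesis
        using i solution_K by (auto simp: theta_quot_def solution_def sum_at_map)
    next
      case (Inl b)
      then have b: "b \<in> chi ` R" "b \<in> R" using i chi_R by auto
      let ?ps = "map (\<lambda>p. (fst p, K (chi (snd p)))) (trs b)"
      have c: "ccsp (sum_prefix ?ps)" using ccsp_H[OF b(2)] by (simp only: H_def sum_at_def)
      have "Ax\<^sub>r \<turnstile> K b \<approx> sum_prefix ?ps" using K_H[OF b(1)] by (simp add: H_def sum_at_def)
      then have "Ax\<^sub>r \<turnstile> Theta X X (K b) \<approx> Theta X X (sum_prefix ?ps)" by (rule derivable_theta) simp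
      also have "Ax\<^sub>r \<turnstile> \<dots> \<approx> sum_at (\<lambda>z. ?\<rho> (map_sum chi chi z)) (theta_trs X b)"
      proof (cases "idle b X")
        case True
        then have "\<forall>p \<in> set ?ps. fst p \<notin> vis_tau X"
          using initials_hnf[OF trs(1)[OF b(2)], of X] by simp
        then have "Ax\<^sub>r \<turnstile> Theta X X (sum_prefix ?ps) \<approx> sum_prefix ?ps"
          using c by (intro theta_sum_idle) auto
        moreover have "sum_prefix ?ps = sum_at (\<lambda>z. ?\<rho> (map_sum chi chi z)) (theta_trs X b)"
          using True by (simp add: theta_trs_def sum_at_def comp_def)
        ultimately show ?thesis by simp
      next
        case False
        then have "\<exists>p \<in> set ?ps. fst p \<in> vis_tau X"
          using initials_hnf[OF trs(1)[OF b(2)], of X] by auto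
        then have "Ax\<^sub>r \<turnstile> Theta X X (sum_prefix ?ps) \<approx>
          sum_prefix (map (\<lambda>p. (fst p, if fst p = Tau then Theta X X (snd p) else snd p))
          (filter (\<lambda>p. fst p \<in> vis_tau X) ?ps))"
          using c by (intro theta_sum_active) auto
        moreover have "map (\<lambda>p. (fst p, if fst p = Tau then Theta X X (snd p) else snd p))
            (filter (\<lambda>p. fst p \<in> vis_tau X) ?ps) = map (\<lambda>p. (fst p, ?\<rho> (map_sum chi chi (snd p)))) (theta_trs X b)"
          unfolding theta_trs_def if_not_P[OF False] filter_map map_map by (simp add: comp_def)
        ultimately show ?thesis unfolding sum_at_def by metis
      qed
      finally show ?thesis using Inl by (simp add: theta_quot_def sum_at_map)
    qed
  qed
  have chiR: "chi P \<in> R" if "P \<in> R" for P using chi[OF that] by blast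
  have closed: "snd p \<in> ?I" if "i \<in> ?I" "p \<in> set (?tr i)" for i p
    using chiR that by (rule theta_quot_closed)
  have "Ax\<^sub>r \<turnstile> ?\<rho> (Inl B) \<approx> case_sum (HX X) K (Inl B)"
  proof (rule solution_unique[OF countable_theta_index _ wf_theta_quot[OF chiR wf_chi] 2 1])
    show "Inl B \<in> ?I" using assms by blast
  qed (rule closed)
  then show ?thesis by simp
qed

lemma theta_K_cong:
  assumes "P \<in> R" "Q \<in> R" "br_bisim_env P X Q"
  shows "Ax\<^sub>r \<turnstile> Prefix \<alpha> (Theta X X (K (chi P))) \<approx> Prefix \<alpha> (Theta X X (K (chi Q)))"
proof -
  have 1: "Ax\<^sub>r \<turnstile> Prefix \<alpha> (Theta X X (K (chi P))) \<approx> Prefix \<alpha> (W X (Inl (xi X P)))" if "P \<in> R" for P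
  proof -
    have "xi X (chi P) = xi X P" using chi[OF that] xi_eq[OF br_env] by metis
    then show ?thesis
      using derivable.transitivity[OF derivable_prefix[OF theta_K_HX[OF imageI[OF that]]] HX_W[OF imageI[OF that]]]
      by metis
  qed
  show ?thesis
    using derivable.transitivity[OF 1[OF assms(1)] derivable.symmetry] 1[OF assms(2)] xi_eq[OF assms(3)] by simp
qed

section \<open>Completeness\<close>

text \<open>These conditions hold in both directions for rooted bisimilar processes and also for
  equivalent bottom members. Thus \<open>root_sim_H\<close> serves twice: for the theorem itself and
  inside \<open>H_K\<close>.\<close>

definition root_sim :: "'a expr \<Rightarrow> 'a expr \<Rightarrow> bool" where
  "root_sim P Q \<longleftrightarrow>
     (\<forall>\<alpha> P'. \<alpha> \<noteq> Tout \<longrightarrow> transition P \<alpha> P' \<longrightarrow> (\<exists>Q'. transition Q \<alpha> Q' \<and> br_bisim P' Q')) \<and>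
     (\<forall>X P'. idle P X \<longrightarrow> transition P Tout P' \<longrightarrow> (\<exists>Q'. transition Q Tout Q' \<and> br_bisim_env P' X Q'))"

lemma root_sim_H:
  assumes PQ: "P \<in> R" "Q \<in> R" and sim: "root_sim P Q" "root_sim Q P"
  shows "Ax\<^sub>r \<turnstile> H P \<approx> H Q"
proof (rule derivable.reactive_approximation, rule allI)
  fix X
  define ps where "ps P = map (\<lambda>p. (fst p, K (chi (snd p)))) (trs P)" for P
  have H: "H P = sum_prefix (ps P)" for P by (simp add: H_def sum_at_def ps_def)
  have ps: "(\<alpha>, E) \<in> set (ps P) \<longleftrightarrow> (\<exists>P'. transition P \<alpha> P' \<and> E = K (chi P'))" if "P \<in> R" for \<alpha> E P
    using trs(1)[OF that] by (force simp: ps_def)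
  have c: "ccsp (sum_prefix (ps P))" if "P \<in> R" for P using ccsp_H[OF that] by (simp add: H)
  \<comment> \<open>Equal initials put \<psi>_X in the same mode, active or idle, on both
    sides.\<close>
  have ini: "initials P \<subseteq> initials Q" if "root_sim P Q" for P Q
    using that unfolding root_sim_def initials_def by blast
  then have eq: "initials P = initials Q" using sim by blast
  have idle: "idle P X \<longleftrightarrow> (\<forall>p \<in> set (ps P). fst p \<notin> vis_tau X)" if "P \<in> R" for P
    using initials_hnf[OF trs(1)[OF that], of X] by (simp add: ps_def)
  show "Ax\<^sub>r \<turnstile> Psi X (H P) \<approx> Psi X (H Q)"
  proof (cases "idle P X")
    case False
    let ?f = "\<lambda>P. filter (\<lambda>p. fst p \<noteq> Tout) (ps P)"
    have psi: "Ax\<^sub>r \<turnstile> Psi X (H P) \<approx> sum_prefix (?f P)" if "P \<in> R" "\<not> idle P X" for P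
      unfolding H using idle[OF that(1)] that c[OF that(1)] by (intro psi_sum_active) auto
    have sub: "set (?f P) \<subseteq> set (?f Q)" if PQ: "P \<in> R" "Q \<in> R" "root_sim P Q" for P Q
    proof
      fix p assume p: "p \<in> set (?f P)"
      obtain \<alpha> E where pE: "p = (\<alpha>, E)" by (cases p)
      obtain P' where P': "transition P \<alpha> P'" "E = K (chi P')" "\<alpha> \<noteq> Tout"
        using ps[OF PQ(1), of \<alpha> E] p pE by auto
      then obtain Q' where Q': "transition Q \<alpha> Q'" "br_bisim P' Q'" using PQ(3) unfolding root_sim_def by blast
      then show "p \<in> set (?f Q)" using ps[OF PQ(2), of \<alpha> E] P' chi_eq[OF Q'(2)] pE by auto
    qed
    have "set (?f P) = set (?f Q)" using sub PQ sim by blast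
    moreover have "ccsp (sum_prefix (?f P))" using c[OF PQ(1)] by simp
    ultimately have "Ax\<^sub>r \<turnstile> sum_prefix (?f P) \<approx> sum_prefix (?f Q)"
      by (rule derivable_sum_set)
    moreover have "\<not> idle Q X" using False eq by simp
    ultimately show ?thesis
      by (intro derivable.transitivity[OF psi[OF PQ(1) False]]
          derivable.transitivity[OF _ derivable.symmetry[OF psi[OF PQ(2)]]])
  next
    case True
    let ?g = "\<lambda>P. map (\<lambda>p. (fst p, if fst p = Tout then Theta X X (snd p) else snd p)) (ps P)"
    have psi: "Ax\<^sub>r \<turnstile> Psi X (H P) \<approx> sum_prefix (?g P)" if "P \<in> R" "idle P X" for P
      unfolding H using idle[OF that(1)] that(2) c[OF that(1)] by (intro psi_sum_idle) auto
    have sub: "\<exists>F. (\<alpha>, F) \<in> set (?g Q) \<and> Ax\<^sub>r \<turnstile> Prefix \<alpha> E \<approx> Prefix \<alpha> F"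
      if PQ: "P \<in> R" "Q \<in> R" "root_sim P Q" "idle P X" "(\<alpha>, E) \<in> set (?g P)" for P Q \<alpha> E
    proof -
      obtain F where "(\<alpha>, F) \<in> set (ps P)" "E = (if \<alpha> = Tout then Theta X X F else F)"
        using PQ(5) by auto
      then obtain P' where P': "transition P \<alpha> P'" "E = (if \<alpha> = Tout then Theta X X (K (chi P')) else K (chi P'))"
        using ps[OF PQ(1), of \<alpha> F] by blast
      have g: "(\<alpha>, if \<alpha> = Tout then Theta X X (K (chi Q')) else K (chi Q')) \<in> set (?g Q)"
        if "transition Q \<alpha> Q'" for Q'
      proof -
        have "(\<alpha>, K (chi Q')) \<in> set (ps Q)" using ps[OF PQ(2)] that by blast
        then show ?thesis by (force simp: image_iff)
      qed
      have P'R: "P' \<in> R" using closedR[OF PQ(1) P'(1)] .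
      show ?thesis
      proof (cases "\<alpha> = Tout")
        case True
        then obtain Q' where Q': "transition Q Tout Q'" "br_bisim_env P' X Q'"
          using PQ(3,4) P'(1) unfolding root_sim_def by blast
        then show ?thesis
          using g[of Q'] True P' theta_K_cong[OF P'R closedR[OF PQ(2) Q'(1)] Q'(2)] by auto
      next
        case False
        then obtain Q' where Q': "transition Q \<alpha> Q'" "br_bisim P' Q'"
          using PQ(3) P'(1) unfolding root_sim_def by blast
        then show ?thesis
          using g[of Q'] False P' chi_eq[OF Q'(2)] ccsp_K[OF P'R]
          by (auto intro!: derivable.reflexivity exI[of _ "K (chi Q')"])
      qed
    qed
    have idle_Q: "idle Q X" using True eq by simp
    have "Ax\<^sub>r \<turnstile> sum_prefix (?g P) \<approx> sum_prefix (?g Q)"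
    proof (rule derivable_sum)
      show "\<exists>F. (\<alpha>, F) \<in> set (?g Q) \<and> Ax\<^sub>r \<turnstile> Prefix \<alpha> E \<approx> Prefix \<alpha> F"
        if "(\<alpha>, E) \<in> set (?g P)" for \<alpha> E using sub[OF PQ sim(1) True that] .
      show "\<exists>F. (\<alpha>, F) \<in> set (?g P) \<and> Ax\<^sub>r \<turnstile> Prefix \<alpha> F \<approx> Prefix \<alpha> E"
        if "(\<alpha>, E) \<in> set (?g Q)" for \<alpha> E
        using sub[OF PQ(2,1) sim(2) idle_Q that] derivable.symmetry by blast
    qed
    then show ?thesis
      by (intro derivable.transitivity[OF psi[OF PQ(1) True]]
          derivable.transitivity[OF _ derivable.symmetry[OF psi[OF PQ(2) idle_Q]]])
  qed
qed

text \<open>The preparatory \<tau>-path of Q must be empty as Q is a bottom member, and an empty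
  match of a \<tau>-step of P would place its target in the class of the bottom member P. For a
  time-out, Q itself turns out to be the idle process provided by
  \<open>env_idle_match\<close>.\<close>

lemma bottom_root_sim:
  assumes "bottom br_bisim P" "bottom br_bisim Q" "br_bisim P Q"
  shows "root_sim P Q"
  unfolding root_sim_def
proof (intro conjI allI impI)
  have uniq: "Q1 = Q" if "tau_steps Q Q1" "br_bisim P Q1" for Q1
    using bottom_steps[OF assms(2) that(1)] br_trans[OF br_sym[OF assms(3)] that(2)] by blast
  fix \<alpha> P' assume P': "\<alpha> \<noteq> Tout" "transition P \<alpha> P'"
  obtain Q1 Q2 where Q: "tau_steps Q Q1" "trans_opt Q1 \<alpha> Q2" "br_bisim P Q1" "br_bisim P' Q2"
    using br_step[OF assms(3) P'(2,1)] by blast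
  then have Q1: "Q1 = Q" using uniq by blast
  have "transition Q \<alpha> Q2"
  proof (rule ccontr)
    assume "\<not> ?thesis"
    then have "\<alpha> = Tau" "Q2 = Q" using Q(2) Q1 by (auto simp: trans_opt_def)
    then have "br_bisim P P'" "tau_plus P P'"
      using br_trans[OF assms(3) br_sym] Q(4) P'(2) tau_steps_refl unfolding tau_plus_steps by blast+
    then show False using assms(1) unfolding bottom_def by blast
  qed
  then show "\<exists>Q'. transition Q \<alpha> Q' \<and> br_bisim P' Q'" using Q(4) by blast
next
  fix X P' assume P': "idle P X" "transition P Tout P'"
  obtain Q0 where Q0: "tau_steps Q Q0" "idle Q0 X" "br_bisim P Q0"
    using env_idle_match[OF P'(1) br_env[OF assms(3)]] by blast
  have "Q0 = Q" using bottom_steps[OF assms(2) Q0(1)] br_trans[OF br_sym[OF assms(3)] Q0(3)] by blast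
  then have "stable Q" using Q0(2) unfolding idle_iff by blast
  then show "\<exists>Q'. transition Q Tout Q' \<and> br_bisim_env P' X Q'"
    using env_tout_match[OF P'(1) br_env[OF assms(3)] _ P'(2)] by blast
qed

text \<open>Without an inert step P is a bottom member like its representative, and
  \<open>root_sim_H\<close> applies. With one, the time-outs are dropped first, as the
  representative need not have them, and the remaining non-inert summands all recur in the sum of
  the representative.\<close>

lemma H_K:
  assumes P: "P \<in> R"
  shows "Ax\<^sub>r \<turnstile> Prefix \<alpha> (H P) \<approx> Prefix \<alpha> (K (chi P))"
proof -
  define b where "b = chi P"
  have b: "b \<in> R" "b \<in> chi ` R" "bottom br_bisim b" "br_bisim P b"
    using chi[OF P] P by (auto simp: b_def)
  show ?thesis
  proof (cases "\<exists>P'. transition P Tau P' \<and> br_bisim P P'")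
    case False
    then have "bottom br_bisim P" using bottomI[OF tau_bisim_br b(3,4)] by blast
    then have "Ax\<^sub>r \<turnstile> H P \<approx> H b"
      using bottom_root_sim b(3,4) br_sym by (intro root_sim_H[OF P b(1)]) blast+
    also have "Ax\<^sub>r \<turnstile> H b \<approx> K b" using K_H[OF b(2)] by (rule derivable.symmetry)
    finally show ?thesis by (simp add: b_def derivable_prefix)
  next
    case True
    then obtain P1 where P1: "transition P Tau P1" "br_bisim P P1" by blast
    let ?val = "map (\<lambda>p. (fst p, K (chi (snd p))))"
    let ?ps = "?val (trs P)"
    have val: "(\<beta>, E) \<in> set (?val (trs Q)) \<longleftrightarrow> (\<exists>Q'. transition Q \<beta> Q' \<and> E = K (chi Q'))" if "Q \<in> R" for \<beta> E Q
      using trs(1)[OF that] by force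
    have inert: "(Tau, K b) \<in> set ?ps" using val[OF P] P1 chi_eq[OF P1(2)] by (auto simp: b_def)
    have c: "ccsp (sum_prefix ?ps)" using ccsp_H[OF P] by (simp only: H_def sum_at_def)
    have "Ax\<^sub>r \<turnstile> H P \<approx> sum_prefix (filter (\<lambda>p. fst p \<noteq> Tout) ?ps)"
      using drop_timeouts[OF inert c] by (simp only: H_def sum_at_def)
    then have "Ax\<^sub>r \<turnstile> Prefix \<alpha> (H P) \<approx> Prefix \<alpha> (sum_prefix (filter (\<lambda>p. fst p \<noteq> Tout) ?ps))"
      by (rule derivable_prefix)
    also have "Ax\<^sub>r \<turnstile> \<dots> \<approx> Prefix \<alpha> (K b)"
    proof (rule absorb_inert)
      show "Ax\<^sub>r \<turnstile> K b \<approx> sum_prefix (?val (trs b))" using K_H[OF b(2)] by (simp only: H_def sum_at_def)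
      show "(Tau, K b) \<in> set (filter (\<lambda>p. fst p \<noteq> Tout) ?ps)" using inert by simp
      fix p assume p: "p \<in> set (filter (\<lambda>p. fst p \<noteq> Tout) ?ps)"
      obtain \<beta> E where pE: "p = (\<beta>, E)" by (cases p)
      obtain P' where P': "transition P \<beta> P'" "E = K (chi P')" "\<beta> \<noteq> Tout"
        using p pE val[OF P, of \<beta> E] by auto
      obtain Q1 Q2 where Q: "tau_steps b Q1" "trans_opt Q1 \<beta> Q2" "br_bisim P Q1" "br_bisim P' Q2"
        using br_step[OF b(4) P'(1,3)] by blast
      have Q1: "Q1 = b" using bottom_steps[OF b(3) Q(1)] br_trans[OF br_sym[OF b(4)] Q(3)] by blast
      show "p = (Tau, K b) \<or> p \<in> set (?val (trs b))"
      proof (cases "transition b \<beta> Q2")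
        case True
        then show ?thesis using val[OF b(1), of \<beta> E] pE P'(2) chi_eq[OF Q(4)] by auto
      next
        case False
        then have "\<beta> = Tau" "Q2 = b" using Q(2) Q1 by (auto simp: trans_opt_def)
        then show ?thesis using pE P'(2) chi_eq[OF Q(4)] chi_idem[OF b(2)] by auto
      qed
    qed
    finally show ?thesis by (simp add: b_def)
  qed
qed

lemma derivable_H:
  assumes "P \<in> R"
  shows "Ax\<^sub>r \<turnstile> P \<approx> H P"
proof (rule solution_unique[of R trs "\<lambda>P. P" H])
  show "countable R" by (rule countableR)
  show "snd p \<in> R" if "P \<in> R" "p \<in> set (trs P)" for P p
    using trs(1)[OF that(1)] closedR[OF that(1)] that(2) by (cases p) auto
  have "{(Q, P). P \<in> R \<and> (Tau, Q) \<in> set (trs P)} = {(Q, P). P \<in> R \<and> transition P Tau Q}"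
    using trs(1) by blast
  then show "wf {(Q, P). P \<in> R \<and> (Tau, Q) \<in> set (trs P)}" using wfR by simp
  show "solution R trs (\<lambda>P. P)" using trs(2) by (simp add: solution_def sum_at_def)
  show "solution R trs H"
    unfolding solution_def
  proof
    fix P assume P: "P \<in> R"
    have "Ax\<^sub>r \<turnstile> sum_at (\<lambda>P'. K (chi P')) (trs P) \<approx> sum_at H (trs P)"
      by (intro derivable_sum_at derivable.symmetry[OF H_K]) (use trs(1)[OF P] closedR[OF P] in blast)
    then show "Ax\<^sub>r \<turnstile> H P \<approx> sum_at H (trs P)" by (simp only: H_def[of P])
  qed
qed (rule assms)

end

section \<open>Rooted bisimulations and reachable processes\<close>

lemma rbr_bisimulation_step:
  assumes "rbr_bisimulation B T" "B P Q" "\<alpha> \<noteq> Tout" "transition P \<alpha> P'"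
  shows "\<exists>Q'. transition Q \<alpha> Q' \<and> br_bisim P' Q'"
  using assms unfolding rbr_bisimulation_def by blast

lemma rbr_bisimulation_env: "rbr_bisimulation B T \<Longrightarrow> B P Q \<Longrightarrow> T P X Q"
  unfolding rbr_bisimulation_def by blast

lemma rbr_bisimulation_tout:
  assumes "rbr_bisimulation B T" "T P X Q" "idle P X" "transition P Tout P'"
  shows "\<exists>Q'. transition Q Tout Q' \<and> br_bisim_env P' X Q'"
  using assms unfolding rbr_bisimulation_def by blast

lemma rbr_bisimulation_sym: "rbr_bisimulation B T \<Longrightarrow> B P Q \<Longrightarrow> B Q P"
  unfolding rbr_bisimulation_def sym_process_rel_def by (elim conjE) blast

lemma reachable_good: "reachable P Q \<Longrightarrow> good P \<Longrightarrow> good Q"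
  unfolding reachable_def by (induction rule: rtranclp_induct) (auto dest: good_transition)

lemma countable_reachable:
  assumes "good P"
  shows "countable {Q. reachable P Q}"
proof -
  \<comment> \<open>Restricting the sources to good processes gives every process finitely many
    successors under \<open>?r\<close>, by its head normal form.\<close>
  let ?r = "{(Q, Q'). good Q \<and> (\<exists>\<alpha>. transition Q \<alpha> Q')}"
  have "countable (?r `` Y)" if "countable Y" for Y
  proof -
    have "finite (?r `` {Q})" for Q
    proof (cases "good Q")
      case True
      then obtain ps where "set ps = {(\<alpha>, P'). transition Q \<alpha> P'}" using hnf_good hnf_def by blast
      then have "?r `` {Q} \<subseteq> snd ` set ps" by force
      then show ?thesis by (rule finite_subset) simp
    qed auto
    then have "countable (\<Union>Q \<in> Y. ?r `` {Q})"
      using that by (intro countable_UN) (auto intro: countable_finite)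
    moreover have "?r `` Y = (\<Union>Q \<in> Y. ?r `` {Q})" by blast
    ultimately show ?thesis by (simp only:)
  qed
  then have "countable (?r\<^sup>* `` {P})" by (rule countable_rtrancl) auto
  moreover have "(P, Q) \<in> ?r\<^sup>*" if "reachable P Q" for Q
    using that unfolding reachable_def
  proof (induction rule: rtranclp_induct)
    case (step Q Q')
    then have "good Q" using reachable_good assms unfolding reachable_def by blast
    then have "(Q, Q') \<in> ?r" using step.hyps(2) by blast
    then show ?case using step.IH by (rule rtrancl.rtrancl_into_rtrancl[rotated])
  qed simp
  ultimately show ?thesis by (elim countable_subset[rotated]) blast
qed

theorem theorem31:
  fixes P Q :: "'a expr"
  assumes "process P" and "process Q"
    and "strongly_guarded P" and "strongly_guarded Q"
    and "rbr_bisim P Q"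
  shows "Ax\<^sub>r \<turnstile> P \<approx> Q"
proof -
  have good: "good P" "good Q"
    using assms(1-4) guarded_process_good unfolding strongly_guarded_def by blast+
  define R where "R = {S. reachable P S} \<union> {S. reachable Q S}"
  have refl: "reachable S S" for S :: "'a expr" by (simp add: reachable_def)
  have PQ: "P \<in> R" "Q \<in> R" using refl by (auto simp: R_def)
  interpret tau_wf R
  proof
    show "good S" if "S \<in> R" for S using that good reachable_good by (auto simp: R_def)
    show "S' \<in> R" if "S \<in> R" "transition S \<alpha> S'" for S S' \<alpha>
      using that unfolding R_def reachable_def by (auto intro: rtranclp.rtrancl_into_rtrancl)
    show "countable R" using good countable_reachable by (auto simp: R_def)
    have no: "\<not> (\<forall>i::nat. transition (f i) Tau (f (Suc i)))" if "f 0 \<in> R" for f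
      using that assms(3,4) unfolding strongly_guarded_def R_def by blast
    show "wf {(S', S). S \<in> R \<and> transition S Tau S'}"
      unfolding wf_iff_no_infinite_down_chain using no by auto
  qed
  obtain B T where BT: "rbr_bisimulation B T" "B P Q" using assms(5) unfolding rbr_bisim_def by blast
  have sim: "root_sim S S'" if B: "B S S'" for S S'
  proof -
    have T: "T S X S'" for X using rbr_bisimulation_env[OF BT(1) B] .
    show ?thesis
      unfolding root_sim_def using rbr_bisimulation_step[OF BT(1) B] rbr_bisimulation_tout[OF BT(1) T] by blast
  qed
  have "B Q P" using rbr_bisimulation_sym[OF BT] .
  then have "Ax\<^sub>r \<turnstile> H P \<approx> H Q" using sim BT(2) by (intro root_sim_H[OF PQ]) blast+
  then show ?thesis
    using derivable_H[OF PQ(1)] derivable.symmetry[OF derivable_H[OF PQ(2)]]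
    by (blast intro: derivable.transitivity)
qed

end
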